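(* Let $\mathbf X=(X,\mathcal E)$ be a coarse space, $\kappa>0$ a cardinal, and $\mathcal H_{\mathbf X}$ a discrete $\kappa$-ample $\mathbf X$-module of local rank at most $\kappa$. Let $\mathcal R^*(\mathcal H_{\mathbf X})$ be any of $C^*_{\mathrm{Roe}}(\mathcal H_{\mathbf X})$, $C^*_{\mathrm{cp}}(\mathcal H_{\mathbf X})$, $C^*_{\mathrm{ql}}(\mathcal H_{\mathbf X})$. Then there are canonical group homomorphisms $$\mathrm{CE}(\mathbf X)\to\mathrm{Out}(\mathcal R^*(\mathcal H_{\mathbf X})),$$ sending $\mathbf f$ to the class of $\mathrm{Ad}(u)$ for any unitary $u$ on $\mathcal H_{\mathbf X}$ covering $\mathbf f$, that are injective whenever $\mathcal M(\mathcal R^*(\mathcal H_{\mathbf X}))\subseteq C^*_{\mathrm{ql}}(\mathcal H_{\mathbf X})$.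
   Context: Relations. For subsets of $X\times X$: $R^{T}=\{(x,y):(y,x)\in R\}$; $R_2\circ R_1=\{(z,x):\exists y,\ (z,y)\in R_2,\ (y,x)\in R_1\}$; $R(A)=\{y:\exists a\in A,\ (y,a)\in R\}$. $B,A\subseteq X$ are $R$-separated if $B\cap R(A)=\emptyset$. A coarse structure on $X$ is a non-empty family $\mathcal E$ of subsets of $X\times X$, closed under subsets and finite unions, containing the diagonal $\Delta_X$, and closed under $E\mapsto E^T$ and under composition. A gauge is a symmetric element of $\mathcal E$ containing $\Delta_X$. $A\subseteq X$ is $E$-bounded if $A\times A\subseteq E$, and bounded if $A\times A\in\mathcal E$. $A\subseteq X$ is coarsely dense if $X=E(A)$ for some $E\in\mathcal E$. For relations $R,R'\subseteq X\times X$ write $R'\preccurlyeq R$ if $R'\subseteq F\circ R\circ E$ for some $E,F\in\mathcal E$, and $R\asymp R'$ if $R\preccurlyeq R'\preccurlyeq R$; a coarse subspace of $\mathbf X\times\mathbf X$ is an $\asymp$-class $[R]$. $R$ is controlled if $R\circ E\circ R^T\in\mathcal E$ for all $E\in\mathcal E$; $[R]$ is then a partial coarse map, and a coarse map $\mathbf X\to\mathbf X$ if in addition the projection of $R$ to the second coordinate (its domain) is coarsely dense. Coarse maps can be represented by (relations $\{(f(x),x)\}$ of) functions $f\colon X\to X$, and are composed by composing representing functions. A coarse equivalence is a coarse map $\mathbf f$ for which there is a coarse map $\mathbf g$ with $\mathbf f\circ\mathbf g=\mathbf g\circ\mathbf f=[\Delta_X]$. $\mathrm{CE}(\mathbf X)$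 is the group of coarse equivalences $\mathbf X\to\mathbf X$ under composition. An $\mathbf X$-module consists of a Boolean algebra $\mathfrak A$ of subsets of $X$ with $X\in\mathfrak A$ (its members are called measurable), a Hilbert space $\mathcal H$, and a map $\mathbb 1_\bullet$ from $\mathfrak A$ to projections in $\mathcal B(\mathcal H)$ with $\mathbb 1_\emptyset=0$, $\mathbb 1_X=1$, $\mathbb 1_{A\cap B}=\mathbb 1_A\mathbb 1_B$, $\mathbb 1_{A\cup B}=\mathbb 1_A+\mathbb 1_B-\mathbb 1_A\mathbb 1_B$, non-degenerate: for some gauge $\widetilde E$ the subspaces $\mathbb 1_A(\mathcal H)$ with $A$ measurable and $\widetilde E$-bounded span a dense subspace. It is $\kappa$-ample if for some gauge $\widetilde E$ the union of all measurable $\widetilde E$-bounded $A$ with $\mathbb 1_A\neq0$ is coarsely dense and $\mathbb 1_A$ has rank at least $\kappa$ for each such $A$. The rank of a projection is the cardinality of an orthonormal basis of its image; the module has local rank at most $\kappa$ if $\mathbb 1_A$ has rank at most $\kappa$ for every bounded measurable $A$. The module is discrete if there are a gauge $\widetilde E$ and a partition $X=\bigsqcup_{i\in I}A_i$ into measurable $\widetilde E$-bounded sets with $\sum_i\mathbb 1_{A_i}=1$ strongly, and such that every $C\subseteq X$ with $C\cap A_i\in\mathfrak A$ for all $i$ is in $\mathfrak A$. For $t\in\mathcal B(\mathcal H_{\mathbf X})$ and $S\subseteq X\times X$, $\mathrm{Supp}(t)\subseteq S$ means $\mathbb 1_Bt\mathbb 1_A=0$ for all $S$-separated measurable $B,A$.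 The coarse support $\mathbf{Supp}(t)$ is the (unique, always existing) coarse subspace $[S]$ with $\mathrm{Supp}(t)\subseteq S$ and $S\preccurlyeq R$ whenever $\mathrm{Supp}(t)\subseteq R$. $t$ covers $\mathbf f$ if $\mathbf{Supp}(t)=\mathbf f$; $t$ has controlled propagation if $\mathrm{Supp}(t)\subseteq E$ for some $E\in\mathcal E$; $t$ is quasi-local if for every $\varepsilon>0$ there is $E\in\mathcal E$ with $\|\mathbb 1_{A'}t\mathbb 1_A\|\le\varepsilon$ for all $E$-separated measurable $A',A$; $t$ is locally compact if $\mathbb 1_At$ and $t\mathbb 1_A$ are compact for every bounded measurable $A$. $C^*_{\mathrm{cp}}(\mathcal H)$ (resp. $C^*_{\mathrm{Roe}}(\mathcal H)$) is the norm closure of the operators of controlled propagation (resp. locally compact operators of controlled propagation); $C^*_{\mathrm{ql}}(\mathcal H)$ is the $C^*$-algebra of quasi-local operators. For a $C^*$-algebra $A\subseteq\mathcal B(\mathcal H)$, $\mathcal M(A)=\{t\in\mathcal B(\mathcal H): tA\subseteq A,\ At\subseteq A\}$; $\mathrm{Out}(A)$ is the quotient of $\mathrm{Aut}(A)$ by $\{\mathrm{Ad}(u):u\in\mathcal M(A)\text{ unitary}\}$, where $\mathrm{Ad}(u)(a)=uau^*$. *)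

theory Defs
  imports "HOL-Analysis.Analysis" "HOL-Algebra.Coset" "HOL-Algebra.Bij"
begin

unbundle cardinal_syntax

section \<open>Complex Hilbert spaces and their operators\<close>

text \<open>
  The complex structure is put on top of the underlying real Hilbert space, so that norm, topology
  and the Banach space of bounded real-linear maps \<open>'h \<Rightarrow>\<^sub>L 'h\<close> are those of the library.  The
  complex inner product is linear in its second argument.  Positivity of \<open>cinner\<close> and
  \<open>norm x = sqrt (Re (cinner x x))\<close> are inherited from \<^class>\<open>real_inner\<close>.
\<close>

class chilbert_space = real_inner + banach +
  fixes scaleC :: "complex \<Rightarrow> 'a \<Rightarrow> 'a"  (infixr \<open>*\<^sub>C\<close> 75)
    and cinner :: "'a \<Rightarrow> 'a \<Rightarrow> complex"
  assumes scaleC_add_right: "c *\<^sub>C (x + y) = c *\<^sub>C x + c *\<^sub>C y"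
    and scaleC_add_left: "(c + d) *\<^sub>C x = c *\<^sub>C x + d *\<^sub>C x"
    and scaleC_scaleC: "c *\<^sub>C (d *\<^sub>C x) = (c * d) *\<^sub>C x"
    and scaleR_scaleC: "r *\<^sub>R x = complex_of_real r *\<^sub>C x"
    and cinner_commute: "cinner x y = cnj (cinner y x)"
    and cinner_add_right: "cinner x (y + z) = cinner x y + cinner x z"
    and cinner_scaleC_right: "cinner x (c *\<^sub>C y) = c * cinner x y"
    and inner_eq_Re_cinner: "inner x y = Re (cinner x y)"

global_interpretation complex_vector: vector_space "scaleC :: complex \<Rightarrow> 'a \<Rightarrow> 'a::chilbert_space"
  defines cspan = complex_vector.span
proof unfold_locales
  show "1 *\<^sub>C x = x" for x :: 'a
    using scaleR_scaleC[of 1 x] by simp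
qed (simp_all add: scaleC_add_right scaleC_add_left scaleC_scaleC)

lemma norm_scaleC: "norm (c *\<^sub>C x) = cmod c * norm (x :: 'h::chilbert_space)"
proof -
  have "cinner (c *\<^sub>C x) (c *\<^sub>C x) = (c * cnj c) * cinner x x"
    by (metis cinner_commute cinner_scaleC_right complex_cnj_mult mult.assoc)
  also have "c * cnj c = complex_of_real ((cmod c)\<^sup>2)"
    by (metis complex_norm_square)
  finally have "inner (c *\<^sub>C x) (c *\<^sub>C x) = (cmod c)\<^sup>2 * inner x x"
    by (simp add: inner_eq_Re_cinner)
  then show ?thesis
    by (simp add: norm_eq_sqrt_inner real_sqrt_mult)
qed

lemma bounded_linear_scaleC: "bounded_linear (\<lambda>x :: 'h::chilbert_space. c *\<^sub>C x)"
proof (rule bounded_linear_intro[where K = "cmod c"])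
  show "c *\<^sub>C (r *\<^sub>R x) = r *\<^sub>R (c *\<^sub>C x)" for r and x :: 'h
    by (simp add: scaleR_scaleC scaleC_scaleC mult.commute)
qed (simp_all add: scaleC_add_right norm_scaleC mult.commute)

text \<open>\<open>bops\<close> is the algebra $\mathcal B(\mathcal H)$.\<close>

definition bops :: "('h::chilbert_space \<Rightarrow>\<^sub>L 'h) set" where
  "bops = {t :: 'h \<Rightarrow>\<^sub>L 'h. \<forall>c x. t (c *\<^sub>C x) = c *\<^sub>C t x}"

definition scaleC_op :: "complex \<Rightarrow> ('h::chilbert_space \<Rightarrow>\<^sub>L 'h) \<Rightarrow> ('h \<Rightarrow>\<^sub>L 'h)" where
  "scaleC_op c t = Blinfun (\<lambda>x. c *\<^sub>C t x)"

lemma scaleC_op_apply [simp]: "scaleC_op c t x = c *\<^sub>C t x"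
proof -
  have "bounded_linear (\<lambda>x. c *\<^sub>C t x)"
    using bounded_linear_compose[OF bounded_linear_scaleC blinfun.bounded_linear_right] .
  then show ?thesis
    by (simp add: scaleC_op_def bounded_linear_Blinfun_apply)
qed

definition adj :: "('h::chilbert_space \<Rightarrow>\<^sub>L 'h) \<Rightarrow> ('h \<Rightarrow>\<^sub>L 'h)" where
  "adj t = (THE s :: 'h \<Rightarrow>\<^sub>L 'h. \<forall>x y. cinner (t x) y = cinner x (s y))"

definition projection :: "('h::chilbert_space \<Rightarrow>\<^sub>L 'h) \<Rightarrow> bool" where
  "projection p \<longleftrightarrow> p \<in> bops \<and> p o\<^sub>L p = p \<and> (\<forall>x y. cinner (p x) y = cinner x (p y))"

definition unitary :: "('h::chilbert_space \<Rightarrow>\<^sub>L 'h) \<Rightarrow> bool" where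
  "unitary u \<longleftrightarrow> u \<in> bops \<and> adj u o\<^sub>L u = id_blinfun \<and> u o\<^sub>L adj u = id_blinfun"

definition compact_op :: "('h::chilbert_space \<Rightarrow>\<^sub>L 'h) \<Rightarrow> bool" where
  "compact_op t \<longleftrightarrow> compact (closure (blinfun_apply t ` cball 0 1))"

definition orthonormal_basis_of :: "'h::chilbert_space set \<Rightarrow> 'h set \<Rightarrow> bool" where
  "orthonormal_basis_of V B \<longleftrightarrow>
     (\<forall>x\<in>B. \<forall>y\<in>B. cinner x y = (if x = y then 1 else 0)) \<and> closure (cspan B) = V"

definition proj_rank :: "('h::chilbert_space \<Rightarrow>\<^sub>L 'h) \<Rightarrow> 'h rel" where
  "proj_rank p = |SOME B. orthonormal_basis_of (range (blinfun_apply p)) B|"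


section \<open>Coarse geometry\<close>

text \<open>
  A pair \<open>(y, x)\<close> in a relation is read as going from \<open>x\<close> to \<open>y\<close>.  With this convention the
  composite $R_2 \circ R_1$ is \<open>R\<^sub>2 O R\<^sub>1\<close>, whereas $R(A)$ is the image of \<open>A\<close> under the converse of \<open>R\<close>
  and the domain of \<open>R\<close> (the projection to the second coordinate) is \<^term>\<open>Range R\<close>.
\<close>

definition rapp :: "'x rel \<Rightarrow> 'x set \<Rightarrow> 'x set" where
  "rapp R A = {y. \<exists>a\<in>A. (y, a) \<in> R}"

definition separated :: "'x rel \<Rightarrow> 'x set \<Rightarrow> 'x set \<Rightarrow> bool" where
  "separated R B A \<longleftrightarrow> B \<inter> rapp R A = {}"

locale coarse_space =
  fixes X :: "'x set" and \<E> :: "'x rel set"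
  assumes sub_carrier: "\<E> \<subseteq> Pow (X \<times> X)"
    and diagonal: "Id_on X \<in> \<E>"
    and subset_closed: "E \<in> \<E> \<Longrightarrow> F \<subseteq> E \<Longrightarrow> F \<in> \<E>"
    and union_closed: "E \<in> \<E> \<Longrightarrow> F \<in> \<E> \<Longrightarrow> E \<union> F \<in> \<E>"
    and converse_closed: "E \<in> \<E> \<Longrightarrow> E\<inverse> \<in> \<E>"
    and comp_closed: "E \<in> \<E> \<Longrightarrow> F \<in> \<E> \<Longrightarrow> E O F \<in> \<E>"

definition gauge_of :: "'x set \<Rightarrow> 'x rel set \<Rightarrow> 'x rel \<Rightarrow> bool" where
  "gauge_of X \<E> E \<longleftrightarrow> E \<in> \<E> \<and> sym E \<and> Id_on X \<subseteq> E"

definition coarsely_bounded :: "'x rel set \<Rightarrow> 'x set \<Rightarrow> bool" where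
  "coarsely_bounded \<E> A \<longleftrightarrow> A \<times> A \<in> \<E>"

definition coarsely_dense :: "'x set \<Rightarrow> 'x rel set \<Rightarrow> 'x set \<Rightarrow> bool" where
  "coarsely_dense X \<E> A \<longleftrightarrow> A \<subseteq> X \<and> (\<exists>E\<in>\<E>. X = rapp E A)"

definition coarse_le :: "'x rel set \<Rightarrow> 'x rel \<Rightarrow> 'x rel \<Rightarrow> bool" where
  "coarse_le \<E> R' R \<longleftrightarrow> (\<exists>E\<in>\<E>. \<exists>F\<in>\<E>. R' \<subseteq> F O R O E)"

definition coarse_eq :: "'x rel set \<Rightarrow> 'x rel \<Rightarrow> 'x rel \<Rightarrow> bool" where
  "coarse_eq \<E> R R' \<longleftrightarrow> coarse_le \<E> R R' \<and> coarse_le \<E> R' R"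

definition coarse_class :: "'x set \<Rightarrow> 'x rel set \<Rightarrow> 'x rel \<Rightarrow> 'x rel set" where
  "coarse_class X \<E> R = {R'. R' \<subseteq> X \<times> X \<and> coarse_eq \<E> R R'}"

definition controlled_rel :: "'x rel set \<Rightarrow> 'x rel \<Rightarrow> bool" where
  "controlled_rel \<E> R \<longleftrightarrow> (\<forall>E\<in>\<E>. R O E O R\<inverse> \<in> \<E>)"

definition coarse_map :: "'x set \<Rightarrow> 'x rel set \<Rightarrow> 'x rel set \<Rightarrow> bool" where
  "coarse_map X \<E> F \<longleftrightarrow>
     (\<exists>R \<subseteq> X \<times> X. F = coarse_class X \<E> R \<and> controlled_rel \<E> R \<and> coarsely_dense X \<E> (Range R))"

definition graph_rel :: "'x set \<Rightarrow> ('x \<Rightarrow> 'x) \<Rightarrow> 'x rel" where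
  "graph_rel X f = {(f x, x) |x. x \<in> X}"

text \<open>
  Composition of coarse maps through representing functions; the class does not depend on
  the representatives.
\<close>

definition coarse_comp :: "'x set \<Rightarrow> 'x rel set \<Rightarrow> 'x rel set \<Rightarrow> 'x rel set \<Rightarrow> 'x rel set" where
  "coarse_comp X \<E> F G = (THE H. \<exists>f g. f \<in> X \<rightarrow> X \<and> g \<in> X \<rightarrow> X \<and>
     graph_rel X f \<in> F \<and> graph_rel X g \<in> G \<and> H = coarse_class X \<E> (graph_rel X (f \<circ> g)))"

definition coarse_equivalence :: "'x set \<Rightarrow> 'x rel set \<Rightarrow> 'x rel set \<Rightarrow> bool" where
  "coarse_equivalence X \<E> F \<longleftrightarrow> coarse_map X \<E> F \<and>
     (\<exists>G. coarse_map X \<E> G \<and> coarse_comp X \<E> F G = coarse_class X \<E> (Id_on X)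
                          \<and> coarse_comp X \<E> G F = coarse_class X \<E> (Id_on X))"

definition CE :: "'x set \<Rightarrow> 'x rel set \<Rightarrow> 'x rel set monoid" where
  "CE X \<E> = \<lparr>carrier = {F. coarse_equivalence X \<E> F}, mult = coarse_comp X \<E>,
             one = coarse_class X \<E> (Id_on X)\<rparr>"


section \<open>Modules over a coarse space\<close>

locale coarse_module = coarse_space X \<E> + algebra X \<AA>
  for X :: "'x set" and \<E> :: "'x rel set" and \<AA> :: "'x set set" +
  fixes P :: "'x set \<Rightarrow> ('h::chilbert_space \<Rightarrow>\<^sub>L 'h)"
  assumes proj: "A \<in> \<AA> \<Longrightarrow> projection (P A)"
    and proj_empty: "P {} = 0"
    and proj_carrier: "P X = id_blinfun"
    and proj_Int: "A \<in> \<AA> \<Longrightarrow> B \<in> \<AA> \<Longrightarrow> P (A \<inter> B) = P A o\<^sub>L P B"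
    and proj_Un: "A \<in> \<AA> \<Longrightarrow> B \<in> \<AA> \<Longrightarrow> P (A \<union> B) = P A + P B - (P A o\<^sub>L P B)"
    and nondegenerate: "\<exists>E. gauge_of X \<E> E \<and>
      closure (cspan (\<Union>A\<in>{A \<in> \<AA>. A \<times> A \<subseteq> E}. range (blinfun_apply (P A)))) = UNIV"

text \<open>Cardinals are cardinal orders \<open>\<kappa>\<close>; ranks are compared with them by \<open>\<le>o\<close>.\<close>

definition ample_module ::
  "'k rel \<Rightarrow> 'x set \<Rightarrow> 'x rel set \<Rightarrow> 'x set set \<Rightarrow> ('x set \<Rightarrow> ('h::chilbert_space \<Rightarrow>\<^sub>L 'h)) \<Rightarrow> bool" where
  "ample_module \<kappa> X \<E> \<AA> P \<longleftrightarrow> (\<exists>E. gauge_of X \<E> E \<and>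
     coarsely_dense X \<E> (\<Union>{A \<in> \<AA>. A \<times> A \<subseteq> E \<and> P A \<noteq> 0}) \<and>
     (\<forall>A\<in>\<AA>. A \<times> A \<subseteq> E \<and> P A \<noteq> 0 \<longrightarrow> \<kappa> \<le>o proj_rank (P A)))"

definition local_rank_at_most ::
  "'k rel \<Rightarrow> 'x rel set \<Rightarrow> 'x set set \<Rightarrow> ('x set \<Rightarrow> ('h::chilbert_space \<Rightarrow>\<^sub>L 'h)) \<Rightarrow> bool" where
  "local_rank_at_most \<kappa> \<E> \<AA> P \<longleftrightarrow>
     (\<forall>A\<in>\<AA>. coarsely_bounded \<E> A \<longrightarrow> proj_rank (P A) \<le>o \<kappa>)"

definition discrete_module ::
  "'x set \<Rightarrow> 'x rel set \<Rightarrow> 'x set set \<Rightarrow> ('x set \<Rightarrow> ('h::chilbert_space \<Rightarrow>\<^sub>L 'h)) \<Rightarrow> bool" where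
  "discrete_module X \<E> \<AA> P \<longleftrightarrow> (\<exists>E \<Q>. gauge_of X \<E> E \<and> partition_on X \<Q> \<and>
     (\<forall>A\<in>\<Q>. A \<in> \<AA> \<and> A \<times> A \<subseteq> E) \<and>
     (\<forall>h. ((\<lambda>A. P A h) has_sum h) \<Q>) \<and>
     (\<forall>C\<subseteq>X. (\<forall>A\<in>\<Q>. C \<inter> A \<in> \<AA>) \<longrightarrow> C \<in> \<AA>))"

definition supp_in ::
  "'x set set \<Rightarrow> ('x set \<Rightarrow> ('h::chilbert_space \<Rightarrow>\<^sub>L 'h)) \<Rightarrow> ('h \<Rightarrow>\<^sub>L 'h) \<Rightarrow> 'x rel \<Rightarrow> bool" where
  "supp_in \<AA> P t S \<longleftrightarrow> (\<forall>B\<in>\<AA>. \<forall>A\<in>\<AA>. separated S B A \<longrightarrow> P B o\<^sub>L t o\<^sub>L P A = 0)"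

text \<open>
  The class below exists for every operator on a coarse module, and it is unique because two
  relations \<open>S\<close> with the stated minimality property are mutually \<^const>\<open>coarse_le\<close>.
\<close>

definition coarse_support ::
  "'x set \<Rightarrow> 'x rel set \<Rightarrow> 'x set set \<Rightarrow> ('x set \<Rightarrow> ('h::chilbert_space \<Rightarrow>\<^sub>L 'h)) \<Rightarrow> ('h \<Rightarrow>\<^sub>L 'h) \<Rightarrow> 'x rel set"
  where
  "coarse_support X \<E> \<AA> P t = (THE F. \<exists>S \<subseteq> X \<times> X. F = coarse_class X \<E> S \<and> supp_in \<AA> P t S \<and>
     (\<forall>R \<subseteq> X \<times> X. supp_in \<AA> P t R \<longrightarrow> coarse_le \<E> S R))"

definition covers ::
  "'x set \<Rightarrow> 'x rel set \<Rightarrow> 'x set set \<Rightarrow> ('x set \<Rightarrow> ('h::chilbert_space \<Rightarrow>\<^sub>L 'h)) \<Rightarrow> ('h \<Rightarrow>\<^sub>L 'h) \<Rightarrow> 'x rel set \<Rightarrow> bool"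
  where
  "covers X \<E> \<AA> P t F \<longleftrightarrow> coarse_support X \<E> \<AA> P t = F"

definition controlled_propagation ::
  "'x rel set \<Rightarrow> 'x set set \<Rightarrow> ('x set \<Rightarrow> ('h::chilbert_space \<Rightarrow>\<^sub>L 'h)) \<Rightarrow> ('h \<Rightarrow>\<^sub>L 'h) \<Rightarrow> bool" where
  "controlled_propagation \<E> \<AA> P t \<longleftrightarrow> (\<exists>E\<in>\<E>. supp_in \<AA> P t E)"

definition quasi_local ::
  "'x rel set \<Rightarrow> 'x set set \<Rightarrow> ('x set \<Rightarrow> ('h::chilbert_space \<Rightarrow>\<^sub>L 'h)) \<Rightarrow> ('h \<Rightarrow>\<^sub>L 'h) \<Rightarrow> bool" where
  "quasi_local \<E> \<AA> P t \<longleftrightarrow> (\<forall>\<epsilon>>0. \<exists>E\<in>\<E>. \<forall>B\<in>\<AA>. \<forall>A\<in>\<AA>.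
     separated E B A \<longrightarrow> norm (P B o\<^sub>L t o\<^sub>L P A) \<le> \<epsilon>)"

definition locally_compact_op ::
  "'x rel set \<Rightarrow> 'x set set \<Rightarrow> ('x set \<Rightarrow> ('h::chilbert_space \<Rightarrow>\<^sub>L 'h)) \<Rightarrow> ('h \<Rightarrow>\<^sub>L 'h) \<Rightarrow> bool" where
  "locally_compact_op \<E> \<AA> P t \<longleftrightarrow>
     (\<forall>A\<in>\<AA>. coarsely_bounded \<E> A \<longrightarrow> compact_op (P A o\<^sub>L t) \<and> compact_op (t o\<^sub>L P A))"

definition Ccp ::
  "'x rel set \<Rightarrow> 'x set set \<Rightarrow> ('x set \<Rightarrow> ('h::chilbert_space \<Rightarrow>\<^sub>L 'h)) \<Rightarrow> ('h \<Rightarrow>\<^sub>L 'h) set" where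
  "Ccp \<E> \<AA> P = closure {t \<in> bops. controlled_propagation \<E> \<AA> P t}"

definition CRoe ::
  "'x rel set \<Rightarrow> 'x set set \<Rightarrow> ('x set \<Rightarrow> ('h::chilbert_space \<Rightarrow>\<^sub>L 'h)) \<Rightarrow> ('h \<Rightarrow>\<^sub>L 'h) set" where
  "CRoe \<E> \<AA> P =
     closure {t \<in> bops. locally_compact_op \<E> \<AA> P t \<and> controlled_propagation \<E> \<AA> P t}"

definition Cql ::
  "'x rel set \<Rightarrow> 'x set set \<Rightarrow> ('x set \<Rightarrow> ('h::chilbert_space \<Rightarrow>\<^sub>L 'h)) \<Rightarrow> ('h \<Rightarrow>\<^sub>L 'h) set" where
  "Cql \<E> \<AA> P = {t \<in> bops. quasi_local \<E> \<AA> P t}"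


section \<open>Outer automorphisms of concrete C*-algebras\<close>

definition multipliers :: "('h::chilbert_space \<Rightarrow>\<^sub>L 'h) set \<Rightarrow> ('h \<Rightarrow>\<^sub>L 'h) set" where
  "multipliers A = {t \<in> bops. (\<forall>a\<in>A. t o\<^sub>L a \<in> A) \<and> (\<forall>a\<in>A. a o\<^sub>L t \<in> A)}"

text \<open>
  As in \<^const>\<open>BijGroup\<close>, self-maps of \<open>A\<close> are represented by functions that are extensional on \<open>A\<close>.
\<close>

definition star_automorphisms ::
  "('h::chilbert_space \<Rightarrow>\<^sub>L 'h) set \<Rightarrow> (('h \<Rightarrow>\<^sub>L 'h) \<Rightarrow> ('h \<Rightarrow>\<^sub>L 'h)) set" where
  "star_automorphisms A = {\<phi> \<in> Bij A.
     (\<forall>a\<in>A. \<forall>b\<in>A. \<phi> (a + b) = \<phi> a + \<phi> b) \<and>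
     (\<forall>c. \<forall>a\<in>A. \<phi> (scaleC_op c a) = scaleC_op c (\<phi> a)) \<and>
     (\<forall>a\<in>A. \<forall>b\<in>A. \<phi> (a o\<^sub>L b) = \<phi> a o\<^sub>L \<phi> b) \<and>
     (\<forall>a\<in>A. \<phi> (adj a) = adj (\<phi> a))}"

definition Aut :: "('h::chilbert_space \<Rightarrow>\<^sub>L 'h) set \<Rightarrow> (('h \<Rightarrow>\<^sub>L 'h) \<Rightarrow> ('h \<Rightarrow>\<^sub>L 'h)) monoid" where
  "Aut A = BijGroup A \<lparr>carrier := star_automorphisms A\<rparr>"

definition Ad :: "('h::chilbert_space \<Rightarrow>\<^sub>L 'h) set \<Rightarrow> ('h \<Rightarrow>\<^sub>L 'h) \<Rightarrow> ('h \<Rightarrow>\<^sub>L 'h) \<Rightarrow> ('h \<Rightarrow>\<^sub>L 'h)" where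
  "Ad A u = (\<lambda>a\<in>A. u o\<^sub>L a o\<^sub>L adj u)"

definition Inn :: "('h::chilbert_space \<Rightarrow>\<^sub>L 'h) set \<Rightarrow> (('h \<Rightarrow>\<^sub>L 'h) \<Rightarrow> ('h \<Rightarrow>\<^sub>L 'h)) set" where
  "Inn A = {Ad A u |u. u \<in> multipliers A \<and> unitary u}"

definition Out :: "('h::chilbert_space \<Rightarrow>\<^sub>L 'h) set \<Rightarrow> (('h \<Rightarrow>\<^sub>L 'h) \<Rightarrow> ('h \<Rightarrow>\<^sub>L 'h)) set monoid" where
  "Out A = Aut A Mod Inn A"

definition Out_class ::
  "('h::chilbert_space \<Rightarrow>\<^sub>L 'h) set \<Rightarrow> (('h \<Rightarrow>\<^sub>L 'h) \<Rightarrow> ('h \<Rightarrow>\<^sub>L 'h)) \<Rightarrow> (('h \<Rightarrow>\<^sub>L 'h) \<Rightarrow> ('h \<Rightarrow>\<^sub>L 'h)) set" where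
  "Out_class A \<phi> = Inn A #>\<^bsub>Aut A\<^esub> \<phi>"

end

theory Submission
  imports Defs
begin

text \<open>
  Call \<open>t\<close> a tracker of a map \<open>f\<close> if $\mathrm{Supp}(t)$ is coarsely contained in $[f]$.  On a discrete module
  trackers compose, and the adjoint of a tracker of a coarse equivalence tracks a coarse inverse.  Hence a
  unitary covering \<open>f\<close> conjugates each of the three algebras onto itself, and two unitaries covering the same
  \<open>f\<close> differ by a unitary of controlled propagation, which is a multiplier.  Covering unitaries exist
  because \<open>X\<close> can be partitioned, along the fibres of \<open>f\<close> and along a coarse retraction onto its image, into
  bounded sets whose ranks are both at least and at most \<open>\<kappa>\<close>; matching orthonormal bases fibrewise gives
  the unitary, for finite \<open>\<kappa>\<close> as well.  Injectivity uses the rank-one operators in the algebra: if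
  $\mathrm{Ad}(u) = \mathrm{Ad}(m v)$ on them, then the quasi-local unitary \<open>m\<close> maps $v h$ to a multiple of $u h$ for
  every \<open>h\<close> of bounded support, so the maps covered by \<open>u\<close> and \<open>v\<close> are close.
\<close>

section \<open>Complex Hilbert spaces\<close>

text \<open>Vanishing corners of \<open>s\<close> and \<open>t\<close> say little about their
  product unless the vectors in between can be cut by a measurable set. Discreteness removes this
  obstacle: unions of pieces are measurable and the pieces resolve the identity strongly, so an
  operator of controlled support can be recorded by where it pushes the range of each
  \<open>P A\<close>. Ampleness speaks of sets unrelated to the pieces; these sets are first traded
  for nearby pieces of rank at least \<kappa>, and the space is retracted onto such pieces before
  ranks are compared. The Roe algebra may have no unit, and an abstract automorphism comes with no
  extension to multipliers, so normality of the inner automorphisms is drawn from nondegeneracy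
  instead. Rank-one operators with bounded support lie in all three algebras, and they supply this
  nondegeneracy as well as injectivity.\<close>

lemma cinner_add_left: "cinner (x + y) z = cinner x z + cinner (y::'h::chilbert_space) z"
  by (metis cinner_add_right cinner_commute complex_cnj_add)

lemma cinner_scaleC_left [simp]: "cinner (c *\<^sub>C x) (y::'h::chilbert_space) = cnj c * cinner x y"
  by (metis cinner_commute cinner_scaleC_right complex_cnj_mult)

declare cinner_scaleC_right [simp]

lemma cinner_norm_sq: "cinner x x = complex_of_real ((norm (x::'h::chilbert_space))\<^sup>2)"
proof (rule complex_eqI)
  show "Re (cinner x x) = Re (complex_of_real ((norm x)\<^sup>2))"
    by (simp add: inner_eq_Re_cinner [symmetric] power2_norm_eq_inner)
  have "Im (cinner x x) = Im (cnj (cinner x x))"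
    by (metis cinner_commute)
  then show "Im (cinner x x) = Im (complex_of_real ((norm x)\<^sup>2))"
    by simp
qed

lemma cmod_cinner_le: "cmod (cinner x y) \<le> norm x * norm (y::'h::chilbert_space)"
proof (cases "cinner x y = 0")
  case False
  \<comment> \<open>Rotating \<open>y\<close> by this phase makes the inner product real and
    nonnegative, so the Cauchy-Schwarz inequality of the underlying real space applies.\<close>
  define c where "c = cnj (sgn (cinner x y))"
  have "c * cinner x y = complex_of_real (cmod (cinner x y))"
    using False complex_norm_square [of "cinner x y"]
    by (simp add: c_def sgn_eq power2_eq_square mult.commute field_simps)
  then have "cmod (cinner x y) = inner x (c *\<^sub>C y)"
    by (simp add: inner_eq_Re_cinner)
  also have "\<dots> \<le> norm x * norm (c *\<^sub>C y)"
    by (rule norm_cauchy_schwarz)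
  also have "\<dots> = norm x * norm y"
    using False by (simp add: c_def norm_scaleC norm_sgn)
  finally show ?thesis .
qed simp

text \<open>Common first step of many norm bounds below: once a squared norm is recognised as an
  inner product, Cauchy-Schwarz applies and usually one factor cancels.\<close>

lemma norm_sq_le_if_eq_cinner:
  "complex_of_real ((norm a)\<^sup>2) = cinner x y \<Longrightarrow> (norm a)\<^sup>2 \<le> norm x * norm (y::'h::chilbert_space)"
  using cmod_cinner_le [of x y] by (metis abs_of_nonneg norm_of_real zero_le_power2)

interpretation cinner: bounded_bilinear "cinner :: 'h::chilbert_space \<Rightarrow> 'h \<Rightarrow> complex"
proof
  show "\<exists>K. \<forall>a b :: 'h. norm (cinner a b) \<le> norm a * norm b * K"
    by (rule exI [of _ 1]) (simp add: cmod_cinner_le)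
qed (simp_all add: cinner_add_left cinner_add_right scaleR_scaleC scaleR_conv_of_real)

interpretation scaleC: bounded_bilinear "scaleC :: complex \<Rightarrow> 'h::chilbert_space \<Rightarrow> 'h"
proof
  show "\<exists>K. \<forall>a b. norm (a *\<^sub>C (b::'h)) \<le> norm a * norm b * K"
    by (rule exI [of _ 1]) (simp add: norm_scaleC)
qed (simp_all add: scaleC_add_left scaleC_add_right scaleR_scaleC scaleC_scaleC scaleR_conv_of_real
    mult.commute)

lemma scaleC_one [simp]: "1 *\<^sub>C (x::'h::chilbert_space) = x"
  using scaleR_scaleC [of 1 x] by simp

lemma cinner_eq_zero_commute: "cinner x y = 0 \<longleftrightarrow> cinner y (x::'h::chilbert_space) = 0"
  by (metis cinner_commute complex_cnj_zero)

lemma cinner_self_eq_zero [simp]: "cinner x x = 0 \<longleftrightarrow> (x::'h::chilbert_space) = 0"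
  by (simp add: cinner_norm_sq)

lemma cinner_eqI: "(\<And>x. cinner x y = cinner x z) \<Longrightarrow> y = (z::'h::chilbert_space)"
  by (metis cinner.diff_right cinner_self_eq_zero eq_iff_diff_eq_0)

lemma csubspace_closure:
  assumes "complex_vector.subspace (S::'h::chilbert_space set)"
  shows "complex_vector.subspace (closure S)"
proof (rule complex_vector.subspaceI)
  show "0 \<in> closure S"
    using assms closure_subset complex_vector.subspace_0 by blast
next
  fix x y assume "x \<in> closure S" "y \<in> closure S"
  then obtain f g where "\<forall>n. f n \<in> S" "f \<longlonglongrightarrow> x" "\<forall>n. g n \<in> S" "g \<longlonglongrightarrow> y"
    unfolding closure_sequential by blast
  then have "\<forall>n. f n + g n \<in> S" "(\<lambda>n. f n + g n) \<longlonglongrightarrow> x + y"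
    using assms by (auto intro: tendsto_add simp: complex_vector.subspace_add)
  then show "x + y \<in> closure S"
    unfolding closure_sequential by (intro exI [of _ "\<lambda>n. f n + g n"]) blast
next
  fix c x assume "x \<in> closure S"
  then obtain f where "\<forall>n. f n \<in> S" "f \<longlonglongrightarrow> x"
    unfolding closure_sequential by blast
  then have "\<forall>n. c *\<^sub>C f n \<in> S" "(\<lambda>n. c *\<^sub>C f n) \<longlonglongrightarrow> c *\<^sub>C x"
    using assms by (auto intro: scaleC.tendsto simp: complex_vector.subspace_scale)
  then show "c *\<^sub>C x \<in> closure S"
    unfolding closure_sequential by (intro exI [of _ "\<lambda>n. c *\<^sub>C f n"]) blast
qed

lemma closure_cspan_minimal:
  assumes "B \<subseteq> V" "complex_vector.subspace V" "closed (V::'h::chilbert_space set)"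
  shows "closure (cspan B) \<subseteq> V"
  using assms by (simp add: closure_minimal complex_vector.span_minimal)

subsection \<open>Orthonormal sets\<close>

definition orthonormal :: "'h::chilbert_space set \<Rightarrow> bool" where
  "orthonormal B \<longleftrightarrow> (\<forall>x\<in>B. \<forall>y\<in>B. cinner x y = (if x = y then 1 else 0))"

lemma orthonormal_cinner_sum:
  assumes "orthonormal B" "finite F" "F \<subseteq> B" "b \<in> B"
  shows "cinner b (\<Sum>a\<in>F. c a *\<^sub>C a) = (if b \<in> F then c b else 0)"
proof -
  have "cinner b (\<Sum>a\<in>F. c a *\<^sub>C a) = (\<Sum>a\<in>F. if a = b then c b else 0)"
    unfolding cinner.sum_right
    using assms by (intro sum.cong) (auto simp: orthonormal_def subset_iff)
  then show ?thesis
    using assms by simp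
qed

lemma orthonormal_norm_sum:
  assumes "orthonormal B" "finite F" "F \<subseteq> B"
  shows "(norm (\<Sum>a\<in>F. c a *\<^sub>C a))\<^sup>2 = (\<Sum>a\<in>F. (cmod (c a))\<^sup>2)"
proof -
  have "cinner (\<Sum>a\<in>F. c a *\<^sub>C a) (\<Sum>a\<in>F. c a *\<^sub>C a) = (\<Sum>b\<in>F. cnj (c b) * c b)"
    unfolding cinner.sum_left [of _ F]
    using assms by (intro sum.cong) (auto simp: orthonormal_cinner_sum subset_iff)
  also have "\<dots> = complex_of_real (\<Sum>a\<in>F. (cmod (c a))\<^sup>2)"
    by (simp add: complex_norm_square mult.commute del: of_real_power)
  finally show ?thesis
    by (simp only: cinner_norm_sq of_real_eq_iff)
qed

text \<open>The Fourier sum \<open>w\<close> over \<open>F\<close> satisfies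
  \<open>cinner w x = norm w ^ 2\<close>, so Cauchy-Schwarz already yields
  \<open>norm w \<le> norm x\<close>.\<close>

lemma Bessel_inequality:
  assumes "orthonormal B" "finite F" "F \<subseteq> B"
  shows "(\<Sum>b\<in>F. (cmod (cinner b x))\<^sup>2) \<le> (norm x)\<^sup>2"
proof -
  define w where "w = (\<Sum>b\<in>F. cinner b x *\<^sub>C b)"
  have w: "(norm w)\<^sup>2 = (\<Sum>b\<in>F. (cmod (cinner b x))\<^sup>2)"
    unfolding w_def by (rule orthonormal_norm_sum [OF assms])
  have "cinner w x = (\<Sum>b\<in>F. cnj (cinner b x) * cinner b x)"
    unfolding w_def cinner.sum_left by simp
  also have "\<dots> = complex_of_real (\<Sum>b\<in>F. (cmod (cinner b x))\<^sup>2)"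
    by (simp add: complex_norm_square mult.commute del: of_real_power)
  finally have "complex_of_real ((norm w)\<^sup>2) = cinner w x"
    using w by simp
  then have "(norm w)\<^sup>2 \<le> norm w * norm x"
    by (rule norm_sq_le_if_eq_cinner)
  then have "norm w \<le> norm x"
    by (cases "norm w = 0") (auto simp: power2_eq_square)
  then show ?thesis
    using w by (metis norm_ge_zero power_mono)
qed

text \<open>\<open>B\<close> may be uncountable. Finite sets \<open>F n\<close> whose square sums
  approach the supremum \<open>s\<close> leave a mass of at most \<open>1 / (n + 1)\<close> outside,
  so the sums over \<open>F n\<close> are Cauchy. An index lying in none of the \<open>F n\<close>
  has coefficient 0, so the limit is right there too.\<close>

lemma Riesz_Fischer:
  fixes B :: "'h::chilbert_space set"
  assumes B: "orthonormal B"
    and bound: "\<And>F. finite F \<Longrightarrow> F \<subseteq> B \<Longrightarrow> (\<Sum>b\<in>F. (cmod (c b))\<^sup>2) \<le> K"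
  obtains y where "y \<in> closure (cspan B)" "\<And>b. b \<in> B \<Longrightarrow> cinner b y = c b"
proof -
  define g where "g F = (\<Sum>b\<in>F. (cmod (c b))\<^sup>2)" for F
  define \<F> where "\<F> = {F. finite F \<and> F \<subseteq> B}"
  define s where "s = (SUP F\<in>\<F>. g F)"
  have bdd: "bdd_above (g ` \<F>)"
    using bound by (auto simp: g_def \<F>_def intro!: bdd_aboveI [of _ K])
  have ne: "\<F> \<noteq> {}"
    by (auto simp: \<F>_def)
  have "\<exists>F\<in>\<F>. s - inverse (real (Suc n)) < g F" for n
    using less_cSUP_iff [OF ne bdd, of "s - inverse (real (Suc n))"] unfolding s_def by simp
  then obtain F where F: "\<And>n. F n \<in> \<F>" "\<And>n. s - inverse (real (Suc n)) < g (F n)"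
    by metis
  have finF: "finite (F n)" "F n \<subseteq> B" for n
    using F(1) [of n] by (auto simp: \<F>_def)
  have small: "g G \<le> inverse (real (Suc n))" if "G \<in> \<F>" "G \<inter> F n = {}" for G n
  proof -
    have "g (G \<union> F n) = g G + g (F n)"
      unfolding g_def using that finF by (intro sum.union_disjoint) (auto simp: \<F>_def)
    moreover have "g (G \<union> F n) \<le> s"
      unfolding s_def using that F(1) [of n] by (intro cSUP_upper bdd) (auto simp: \<F>_def)
    ultimately show ?thesis
      using F(2) [of n] by linarith
  qed
  define y where "y n = (\<Sum>b\<in>F n. c b *\<^sub>C b)" for n
  define r where "r n = sqrt (inverse (real (Suc n)))" for n
  have r0: "r \<longlonglongrightarrow> 0"
    unfolding r_def using tendsto_real_sqrt [OF LIMSEQ_inverse_real_of_nat] by simp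
  have nrm: "norm (\<Sum>b\<in>F m - F n. c b *\<^sub>C b) \<le> r n" for m n
  proof -
    have "(norm (\<Sum>b\<in>F m - F n. c b *\<^sub>C b))\<^sup>2 = g (F m - F n)"
      unfolding g_def using finF by (intro orthonormal_norm_sum [OF B]) auto
    also have "\<dots> \<le> inverse (real (Suc n))"
      using finF [of m] by (intro small) (auto simp: \<F>_def)
    finally show ?thesis
      unfolding r_def by (rule real_le_rsqrt)
  qed
  \<comment> \<open>The sets \<open>F n\<close> are not nested; both sums are compared with the sum
    over the common part.\<close>
  have diff: "norm (y m - y n) \<le> r n + r m" for m n
  proof -
    have "y m = (\<Sum>b\<in>F m - F n. c b *\<^sub>C b) + (\<Sum>b\<in>F m \<inter> F n. c b *\<^sub>C b)"
      unfolding y_def using sum.Int_Diff [OF finF(1) [of m], of _ "F n"] by (simp add: add.commute)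
    moreover have "y n = (\<Sum>b\<in>F n - F m. c b *\<^sub>C b) + (\<Sum>b\<in>F m \<inter> F n. c b *\<^sub>C b)"
      unfolding y_def using sum.Int_Diff [OF finF(1) [of n], of _ "F m"]
        by (simp add: add.commute Int_commute)
    ultimately have "y m - y n = (\<Sum>b\<in>F m - F n. c b *\<^sub>C b) - (\<Sum>b\<in>F n - F m. c b *\<^sub>C b)"
      by simp
    then show ?thesis
      using add_mono [OF nrm [of m n] nrm [of n m]] norm_triangle_ineq4 order_trans by metis
  qed
  have "Cauchy y"
  proof (rule CauchyI)
    fix e :: real assume "e > 0"
    then have "\<forall>\<^sub>F n in sequentially. r n < e / 2"
      using r0 by (intro order_tendstoD) auto
    then obtain N where "\<And>n. n \<ge> N \<Longrightarrow> r n < e / 2"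
      unfolding eventually_sequentially by blast
    then have "norm (y m - y n) < e" if "m \<ge> N" "n \<ge> N" for m n
    proof -
      have "r n < e / 2" "r m < e / 2"
        using \<open>\<And>n. n \<ge> N \<Longrightarrow> r n < e / 2\<close> that by auto
      then show ?thesis
        using diff [of m n] by linarith
    qed
    then show "\<exists>M. \<forall>m\<ge>M. \<forall>n\<ge>M. norm (y m - y n) < e"
      by blast
  qed
  then obtain l where l: "y \<longlonglongrightarrow> l"
    by (auto simp: Cauchy_convergent_iff convergent_def)
  show thesis
  proof
    have "y n \<in> cspan B" for n
      unfolding y_def using finF
      by (intro complex_vector.span_sum complex_vector.span_scale complex_vector.span_base) auto
    then show "l \<in> closure (cspan B)"
      using l unfolding closure_sequential by blast
    fix b assume b: "b \<in> B"
    have "norm (cinner b (y n) - c b) \<le> r n" for n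
    proof (cases "b \<in> F n")
      case True
      then show ?thesis
        using orthonormal_cinner_sum [OF B finF [of n] b, of c] by (simp add: y_def r_def)
    next
      case False
      then have "g {b} \<le> inverse (real (Suc n))"
        using b by (intro small) (auto simp: \<F>_def)
      then have "cmod (c b) \<le> r n"
        unfolding r_def by (intro real_le_rsqrt) (simp add: g_def)
      then show ?thesis
        using orthonormal_cinner_sum [OF B finF [of n] b, of c] False by (simp add: y_def)
    qed
    then have "(\<lambda>n. cinner b (y n) - c b) \<longlonglongrightarrow> 0"
      by (intro Lim_null_comparison [OF _ r0] always_eventually allI)
    then have "(\<lambda>n. cinner b (y n)) \<longlonglongrightarrow> c b"
      by (rule LIM_zero_cancel)
    moreover have "(\<lambda>n. cinner b (y n)) \<longlonglongrightarrow> cinner b l"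
      by (intro cinner.tendsto tendsto_const l)
    ultimately show "cinner b l = c b"
      using LIMSEQ_unique by blast
  qed
qed

lemma csubspace_orth: "complex_vector.subspace {x::'h::chilbert_space. cinner x y = 0}"
  by (rule complex_vector.subspaceI) (simp_all add: cinner_add_left cinner.zero_left)

lemma closed_orth: "closed {x::'h::chilbert_space. cinner x y = 0}"
  by (intro closed_Collect_eq continuous_intros cinner.continuous_on)

lemma orth_closure_cspan:
  assumes "\<And>b. b \<in> B \<Longrightarrow> cinner b y = 0" "x \<in> closure (cspan B)"
  shows "cinner x y = 0"
  using closure_cspan_minimal [OF _ csubspace_orth closed_orth, of B y] assms by blast

lemma orthonormal_basis_of_iff: "orthonormal_basis_of V B \<longleftrightarrow> orthonormal B \<and> closure (cspan B) = V"
  by (simp add: orthonormal_basis_of_def orthonormal_def)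

lemma orthonormal_basis_of_subset: "orthonormal_basis_of V B \<Longrightarrow> B \<subseteq> V"
  by (metis closure_subset complex_vector.span_superset orthonormal_basis_of_iff order_trans)

lemma orthonormal_basis_of_orth:
  "orthonormal_basis_of V B \<Longrightarrow> x \<in> V \<Longrightarrow> (\<And>b. b \<in> B \<Longrightarrow> cinner b x = 0) \<Longrightarrow> x = 0"
  by (metis cinner_self_eq_zero orth_closure_cspan orthonormal_basis_of_iff)

text \<open>Bessel and Riesz-Fischer give a vector \<open>y\<close> in the closed span with the same
  coefficients as \<open>x\<close>. Then \<open>x - y\<close> lies in \<open>V\<close> and is
  orthogonal to \<open>B\<close>, so maximality forces \<open>x = y\<close>.\<close>

lemma orthonormal_basis_ofI:
  fixes V :: "'h::chilbert_space set"
  assumes B: "orthonormal B" and V: "B \<subseteq> V" "complex_vector.subspace V" "closed V"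
    and max: "\<And>x. x \<in> V \<Longrightarrow> (\<And>b. b \<in> B \<Longrightarrow> cinner b x = 0) \<Longrightarrow> x = 0"
  shows "orthonormal_basis_of V B"
proof -
  have sub: "closure (cspan B) \<subseteq> V"
    using V by (rule closure_cspan_minimal)
  have "x \<in> closure (cspan B)" if x: "x \<in> V" for x
  proof -
    obtain y where y: "y \<in> closure (cspan B)" "\<And>b. b \<in> B \<Longrightarrow> cinner b y = cinner b x"
      using Riesz_Fischer [OF B, of "\<lambda>b. cinner b x"] Bessel_inequality [OF B] by metis
    have "x - y = 0"
      using x y sub V by (intro max) (auto simp: cinner.diff_right complex_vector.subspace_diff)
    then show ?thesis
      using y by simp
  qed
  then show ?thesis
    using B sub by (auto simp: orthonormal_basis_of_iff)
qed

lemma orthonormal_insert: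
  fixes x :: "'h::chilbert_space"
  assumes "orthonormal B" "\<And>b. b \<in> B \<Longrightarrow> cinner b x = 0" "cinner x x = 1"
  shows "orthonormal (insert x B)"
  using assms unfolding orthonormal_def
  by (metis cinner_eq_zero_commute insert_iff zero_neq_one)

lemma ex_orthonormal_basis_of:
  fixes V :: "'h::chilbert_space set"
  assumes V: "complex_vector.subspace V" "closed V"
  obtains B where "orthonormal_basis_of V B"
proof -
  let ?S = "{B. orthonormal B \<and> B \<subseteq> V}"
  have "\<exists>M\<in>?S. \<forall>B\<in>?S. M \<subseteq> B \<longrightarrow> B = M"
  proof (rule subset_Zorn_nonempty)
    show "?S \<noteq> {}"
      by (auto simp: orthonormal_def)
    fix \<C> assume "\<C> \<noteq> {}" and ch: "subset.chain ?S \<C>"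
    have sub: "\<And>B. B \<in> \<C> \<Longrightarrow> orthonormal B \<and> B \<subseteq> V"
      and total: "\<And>B C. B \<in> \<C> \<Longrightarrow> C \<in> \<C> \<Longrightarrow> B \<subseteq> C \<or> C \<subseteq> B"
      using ch unfolding subset_chain_def by blast+
    have "cinner x y = (if x = y then 1 else 0)" if x: "x \<in> \<Union>\<C>" and y: "y \<in> \<Union>\<C>" for x y
    proof -
      obtain B C where "B \<in> \<C>" "C \<in> \<C>" "x \<in> B" "y \<in> C"
        using x y by blast
      then obtain D where "D \<in> \<C>" "x \<in> D" "y \<in> D"
        using total by (metis subset_iff)
      then show ?thesis
        using sub unfolding orthonormal_def by blast
    qed
    then show "\<Union>\<C> \<in> ?S"
      using sub unfolding orthonormal_def by blast
  qed
  then obtain M where M: "orthonormal M" "M \<subseteq> V"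
      and max: "\<And>B. orthonormal B \<Longrightarrow> B \<subseteq> V \<Longrightarrow> M \<subseteq> B \<Longrightarrow> B = M"
    by auto
  have "x = 0" if x: "x \<in> V" "\<And>b. b \<in> M \<Longrightarrow> cinner b x = 0" for x
  proof (rule ccontr)
    assume "x \<noteq> 0"
    define e where "e = complex_of_real (inverse (norm x)) *\<^sub>C x"
    have e: "cinner e e = 1"
      using \<open>x \<noteq> 0\<close> by (simp add: cinner_norm_sq e_def norm_scaleC norm_inverse)
    have "insert e M = M"
      using M x e V by (intro max orthonormal_insert) (auto simp: e_def
        complex_vector.subspace_scale)
    then have "cinner e x = 0"
      using x by auto
    then show False
      using e \<open>x \<noteq> 0\<close> by (simp add: e_def)
  qed
  then show thesis
    using that orthonormal_basis_ofI [OF M V] by blast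
qed

text \<open>Double counting of the squared coefficients between \<open>F\<close> and
  \<open>C\<close>: each \<open>e\<close> in \<open>F\<close> contributes exactly 1 by Parseval in
  \<open>W\<close>, and each \<open>b\<close> in \<open>C\<close> at most 1 by Bessel for
  \<open>F\<close>.\<close>

lemma orthonormal_finite_bound:
  assumes BV: "orthonormal_basis_of V B" and W: "orthonormal_basis_of W C" "finite C"
    and F: "finite F" "F \<subseteq> B" and sub: "V \<subseteq> W"
  shows "card F \<le> card C"
proof -
  have oB: "orthonormal B" and oC: "orthonormal C"
    using BV W by (auto simp: orthonormal_basis_of_iff)
  have Pars: "(\<Sum>b\<in>C. (cmod (cinner b e))\<^sup>2) = 1" if e: "e \<in> F" for e
  proof -
    have eB: "e \<in> B" "e \<in> V"
      using e F orthonormal_basis_of_subset [OF BV] by auto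
    obtain y where y: "y \<in> closure (cspan C)" and cy: "\<And>b. b \<in> C \<Longrightarrow> cinner b y = cinner b e"
      and y_def: "y = (\<Sum>b\<in>C. cinner b e *\<^sub>C b)"
    proof
      show "(\<Sum>b\<in>C. cinner b e *\<^sub>C b) \<in> closure (cspan C)"
        using closure_subset by (intro subsetD [OF closure_subset] complex_vector.span_sum
            complex_vector.span_scale complex_vector.span_base)
      show "cinner b (\<Sum>b\<in>C. cinner b e *\<^sub>C b) = cinner b e" if "b \<in> C" for b
        using orthonormal_cinner_sum [OF oC \<open>finite C\<close> subset_refl that, of "\<lambda>b. cinner b e"] that
          by simp
    qed simp
    have "complex_vector.subspace W"
      using W csubspace_closure by (metis complex_vector.subspace_span orthonormal_basis_of_iff)
    then have "e - y \<in> W"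
      using y eB sub W by (auto simp: orthonormal_basis_of_iff complex_vector.subspace_diff)
    then have "e - y = 0"
      using cy by (intro orthonormal_basis_of_orth [OF W(1)]) (auto simp: cinner.diff_right)
    then have "(norm e)\<^sup>2 = (\<Sum>b\<in>C. (cmod (cinner b e))\<^sup>2)"
      using orthonormal_norm_sum [OF oC \<open>finite C\<close> subset_refl, of "\<lambda>b. cinner b e"] y_def by simp
    moreover have "cinner e e = 1"
      using oB eB by (auto simp: orthonormal_def)
    ultimately show ?thesis
      by (metis cinner_norm_sq of_real_eq_1_iff)
  qed
  have "real (card F) = (\<Sum>e\<in>F. \<Sum>b\<in>C. (cmod (cinner b e))\<^sup>2)"
    using Pars by simp
  also have "\<dots> = (\<Sum>b\<in>C. \<Sum>e\<in>F. (cmod (cinner b e))\<^sup>2)"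
    by (rule sum.swap)
  also have "\<dots> \<le> (\<Sum>b\<in>C. 1)"
  proof (rule sum_mono)
    fix b assume "b \<in> C"
    then have "(norm b)\<^sup>2 = 1"
      using oC unfolding orthonormal_def by (metis cinner_norm_sq of_real_eq_1_iff)
    moreover have "cmod (cinner b e) = cmod (cinner e b)" for e
      by (metis cinner_commute complex_mod_cnj)
    ultimately show "(\<Sum>e\<in>F. (cmod (cinner b e))\<^sup>2) \<le> 1"
      using Bessel_inequality [OF oB F, of b] by simp
  qed
  finally show ?thesis
    by simp
qed

text \<open>By Bessel only finitely many elements of \<open>B\<close> have a squared coefficient
  above \<open>1 / (n + 1)\<close>.\<close>

lemma countable_orthonormal_support:
  assumes B: "orthonormal B"
  shows "countable {e \<in> B. cinner e x \<noteq> 0}"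
proof -
  have "{e \<in> B. cinner e x \<noteq> 0} = (\<Union>n. {e \<in> B. inverse (real (Suc n)) < (cmod (cinner e x))\<^sup>2})"
  proof (intro equalityI subsetI)
    fix e assume "e \<in> {e \<in> B. cinner e x \<noteq> 0}"
    then have "e \<in> B" "0 < (cmod (cinner e x))\<^sup>2"
      by auto
    then show "e \<in> (\<Union>n. {e \<in> B. inverse (real (Suc n)) < (cmod (cinner e x))\<^sup>2})"
      using reals_Archimedean [of "(cmod (cinner e x))\<^sup>2"] by blast
  next
    fix e assume "e \<in> (\<Union>n. {e \<in> B. inverse (real (Suc n)) < (cmod (cinner e x))\<^sup>2})"
    then obtain n where "e \<in> B" "inverse (real (Suc n)) < (cmod (cinner e x))\<^sup>2"
      by blast
    moreover have "0 < inverse (real (Suc n))"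
      by simp
    ultimately have "(cmod (cinner e x))\<^sup>2 \<noteq> 0"
      by linarith
    then show "e \<in> {e \<in> B. cinner e x \<noteq> 0}"
      using \<open>e \<in> B\<close> by simp
  qed
  moreover have "finite {e \<in> B. inverse (real (Suc n)) < (cmod (cinner e x))\<^sup>2}"
    (is "finite ?S") for n
  proof (rule ccontr)
    assume inf: "infinite ?S"
    obtain k :: nat where k: "(norm x)\<^sup>2 * real (Suc n) < real k"
      using reals_Archimedean2 by blast
    obtain F where F: "F \<subseteq> ?S" "finite F" "card F = k"
      using infinite_arbitrarily_large [OF inf, of k] by auto
    have "real k * inverse (real (Suc n)) = (\<Sum>e\<in>F. inverse (real (Suc n)))"
      using F by simp
    also have "\<dots> \<le> (\<Sum>e\<in>F. (cmod (cinner e x))\<^sup>2)"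
      using F by (intro sum_mono) auto
    also have "\<dots> \<le> (norm x)\<^sup>2"
      using F by (intro Bessel_inequality [OF B]) auto
    finally show False
      using k by (simp add: field_simps)
  qed
  ultimately show ?thesis
    by (simp add: countable_finite)
qed

text \<open>For infinite \<open>C\<close>, every element of \<open>B\<close> has a nonzero
  coefficient against some element of \<open>C\<close>, and each element of \<open>C\<close> meets
  only countably many of them. Thus \<open>B\<close> is covered by \<open>|C|\<close> many countable
  sets. With \<open>V = W\<close> this also shows that the choice of basis in
  \<open>proj_rank\<close> does not affect the cardinal.\<close>

lemma orthonormal_basis_card_mono:
  fixes V W :: "'h::chilbert_space set"
  assumes B: "orthonormal_basis_of V B" and C: "orthonormal_basis_of W C" and sub: "V \<subseteq> W"
  shows "|B| \<le>o |C|"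
proof (cases "finite C")
  case True
  have bd: "card F \<le> card C" if "finite F" "F \<subseteq> B" for F
    using orthonormal_finite_bound [OF B C True that sub] .
  then have "finite B"
    by (metis card_mono finite_subset infinite_arbitrarily_large lessI not_less subset_refl)
  then show ?thesis
    using bd True by (metis card_of_ordLeq card_le_inj subset_refl)
next
  case False
  have oB: "orthonormal B"
    using B by (simp add: orthonormal_basis_of_iff)
  have "B \<subseteq> (\<Union>b\<in>C. {e \<in> B. cinner e b \<noteq> 0})"
  proof
    fix e assume e: "e \<in> B"
    then have "e \<noteq> 0"
      using oB unfolding orthonormal_def by (metis cinner_self_eq_zero zero_neq_one)
    then have "\<exists>b\<in>C. cinner b e \<noteq> 0"
      using orthonormal_basis_of_orth [OF C] e orthonormal_basis_of_subset [OF B] sub by blast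
    then show "e \<in> (\<Union>b\<in>C. {e \<in> B. cinner e b \<noteq> 0})"
      using e cinner_eq_zero_commute by blast
  qed
  moreover have "|\<Union>b\<in>C. {e \<in> B. cinner e b \<noteq> 0}| \<le>o |C|"
  proof (rule card_of_UNION_ordLeq_infinite [OF False])
    show "|C| \<le>o |C|"
      by (rule card_of_mono1) simp
    have "|{e \<in> B. cinner e b \<noteq> 0}| \<le>o |UNIV :: nat set|" for b
      using countable_orthonormal_support [OF oB, of b] unfolding countable_def
      by (meson card_of_ordLeqI UNIV_I)
    moreover have "|UNIV :: nat set| \<le>o |C|"
      using False by (simp add: infinite_iff_card_of_nat)
    ultimately show "\<forall>b\<in>C. |{e \<in> B. cinner e b \<noteq> 0}| \<le>o |C|"
      using ordLeq_transitive by blast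
  qed
  ultimately show ?thesis
    using card_of_mono1 ordLeq_transitive by blast
qed

section \<open>Bounded operators\<close>

text \<open>Linearity is automatic: the squared norm of the defect expands into inner products of
  values of \<open>u\<close>, which cancel.\<close>

lemma cinner_preserving_linear:
  fixes u :: "'h::chilbert_space \<Rightarrow> 'h"
  assumes u: "\<And>x y. cinner (u x) (u y) = cinner x y"
  shows "u (x + y) = u x + u y" "u (c *\<^sub>C x) = c *\<^sub>C u x"
proof -
  have "cinner (u (x + y) - (u x + u y)) (u (x + y) - (u x + u y)) = 0"
    by (simp add: u cinner.diff_left cinner.diff_right cinner.add_left cinner.add_right)
  then show "u (x + y) = u x + u y"
    by simp
  have "cinner (u (c *\<^sub>C x) - c *\<^sub>C u x) (u (c *\<^sub>C x) - c *\<^sub>C u x) = 0"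
    by (simp add: u cinner.diff_left cinner.diff_right)
  then show "u (c *\<^sub>C x) = c *\<^sub>C u x"
    by simp
qed

lemma norm_eq_if_cinner_eq: "cinner x x = cinner y y \<Longrightarrow> norm x = norm (y::'h::chilbert_space)"
  by (simp add: cinner_norm_sq flip: of_real_power)

lemma cinner_preserving_bops:
  fixes u :: "'h::chilbert_space \<Rightarrow> 'h"
  assumes u: "\<And>x y. cinner (u x) (u y) = cinner x y"
  obtains U where "U \<in> bops" "blinfun_apply U = u"
proof -
  have "bounded_linear u"
  proof (rule bounded_linear_intro [where K = 1])
    show "norm (u x) \<le> norm x * 1" for x
      using norm_eq_if_cinner_eq [OF u [of x x]] by simp
  qed (simp_all add: cinner_preserving_linear [OF u] scaleR_scaleC)
  then have "blinfun_apply (Blinfun u) = u"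
    by (rule bounded_linear_Blinfun_apply)
  then show thesis
    using that [of "Blinfun u"] cinner_preserving_linear [OF u] by (simp add: bops_def)
qed

section \<open>Isometries determined by inner products on a total family\<close>

definition lcomb :: "('i \<Rightarrow> 'h::chilbert_space) \<Rightarrow> (complex \<times> 'i) list \<Rightarrow> 'h" where
  "lcomb v xs = (\<Sum>(c, i)\<leftarrow>xs. c *\<^sub>C v i)"

lemma lcomb_Nil [simp]: "lcomb v [] = 0"
  and lcomb_Cons [simp]: "lcomb v ((c, i) # xs) = c *\<^sub>C v i + lcomb v xs"
  and lcomb_append [simp]: "lcomb v (xs @ ys) = lcomb v xs + lcomb v ys"
  by (simp_all add: lcomb_def)

lemma lcomb_scale [simp]: "lcomb v (map (map_prod ((*) c) id) xs) = c *\<^sub>C lcomb v xs"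
  by (induction xs) (auto simp: scaleC_add_right scaleC_scaleC scaleC.zero_right)

lemma cspan_image_eq_lcomb: "cspan (v ` I) = lcomb v ` {xs. snd ` set xs \<subseteq> I}" (is "_ = ?R")
proof (rule antisym)
  show "cspan (v ` I) \<subseteq> ?R"
  proof (rule complex_vector.span_minimal)
    show "v ` I \<subseteq> ?R"
    proof
      fix x assume "x \<in> v ` I"
      then obtain i where "i \<in> I" "x = v i" by blast
      then show "x \<in> ?R"
        by (intro image_eqI [of _ _ "[(1, i)]"]) auto
    qed
    show "complex_vector.subspace ?R"
    proof (rule complex_vector.subspaceI)
      show "0 \<in> ?R"
        by (rule image_eqI [of _ _ "[]"]) auto
      show "x + y \<in> ?R" if "x \<in> ?R" "y \<in> ?R" for x y
      proof -
        obtain xs ys where "snd ` set xs \<subseteq> I" "snd ` set ys \<subseteq> I" "x = lcomb v xs" "y = lcomb v ys"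
          using \<open>x \<in> ?R\<close> \<open>y \<in> ?R\<close> by blast
        then show ?thesis
          by (intro image_eqI [of _ _ "xs @ ys"]) auto
      qed
      show "c *\<^sub>C x \<in> ?R" if "x \<in> ?R" for c x
      proof -
        obtain xs where "snd ` set xs \<subseteq> I" "x = lcomb v xs"
          using \<open>x \<in> ?R\<close> by blast
        then show ?thesis
          by (intro image_eqI [of _ _ "map (map_prod ((*) c) id) xs"]) (auto simp: image_image)
      qed
    qed
  qed
  have "lcomb v xs \<in> cspan (v ` I)" if "snd ` set xs \<subseteq> I" for xs
    using that
  proof (induction xs)
    case (Cons a xs)
    then show ?case
      by (cases a) (auto intro: complex_vector.span_add complex_vector.span_scale
          complex_vector.span_base)
  qed (simp add: complex_vector.span_zero)
  then show "?R \<subseteq> cspan (v ` I)"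
    by blast
qed

text \<open>Formal combinations are kept as lists so that the same coefficients can be evaluated on
  both families \<open>v\<close> and \<open>w\<close>; no map on the span has to be shown well
  defined beforehand.\<close>

lemma lcomb_cinner_eq:
  assumes gram: "\<And>i j. i \<in> I \<Longrightarrow> j \<in> I \<Longrightarrow> cinner (v i) (v j) = cinner (w i) (w j)"
    and "snd ` set xs \<subseteq> I" "snd ` set ys \<subseteq> I"
  shows "cinner (lcomb v xs) (lcomb v ys) = cinner (lcomb w xs) (lcomb w ys)"
  using assms(2)
proof (induction xs)
  case (Cons a xs)
  have "cinner (v i) (lcomb v ys) = cinner (w i) (lcomb w ys)" if "i \<in> I" for i
    using assms(3)
  proof (induction ys)
    case (Cons b ys)
    then show ?case
      using that gram by (cases b) (auto simp: cinner.add_right)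
  qed (simp add: cinner.zero_right)
  with Cons show ?case
    by (cases a) (auto simp: cinner.add_left)
qed (simp add: cinner.zero_left)

text \<open>\<open>rel x y\<close> relates limits of the same formal combinations, evaluated on
  \<open>v\<close> and on \<open>w\<close>. Equal inner products make this relation preserve inner
  products, hence single-valued, and completeness together with totality of \<open>v\<close> makes
  it defined everywhere. It later yields both the transported multipliers and the covering
  unitaries.\<close>

lemma isometric_extension:
  fixes v w :: "'i \<Rightarrow> 'h::chilbert_space"
  assumes gram: "\<And>i j. i \<in> I \<Longrightarrow> j \<in> I \<Longrightarrow> cinner (v i) (v j) = cinner (w i) (w j)"
    and total: "closure (cspan (v ` I)) = UNIV"
  obtains u where "u \<in> bops" "\<And>x y. cinner (u x) (u y) = cinner x y" "\<And>i. i \<in> I \<Longrightarrow> u (v i) = w i"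
proof -
  define L where "L = {xs :: (complex \<times> 'i) list. snd ` set xs \<subseteq> I}"
  define rel where "rel x y \<longleftrightarrow> (\<exists>xs. (\<forall>n. xs n \<in> L) \<and> (\<lambda>n. lcomb v (xs n)) \<longlonglongrightarrow> x \<and>
    (\<lambda>n. lcomb w (xs n)) \<longlonglongrightarrow> y)" for x y
  have Lc: "cinner (lcomb v xs) (lcomb v ys) = cinner (lcomb w xs) (lcomb w ys)"
    if "xs \<in> L" "ys \<in> L" for xs ys
    using that unfolding L_def by (intro lcomb_cinner_eq [where I = I] gram) auto
  have rel_cinner: "cinner y y' = cinner x x'" if "rel x y" "rel x' y'" for x y x' y'
  proof -
    obtain xs ys where xs: "\<forall>n. xs n \<in> L" "(\<lambda>n. lcomb v (xs n)) \<longlonglongrightarrow> x" "(\<lambda>n. lcomb w (xs n)) \<longlonglongrightarrow> y"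
      and ys: "\<forall>n. ys n \<in> L" "(\<lambda>n. lcomb v (ys n)) \<longlonglongrightarrow> x'" "(\<lambda>n. lcomb w (ys n)) \<longlonglongrightarrow> y'"
      using \<open>rel x y\<close> \<open>rel x' y'\<close> unfolding rel_def by blast
    have "(\<lambda>n. cinner (lcomb v (xs n)) (lcomb v (ys n))) \<longlonglongrightarrow> cinner x x'"
      by (intro cinner.tendsto xs ys)
    moreover have "(\<lambda>n. cinner (lcomb w (xs n)) (lcomb w (ys n))) \<longlonglongrightarrow> cinner y y'"
      by (intro cinner.tendsto xs ys)
    moreover have "cinner (lcomb w (xs n)) (lcomb w (ys n)) =
        cinner (lcomb v (xs n)) (lcomb v (ys n))" for n
      using xs ys by (simp add: Lc)
    ultimately show ?thesis
      by (simp add: LIMSEQ_unique)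
  qed
  have "\<exists>y. rel x y" for x
  proof -
    have "x \<in> closure (lcomb v ` L)"
      using total by (simp add: cspan_image_eq_lcomb L_def)
    then obtain f where f: "\<forall>n. f n \<in> lcomb v ` L" "f \<longlonglongrightarrow> x"
      unfolding closure_sequential by blast
    then have "\<forall>n. \<exists>xs. xs \<in> L \<and> f n = lcomb v xs"
      by blast
    then obtain xs where xs: "\<forall>n. xs n \<in> L \<and> f n = lcomb v (xs n)"
      by (rule choice [THEN exE])
    \<comment> \<open>Equal inner products give equal distances, so convergence on the
      \<open>v\<close> side makes the \<open>w\<close> side Cauchy.\<close>
    have diff: "norm (lcomb w (xs m) - lcomb w (xs n)) = norm (f m - f n)" for m n
      using xs by (intro norm_eq_if_cinner_eq) (simp add: cinner.diff_left cinner.diff_right Lc)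
    have "Cauchy f"
      using f(2) by (rule LIMSEQ_imp_Cauchy)
    then have "Cauchy (\<lambda>n. lcomb w (xs n))"
      by (simp add: Cauchy_iff diff)
    then obtain y where "(\<lambda>n. lcomb w (xs n)) \<longlonglongrightarrow> y"
      by (auto simp: Cauchy_convergent_iff convergent_def)
    moreover have "(\<lambda>n. lcomb v (xs n)) \<longlonglongrightarrow> x"
    proof -
      have "f = (\<lambda>n. lcomb v (xs n))"
        using xs by auto
      then show ?thesis
        using f(2) by simp
    qed
    ultimately show ?thesis
      using xs unfolding rel_def by blast
  qed
  then obtain u where u: "\<And>x. rel x (u x)"
    by metis
  have iso: "cinner (u x) (u y) = cinner x y" for x y
    using rel_cinner [OF u u] .
  have uv: "u (v i) = w i" if "i \<in> I" for i
  proof -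
    \<comment> \<open>The constant sequence with the single term \<open>1 \<cdot> i\<close> relates
      \<open>v i\<close> to \<open>w i\<close>; preservation of inner products then leaves no room
      for another value.\<close>
    have r: "rel (v i) (w i)"
      unfolding rel_def L_def using that by (intro exI [of _ "\<lambda>_. [(1, i)]"]) simp
    then have "cinner (u (v i) - w i) (u (v i) - w i) = 0"
      by (simp add: cinner.diff_left cinner.diff_right rel_cinner [OF u u] rel_cinner [OF u r]
          rel_cinner [OF r u] rel_cinner [OF r r])
    then show ?thesis
      by simp
  qed
  show thesis
    using cinner_preserving_bops [OF iso] that iso uv by metis
qed

subsection \<open>Adjoints\<close>

lemma bops_scaleC: "t \<in> bops \<Longrightarrow> t (c *\<^sub>C x) = c *\<^sub>C t x"
  by (simp add: bops_def)

lemma norm_adjoint_le: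
  fixes t :: "'h::chilbert_space \<Rightarrow>\<^sub>L 'h"
  assumes "\<And>x y. cinner (t x) y = cinner x (s y)"
  shows "norm (s y) \<le> norm t * norm y"
proof -
  have "complex_of_real ((norm (s y))\<^sup>2) = cinner (t (s y)) y"
    by (simp add: assms cinner_norm_sq)
  then have "(norm (s y))\<^sup>2 \<le> norm (t (s y)) * norm y"
    by (rule norm_sq_le_if_eq_cinner)
  also have "\<dots> \<le> norm t * norm (s y) * norm y"
    by (intro mult_right_mono norm_blinfun) auto
  finally show ?thesis
    by (cases "norm (s y) = 0") (auto simp: power2_eq_square mult_ac)
qed

text \<open>Riesz representation in coordinates: for fixed \<open>y\<close> the numbers
  \<open>cinner (t b) y\<close> have square sums at most \<open>(norm t * norm y) ^ 2\<close>, so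
  they are the coefficients of a vector, which is the value of the adjoint at
  \<open>y\<close>.\<close>

lemma adj_exists:
  fixes t :: "'h::chilbert_space \<Rightarrow>\<^sub>L 'h"
  assumes t: "t \<in> bops"
  obtains s where "s \<in> bops" "\<And>x y. cinner (t x) y = cinner x (s y)"
proof -
  obtain B :: "'h set" where "orthonormal_basis_of UNIV B"
    using ex_orthonormal_basis_of [OF complex_vector.subspace_UNIV closed_UNIV] by blast
  then have B: "orthonormal B" "closure (cspan B) = UNIV"
    by (auto simp: orthonormal_basis_of_iff)
  have "\<exists>z. \<forall>x. cinner (t x) y = cinner x z" for y
  proof -
    have "(\<Sum>b\<in>F. (cmod (cinner (t b) y))\<^sup>2) \<le> (norm t * norm y)\<^sup>2" if F: "finite F" "F \<subseteq> B" for F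
    proof -
      define w where "w = (\<Sum>b\<in>F. cinner (t b) y *\<^sub>C b)"
      have w: "(norm w)\<^sup>2 = (\<Sum>b\<in>F. (cmod (cinner (t b) y))\<^sup>2)"
        unfolding w_def by (rule orthonormal_norm_sum [OF B(1) F])
      have "cinner (t w) y = (\<Sum>b\<in>F. cnj (cinner (t b) y) * cinner (t b) y)"
        unfolding w_def blinfun.sum_right cinner.sum_left using t by (simp add: bops_scaleC)
      also have "\<dots> = complex_of_real (\<Sum>b\<in>F. (cmod (cinner (t b) y))\<^sup>2)"
        by (simp add: complex_norm_square mult.commute del: of_real_power)
      finally have "complex_of_real ((norm w)\<^sup>2) = cinner (t w) y"
        using w by simp
      then have "(norm w)\<^sup>2 \<le> norm (t w) * norm y"
        by (rule norm_sq_le_if_eq_cinner)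
      also have "\<dots> \<le> norm t * norm w * norm y"
        by (intro mult_right_mono norm_blinfun) auto
      finally have "norm w \<le> norm t * norm y"
        by (cases "norm w = 0") (auto simp: power2_eq_square mult_ac)
      then show ?thesis
        using w by (metis norm_ge_zero power_mono)
    qed
    then obtain z where z: "\<And>b. b \<in> B \<Longrightarrow> cinner b z = cinner (t b) y"
      using Riesz_Fischer [OF B(1), of "\<lambda>b. cinner (t b) y"] by metis
    have "complex_vector.subspace {x. cinner (t x) y = cinner x z}"
      using t by (intro complex_vector.subspaceI)
        (auto simp: blinfun.add_right cinner.add_left bops_scaleC cinner.zero_left)
    moreover have "closed {x. cinner (t x) y = cinner x z}"
      by (intro closed_Collect_eq continuous_intros cinner.continuous_on)
    ultimately have "closure (cspan B) \<subseteq> {x. cinner (t x) y = cinner x z}"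
      using z by (intro closure_cspan_minimal) auto
    then show ?thesis
      using B by auto
  qed
  then obtain s where s: "\<And>x y. cinner (t x) y = cinner x (s y)"
    by metis
  have "bounded_linear s"
  proof (rule bounded_linear_intro [where K = "norm t"])
    show "s (x + y) = s x + s y" for x y
      by (rule cinner_eqI) (simp add: cinner.add_right flip: s)
    show "s (r *\<^sub>R x) = r *\<^sub>R s x" for r x
      by (rule cinner_eqI) (simp add: scaleR_scaleC flip: s)
    show "norm (s y) \<le> norm y * norm t" for y
      using norm_adjoint_le [of t s, OF s] by (simp add: mult.commute)
  qed
  moreover have "s (c *\<^sub>C x) = c *\<^sub>C s x" for c x
    by (rule cinner_eqI) (simp flip: s)
  ultimately show thesis
    using that [of "Blinfun s"] s by (simp add: bops_def bounded_linear_Blinfun_apply)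
qed

lemma adj_unique:
  fixes s t :: "'h::chilbert_space \<Rightarrow>\<^sub>L 'h"
  assumes "\<And>x y. cinner (t x) y = cinner x (s y)"
  shows "adj t = s"
  unfolding adj_def
proof (rule the_equality)
  fix s' assume "\<forall>x y. cinner (t x) y = cinner x (blinfun_apply s' y)"
  then have "s' y = s y" for y
    using assms by (metis cinner_eqI)
  then show "s' = s"
    by (simp add: blinfun_eqI)
qed (use assms in blast)

lemma
  assumes "t \<in> bops"
  shows cinner_adj: "cinner (t x) y = cinner x (adj t y)"
    and adj_bops [simp]: "adj t \<in> bops"
  using adj_exists [OF assms] adj_unique by metis+

lemma cinner_adj': "t \<in> bops \<Longrightarrow> cinner x (t y) = cinner (adj t x) y"
  by (metis cinner_adj cinner_commute)

lemma bops_simps [simp]: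
  "0 \<in> bops" "id_blinfun \<in> bops"
  "s \<in> bops \<Longrightarrow> t \<in> bops \<Longrightarrow> s + t \<in> bops" "s \<in> bops \<Longrightarrow> t \<in> bops \<Longrightarrow> s - t \<in> bops"
  "s \<in> bops \<Longrightarrow> t \<in> bops \<Longrightarrow> s o\<^sub>L t \<in> bops" "t \<in> bops \<Longrightarrow> scaleC_op c t \<in> bops"
  by (auto simp: bops_def blinfun.add_left blinfun.diff_left scaleC_add_right scaleC.diff_right
      scaleC_scaleC mult.commute scaleC.zero_right)

lemma adj_adj [simp]: "t \<in> bops \<Longrightarrow> adj (adj t) = t"
  by (rule adj_unique) (simp add: cinner_adj')

lemma adj_comp: "s \<in> bops \<Longrightarrow> t \<in> bops \<Longrightarrow> adj (s o\<^sub>L t) = adj t o\<^sub>L adj s"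
  by (rule adj_unique) (simp add: cinner_adj)

lemma adj_diff: "s \<in> bops \<Longrightarrow> t \<in> bops \<Longrightarrow> adj (s - t) = adj s - adj t"
  by (rule adj_unique) (simp add: cinner_adj blinfun.diff_left cinner.diff_left cinner.diff_right)

lemma adj_zero [simp]: "adj 0 = 0"
  by (rule adj_unique) (simp add: cinner.zero_left cinner.zero_right)

lemma adj_id [simp]: "adj id_blinfun = id_blinfun"
  by (rule adj_unique) simp

lemma norm_adj_le: "t \<in> bops \<Longrightarrow> norm (adj t) \<le> norm t"
  by (rule norm_blinfun_bound) (auto intro: norm_adjoint_le cinner_adj)

lemma norm_adj: "t \<in> bops \<Longrightarrow> norm (adj t) = norm t"
  by (metis adj_adj adj_bops norm_adj_le order_antisym)

lemma closed_bops: "closed (bops :: ('h::chilbert_space \<Rightarrow>\<^sub>L 'h) set)"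
proof -
  have "closed {t :: 'h \<Rightarrow>\<^sub>L 'h. t (c *\<^sub>C x) = c *\<^sub>C t x}" for c x
    by (intro closed_Collect_eq continuous_intros scaleC.continuous_on)
  then show ?thesis
    unfolding bops_def by (intro closed_Collect_all)
qed

lemma bops_eqI:
  assumes "s \<in> bops" "t \<in> bops" "closure (cspan B) = UNIV" "\<And>b. b \<in> B \<Longrightarrow> s b = t b"
  shows "s = t"
proof -
  have "complex_vector.subspace {x. s x = t x}"
    using assms by (intro complex_vector.subspaceI) (auto simp: blinfun.add_right bops_scaleC)
  moreover have "closed {x. s x = t x}"
    by (intro closed_Collect_eq continuous_intros)
  ultimately have "closure (cspan B) \<subseteq> {x. s x = t x}"
    using assms by (intro closure_cspan_minimal) auto
  then show ?thesis
    using assms by (intro blinfun_eqI) auto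
qed

lemma comp_eqD: "s o\<^sub>L t = r \<Longrightarrow> s (t x) = r x"
  by (metis blinfun_apply_blinfun_compose)

lemmas blinfun_compose_bilinear_simps =
  bounded_bilinear.add_left [OF bounded_bilinear_blinfun_compose]
  bounded_bilinear.add_right [OF bounded_bilinear_blinfun_compose]
  bounded_bilinear.diff_left [OF bounded_bilinear_blinfun_compose]
  bounded_bilinear.diff_right [OF bounded_bilinear_blinfun_compose]
  bounded_bilinear.zero_left [OF bounded_bilinear_blinfun_compose]
  bounded_bilinear.zero_right [OF bounded_bilinear_blinfun_compose]

subsection \<open>Projections and unitaries\<close>

lemma projection_adj: "projection p \<Longrightarrow> adj p = p"
  by (rule adj_unique) (simp add: projection_def)

lemma projection_bops: "projection p \<Longrightarrow> p \<in> bops"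
  by (simp add: projection_def)

lemma projection_idem: "projection p \<Longrightarrow> p (p x) = p x"
  unfolding projection_def by (metis blinfun_apply_blinfun_compose)

lemma projection_range: "projection p \<Longrightarrow> range (blinfun_apply p) = {x. p x = x}"
  by (auto simp: projection_idem) (metis rangeI)

lemma projection_range_closed: "projection p \<Longrightarrow> closed (range (blinfun_apply p))"
  unfolding projection_range by (intro closed_Collect_eq continuous_intros)

lemma projection_range_csubspace: "projection p \<Longrightarrow> complex_vector.subspace (range (blinfun_apply p))"
  unfolding projection_range
  by (intro complex_vector.subspaceI) (auto simp: blinfun.add_right bops_scaleC projection_bops)

lemma projection_norm_le: "projection p \<Longrightarrow> norm (p x) \<le> norm x"
proof -
  assume p: "projection p"
  have "complex_of_real ((norm (p x))\<^sup>2) = cinner x (p x)"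
    using p unfolding projection_def cinner_norm_sq [symmetric] by (metis projection_idem [OF p])
  then have "(norm (p x))\<^sup>2 \<le> norm x * norm (p x)"
    by (rule norm_sq_le_if_eq_cinner)
  then show ?thesis
    by (cases "norm (p x) = 0") (auto simp: power2_eq_square)
qed

lemma projection_norm: "projection p \<Longrightarrow> norm p \<le> 1"
  by (rule norm_blinfun_bound) (auto simp: projection_norm_le)

lemma unitary_bops: "unitary u \<Longrightarrow> u \<in> bops"
  by (simp add: unitary_def)

lemma unitary_cancel [simp]:
  assumes "unitary u"
  shows "adj u (u x) = x" "u (adj u x) = x"
  using assms unfolding unitary_def by (metis blinfun_apply_blinfun_compose blinfun_apply_id_blinfun
    id_apply)+

lemma unitary_cinner: "unitary u \<Longrightarrow> cinner (u x) (u y) = cinner x y"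
  by (simp add: cinner_adj unitary_bops)

lemma unitary_norm: "unitary u \<Longrightarrow> norm (u x) = norm x"
  by (rule norm_eq_if_cinner_eq) (simp add: unitary_cinner)

lemma unitary_adj: "unitary u \<Longrightarrow> unitary (adj u)"
  by (simp add: unitary_def)

lemma unitary_comp: "unitary u \<Longrightarrow> unitary v \<Longrightarrow> unitary (u o\<^sub>L v)"
  unfolding unitary_def
  by (auto intro!: blinfun_eqI simp: adj_comp unitary_cancel unitary_def)

lemma unitary_id: "unitary id_blinfun"
  by (auto simp: unitary_def intro: blinfun_eqI)

text \<open>The isometry condition gives \<open>adj u o\<^sub>L u = id_blinfun\<close>; hence
  \<open>u o\<^sub>L adj u\<close> fixes the range of \<open>u\<close>, and a total set in the range
  settles the other identity.\<close>

lemma unitaryI: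
  assumes u: "u \<in> bops" and iso: "\<And>x y. cinner (u x) (u y) = cinner x y"
    and B: "closure (cspan B) = UNIV" "B \<subseteq> range (blinfun_apply u)"
  shows "unitary u"
proof -
  have 1: "adj u o\<^sub>L u = id_blinfun"
    by (intro blinfun_eqI cinner_eqI) (simp add: iso flip: cinner_adj [OF u])
  have "u o\<^sub>L adj u = id_blinfun"
  proof (rule bops_eqI [OF _ _ B(1)])
    fix b assume "b \<in> B"
    then obtain x where "b = u x"
      using B by auto
    then show "(u o\<^sub>L adj u) b = id_blinfun b"
      using comp_eqD [OF 1, of x] by simp
  qed (use u in auto)
  with 1 u show ?thesis
    by (simp add: unitary_def)
qed

subsection \<open>Compact operators\<close>

lemma compact_opI: "compact K \<Longrightarrow> blinfun_apply t ` cball 0 1 \<subseteq> K \<Longrightarrow> compact_op t"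
  unfolding compact_op_def
  by (metis closed_closure closure_minimal compact_Int_closed compact_imp_closed inf.absorb_iff2)

lemma compact_op_comp_left:
  assumes "compact_op t" shows "compact_op (s o\<^sub>L t)"
proof (rule compact_opI)
  show "compact (blinfun_apply s ` closure (blinfun_apply t ` cball 0 1))"
    using assms by (intro compact_continuous_image continuous_intros) (simp add: compact_op_def)
  show "blinfun_apply (s o\<^sub>L t) ` cball 0 1 \<subseteq>
      blinfun_apply s ` closure (blinfun_apply t ` cball 0 1)"
    using closure_subset by fastforce
qed

lemma compact_op_comp_right:
  assumes "compact_op t" shows "compact_op (t o\<^sub>L s)"
proof (rule compact_opI)
  \<comment> \<open>The summand 1 keeps \<open>K\<close> positive when \<open>s = 0\<close>, so that
    dividing by \<open>K\<close> maps the image of the unit ball under \<open>s\<close> into the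
    unit ball.\<close>
  define K where "K = norm s + 1"
  have K: "K > 0" by (simp add: K_def add_nonneg_pos)
  show "compact ((*\<^sub>R) K ` closure (blinfun_apply t ` cball 0 1))"
    using assms by (intro compact_scaling) (simp add: compact_op_def)
  show "blinfun_apply (t o\<^sub>L s) ` cball 0 1 \<subseteq> (*\<^sub>R) K ` closure (blinfun_apply t ` cball 0 1)"
  proof clarify
    fix x :: 'a assume "x \<in> cball 0 1"
    then have "norm (s x) \<le> norm s"
      using norm_blinfun [of s x] mult_left_mono [of "norm x" 1 "norm s"] by auto
    then have "norm (inverse K *\<^sub>R s x) \<le> 1"
      using K by (simp add: K_def field_simps)
    then have "t (inverse K *\<^sub>R s x) \<in> closure (blinfun_apply t ` cball 0 1)"
      by (intro subsetD [OF closure_subset] imageI) simp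
    moreover have "(t o\<^sub>L s) x = K *\<^sub>R t (inverse K *\<^sub>R s x)"
      using K by (simp add: blinfun.scaleR_right)
    ultimately show "(t o\<^sub>L s) x \<in> (*\<^sub>R) K ` closure (blinfun_apply t ` cball 0 1)"
      by blast
  qed
qed

lemma compact_op_add:
  assumes "compact_op s" "compact_op t" shows "compact_op (s + t)"
proof (rule compact_opI)
  show "compact {x + y |x y. x \<in> closure (blinfun_apply s ` cball 0 1) \<and>
      y \<in> closure (blinfun_apply t ` cball 0 1)}"
    using assms by (intro compact_sums) (simp_all add: compact_op_def)
  show "blinfun_apply (s + t) ` cball 0 1 \<subseteq>
    {x + y |x y. x \<in> closure (blinfun_apply s ` cball 0 1) \<and>
      y \<in> closure (blinfun_apply t ` cball 0 1)}"
  proof clarify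
    fix x :: 'a assume "x \<in> cball 0 1"
    then show "\<exists>y z. (s + t) x = y + z \<and> y \<in> closure (blinfun_apply s ` cball 0 1) \<and>
        z \<in> closure (blinfun_apply t ` cball 0 1)"
      using closure_subset by (rule_tac exI [of _ "s x"], rule_tac exI [of _ "t x"])
        (auto simp: blinfun.add_left intro!: subsetD [OF closure_subset])
  qed
qed

lemma compact_op_scaleC: "compact_op t \<Longrightarrow> compact_op (scaleC_op c t)"
proof -
  assume t: "compact_op t"
  have "scaleC_op c t = scaleC_op c id_blinfun o\<^sub>L t"
    by (rule blinfun_eqI) simp
  then show ?thesis
    using compact_op_comp_left [OF t] by simp
qed

text \<open>Schauder's theorem in its Hilbert space form. Since \<open>t o\<^sub>L adj t\<close> is
  compact, a subsequence of its values converges, and the estimate \<open>key\<close>, applied to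
  differences, makes the values of \<open>adj t\<close> Cauchy along it.\<close>

lemma compact_op_adj:
  fixes t :: "'h::chilbert_space \<Rightarrow>\<^sub>L 'h"
  assumes t: "t \<in> bops" "compact_op t"
  shows "compact_op (adj t)"
proof -
  have tt: "compact_op (t o\<^sub>L adj t)"
    by (rule compact_op_comp_right [OF t(2)])
  have key: "(norm (adj t z))\<^sup>2 \<le> norm z * norm (t (adj t z))" for z
  proof -
    have "complex_of_real ((norm (adj t z))\<^sup>2) = cinner z (t (adj t z))"
      using cinner_adj' [OF t(1), of z "adj t z"] by (simp only: cinner_norm_sq)
    then show ?thesis
      by (rule norm_sq_le_if_eq_cinner)
  qed
  have "seq_compact (closure (blinfun_apply (adj t) ` cball 0 1))"
  proof (rule seq_compactI)
    fix f :: "nat \<Rightarrow> 'h" assume f: "\<forall>n. f n \<in> closure (blinfun_apply (adj t) ` cball 0 1)"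
    \<comment> \<open>Points of the closure are replaced by genuine images with error below
      \<open>1 / (n + 1)\<close>; the limit is unchanged.\<close>
    have "\<exists>y. norm y \<le> 1 \<and> dist (adj t y) (f n) < inverse (real (Suc n))" for n
      using f unfolding closure_approachable
      by (metis (no_types, lifting) imageE inverse_positive_iff_positive mem_cball_0
        of_nat_0_less_iff zero_less_Suc)
    then obtain y where y: "\<And>n. norm (y n) \<le> 1"
      "\<And>n. dist (adj t (y n)) (f n) < inverse (real (Suc n))"
      by metis
    have "seq_compact (closure (blinfun_apply (t o\<^sub>L adj t) ` cball 0 1))"
      using tt by (simp add: compact_op_def compact_eq_seq_compact_metric)
    moreover have "\<forall>n. (t o\<^sub>L adj t) (y n) \<in> closure (blinfun_apply (t o\<^sub>L adj t) ` cball 0 1)"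
      using y by (intro allI subsetD [OF closure_subset] imageI) simp
    ultimately obtain l r where r: "strict_mono (r :: nat \<Rightarrow> nat)"
      "((\<lambda>n. (t o\<^sub>L adj t) (y n)) \<circ> r) \<longlonglongrightarrow> l"
      unfolding seq_compact_def by (metis (no_types, lifting))
    have "Cauchy (\<lambda>n. (t o\<^sub>L adj t) (y (r n)))"
      using LIMSEQ_imp_Cauchy [OF r(2)] by (simp add: o_def)
    have "Cauchy (\<lambda>n. adj t (y (r n)))"
    proof (rule CauchyI)
      fix e :: real assume e: "e > 0"
      \<comment> \<open>Differences of points of the unit ball have norm at most 2; the divisor 2
        compensates for this factor in \<open>key\<close>.\<close>
      then have "e\<^sup>2 / 2 > 0" by simp
      then obtain M where M: "\<And>m n. m \<ge> M \<Longrightarrow> n \<ge> M \<Longrightarrow>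
          norm ((t o\<^sub>L adj t) (y (r m)) - (t o\<^sub>L adj t) (y (r n))) < e\<^sup>2 / 2"
        using \<open>Cauchy (\<lambda>n. (t o\<^sub>L adj t) (y (r n)))\<close> unfolding Cauchy_iff by metis
      have "norm (adj t (y (r m)) - adj t (y (r n))) < e" if "m \<ge> M" "n \<ge> M" for m n
      proof -
        let ?z = "y (r m) - y (r n)"
        have "norm ?z \<le> 2"
          using norm_triangle_ineq4 [of "y (r m)" "y (r n)"] y(1) [of "r m"] y(1) [of "r n"]
            by linarith
        have "(norm (adj t ?z))\<^sup>2 \<le> norm ?z * norm (t (adj t ?z))"
          by (rule key)
        also have "\<dots> \<le> 2 * norm (t (adj t ?z))"
          using \<open>norm ?z \<le> 2\<close> by (intro mult_right_mono) auto
        also have "\<dots> < e\<^sup>2"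
          using M [OF that] by (simp add: blinfun.diff_right)
        finally have "norm (adj t ?z) < e"
          using e by (simp add: power_less_imp_less_base)
        then show ?thesis
          by (simp add: blinfun.diff_right)
      qed
      then show "\<exists>M. \<forall>m\<ge>M. \<forall>n\<ge>M. norm (adj t (y (r m)) - adj t (y (r n))) < e"
        by blast
    qed
    then obtain l' where l': "(\<lambda>n. adj t (y (r n))) \<longlonglongrightarrow> l'"
      by (auto simp: Cauchy_convergent_iff convergent_def)
    have "(\<lambda>n. inverse (real (Suc (r n)))) \<longlonglongrightarrow> 0"
      using LIMSEQ_subseq_LIMSEQ [OF LIMSEQ_inverse_real_of_nat r(1)] by (simp add: o_def)
    then have "(\<lambda>n. f (r n) - adj t (y (r n))) \<longlonglongrightarrow> 0"
    proof (rule Lim_null_comparison [rotated])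
      show "\<forall>\<^sub>F n in sequentially. norm (f (r n) - adj t (y (r n))) \<le> inverse (real (Suc (r n)))"
        using y(2) by (intro always_eventually allI less_imp_le) (simp add: dist_norm
          norm_minus_commute)
    qed
    from tendsto_add [OF this l'] have "(f \<circ> r) \<longlonglongrightarrow> l'"
      by (simp add: o_def)
    moreover have "l' \<in> closure (blinfun_apply (adj t) ` cball 0 1)"
      using calculation f closed_sequentially [OF closed_closure] by (metis comp_apply)
    ultimately show "\<exists>l\<in>closure (blinfun_apply (adj t) ` cball 0 1). \<exists>r. strict_mono r \<and>
        (f \<circ> r) \<longlonglongrightarrow> l"
      using r(1) by blast
  qed
  then show ?thesis
    by (simp add: compact_op_def compact_eq_seq_compact_metric)
qed

text \<open>The operator |h><k| of Dirac notation; for a unit vector \<open>h\<close>,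
  \<open>rank_one h h\<close> is the projection onto its line.\<close>

definition rank_one :: "'h::chilbert_space \<Rightarrow> 'h \<Rightarrow> 'h \<Rightarrow>\<^sub>L 'h" where
  "rank_one h k = Blinfun (\<lambda>x. cinner k x *\<^sub>C h)"

lemma rank_one_apply [simp]: "rank_one h k x = cinner k x *\<^sub>C h"
proof -
  have "bounded_linear (\<lambda>x. cinner k x *\<^sub>C h)"
    by (rule bounded_linear_compose [OF scaleC.bounded_linear_left cinner.bounded_linear_right])
  then show ?thesis
    by (simp add: rank_one_def bounded_linear_Blinfun_apply)
qed

lemma rank_one_bops [simp]: "rank_one h k \<in> bops"
  by (simp add: bops_def scaleC_scaleC)

lemma compact_op_rank_one: "compact_op (rank_one h k)"
proof (rule compact_opI)
  show "compact ((\<lambda>c. c *\<^sub>C h) ` cball 0 (norm k))"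
    by (intro compact_continuous_image continuous_intros scaleC.continuous_on compact_cball)
  show "blinfun_apply (rank_one h k) ` cball 0 1 \<subseteq> (\<lambda>c. c *\<^sub>C h) ` cball 0 (norm k)"
  proof (clarsimp)
    fix x :: 'a assume "norm x \<le> 1"
    then have "cmod (cinner k x) \<le> norm k"
      using cmod_cinner_le [of k x] mult_left_mono [of "norm x" 1 "norm k"] by simp
    then show "cinner k x *\<^sub>C h \<in> (\<lambda>c. c *\<^sub>C h) ` cball 0 (norm k)"
      by auto
  qed
qed

section \<open>Outer automorphisms\<close>

text \<open>Norm closedness is deliberately absent: the properties are verified on dense cores and
  then carried to closures.\<close>

definition star_algebra :: "('h::chilbert_space \<Rightarrow>\<^sub>L 'h) set \<Rightarrow> bool" where
  "star_algebra A \<longleftrightarrow> A \<subseteq> bops \<and> (\<forall>a\<in>A. \<forall>b\<in>A. a + b \<in> A) \<and> (\<forall>c. \<forall>a\<in>A. scaleC_op c a \<in> A) \<and>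
     (\<forall>a\<in>A. \<forall>b\<in>A. a o\<^sub>L b \<in> A) \<and> (\<forall>a\<in>A. adj a \<in> A)"

lemma star_algebraD:
  assumes "star_algebra A"
  shows "a \<in> A \<Longrightarrow> a \<in> bops"
    and "a \<in> A \<Longrightarrow> b \<in> A \<Longrightarrow> a + b \<in> A"
    and "a \<in> A \<Longrightarrow> scaleC_op c a \<in> A"
    and "a \<in> A \<Longrightarrow> b \<in> A \<Longrightarrow> a o\<^sub>L b \<in> A"
    and "a \<in> A \<Longrightarrow> adj a \<in> A"
  using assms by (auto simp: star_algebra_def)

lemma blinfun_compose_assoc: "(r o\<^sub>L s) o\<^sub>L t = r o\<^sub>L (s o\<^sub>L t)"
  by (rule blinfun_eqI) simp

lemma blinfun_compose_id [simp]: "id_blinfun o\<^sub>L t = t" "t o\<^sub>L id_blinfun = t"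
  by (auto intro: blinfun_eqI)

lemma bounded_linear_scaleC_op: "bounded_linear (scaleC_op c :: ('h::chilbert_space \<Rightarrow>\<^sub>L 'h) \<Rightarrow> _)"
proof -
  have "scaleC_op c = (\<lambda>t. scaleC_op c id_blinfun o\<^sub>L (t :: 'h \<Rightarrow>\<^sub>L 'h))"
    by (intro ext blinfun_eqI) simp
  then show ?thesis
    using bounded_bilinear.bounded_linear_right [OF bounded_bilinear_blinfun_compose] by metis
qed

lemma closure_image_subset_closed:
  "continuous_on UNIV f \<Longrightarrow> closed T \<Longrightarrow> f ` S \<subseteq> T \<Longrightarrow> f ` closure S \<subseteq> T"
  by (meson continuous_on_subset image_closure_subset subset_UNIV)

lemma tendsto_adj:
  fixes a :: "nat \<Rightarrow> ('h::chilbert_space \<Rightarrow>\<^sub>L 'h)"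
  assumes "\<And>n. a n \<in> bops" "a \<longlonglongrightarrow> t"
  shows "(\<lambda>n. adj (a n)) \<longlonglongrightarrow> adj t"
proof -
  have t: "t \<in> bops"
    using assms closed_bops closed_sequentially by blast
  have "norm (adj (a n) - adj t) = norm (a n - t)" for n
    using assms(1) t by (simp add: norm_adj flip: adj_diff)
  then show ?thesis
    using assms(2) by (simp add: LIMSEQ_iff)
qed

lemma star_algebra_closure:
  fixes A :: "('h::chilbert_space \<Rightarrow>\<^sub>L 'h) set"
  assumes A: "star_algebra A"
  shows "star_algebra (closure A)"
proof -
  have seq: "\<exists>f. (\<forall>n. f n \<in> A) \<and> f \<longlonglongrightarrow> x" if "x \<in> closure A" for x
    using that closure_sequential by blast
  have cl: "x \<in> closure A" if "\<forall>n. f n \<in> A" "f \<longlonglongrightarrow> x" for f x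
    using that closure_sequential by blast
  show ?thesis
    unfolding star_algebra_def
  proof (intro conjI ballI allI)
    show "closure A \<subseteq> bops"
      using A closed_bops by (intro closure_minimal) (auto simp: star_algebra_def)
    show "x + y \<in> closure A" if x: "x \<in> closure A" and y: "y \<in> closure A" for x y
    proof -
      obtain f g where "\<forall>n. f n \<in> A" "f \<longlonglongrightarrow> x" "\<forall>n. g n \<in> A" "g \<longlonglongrightarrow> y"
        using seq [OF x] seq [OF y] by auto
      then show ?thesis
        using A by (intro cl [of "\<lambda>n. f n + g n"]) (auto intro: tendsto_add star_algebraD)
    qed
    show "x o\<^sub>L y \<in> closure A" if x: "x \<in> closure A" and y: "y \<in> closure A" for x y
    proof -
      obtain f g where "\<forall>n. f n \<in> A" "f \<longlonglongrightarrow> x" "\<forall>n. g n \<in> A" "g \<longlonglongrightarrow> y"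
        using seq [OF x] seq [OF y] by auto
      then show ?thesis
        using A by (intro cl [of "\<lambda>n. f n o\<^sub>L g n"])
          (auto intro: bounded_bilinear.tendsto [OF bounded_bilinear_blinfun_compose] star_algebraD)
    qed
    show "scaleC_op c x \<in> closure A" if x: "x \<in> closure A" for c x
    proof -
      obtain f where "\<forall>n. f n \<in> A" "f \<longlonglongrightarrow> x"
        using seq [OF x] by auto
      then show ?thesis
        using A by (intro cl [of "\<lambda>n. scaleC_op c (f n)"])
          (auto intro: bounded_linear.tendsto [OF bounded_linear_scaleC_op] star_algebraD)
    qed
    show "adj x \<in> closure A" if x: "x \<in> closure A" for x
    proof -
      obtain f where "\<forall>n. f n \<in> A" "f \<longlonglongrightarrow> x"
        using seq [OF x] by auto
      then show ?thesis
        using A by (intro cl [of "\<lambda>n. adj (f n)"]) (auto intro: tendsto_adj star_algebraD)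
    qed
  qed
qed

text \<open>A substitute for a unit. It makes a bounded operator determined by its products with
  elements of the algebra.\<close>

definition nondegenerate_algebra :: "('h::chilbert_space \<Rightarrow>\<^sub>L 'h) set \<Rightarrow> bool" where
  "nondegenerate_algebra A \<longleftrightarrow> closure (cspan {blinfun_apply a h |a h. a \<in> A}) = UNIV"

lemma star_automorphismsD:
  assumes "\<phi> \<in> star_automorphisms A"
  shows "\<phi> \<in> Bij A" "bij_betw \<phi> A A"
    "a \<in> A \<Longrightarrow> b \<in> A \<Longrightarrow> \<phi> (a + b) = \<phi> a + \<phi> b"
    "a \<in> A \<Longrightarrow> \<phi> (scaleC_op c a) = scaleC_op c (\<phi> a)"
    "a \<in> A \<Longrightarrow> b \<in> A \<Longrightarrow> \<phi> (a o\<^sub>L b) = \<phi> a o\<^sub>L \<phi> b"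
    "a \<in> A \<Longrightarrow> \<phi> (adj a) = adj (\<phi> a)"
    "a \<in> A \<Longrightarrow> \<phi> a \<in> A"
  using assms by (auto simp: star_automorphisms_def Bij_def bij_betw_def)

lemma carrier_Aut [simp]: "carrier (Aut A) = star_automorphisms A"
  by (simp add: Aut_def)

lemma mult_Aut:
  "\<phi> \<in> star_automorphisms A \<Longrightarrow> \<psi> \<in> star_automorphisms A \<Longrightarrow> \<phi> \<otimes>\<^bsub>Aut A\<^esub> \<psi> = compose A \<phi> \<psi>"
  by (simp add: Aut_def BijGroup_def star_automorphismsD)

lemma one_Aut: "\<one>\<^bsub>Aut A\<^esub> = (\<lambda>a\<in>A. a)"
  by (simp add: Aut_def BijGroup_def)

lemma id_star_automorphism:
  assumes "star_algebra A"
  shows "(\<lambda>a\<in>A. a) \<in> star_automorphisms A"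
  using star_algebraD [OF assms] by (auto simp: star_automorphisms_def id_Bij)

lemma compose_star_automorphism:
  assumes "star_algebra A" "\<phi> \<in> star_automorphisms A" "\<psi> \<in> star_automorphisms A"
  shows "compose A \<phi> \<psi> \<in> star_automorphisms A"
  using star_algebraD [OF assms(1)] star_automorphismsD [OF assms(2)] star_automorphismsD
    [OF assms(3)]
  by (simp add: star_automorphisms_def compose_Bij compose_eq)

lemma inv_star_automorphism:
  assumes A: "star_algebra A" and \<phi>: "\<phi> \<in> star_automorphisms A"
  shows "restrict (inv_into A \<phi>) A \<in> star_automorphisms A"
proof -
  let ?\<psi> = "inv_into A \<phi>"
  note D = star_automorphismsD [OF \<phi>] and alg = star_algebraD [OF A]
  have \<psi>A: "?\<psi> a \<in> A" and \<phi>\<psi>: "\<phi> (?\<psi> a) = a" if "a \<in> A" for a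
    using that D(1) by (simp_all add: Bij_inv_into_mem) (metis D(2) bij_betw_inv_into_right that)
  have \<psi>I: "?\<psi> b = a" if "a \<in> A" "\<phi> a = b" for a b
    using that D(2) by (metis bij_betw_inv_into_left)
  show ?thesis
    unfolding star_automorphisms_def
    using \<psi>A \<phi>\<psi> D alg
    by (auto simp: restrict_inv_into_Bij intro!: \<psi>I)
qed

lemma group_Aut:
  assumes A: "star_algebra A"
  shows "group (Aut A)"
proof (rule groupI)
  note mul = mult_Aut compose_star_automorphism [OF A]
  show "\<exists>y\<in>carrier (Aut A). y \<otimes>\<^bsub>Aut A\<^esub> x = \<one>\<^bsub>Aut A\<^esub>" if "x \<in> carrier (Aut A)" for x
    using that inv_star_automorphism [OF A, of x] Bij_compose_restrict_eq [of x A]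
    by (auto simp: mul one_Aut star_automorphismsD intro!: bexI [of _ "restrict (inv_into A x) A"])
  show "x \<otimes>\<^bsub>Aut A\<^esub> y \<otimes>\<^bsub>Aut A\<^esub> z = x \<otimes>\<^bsub>Aut A\<^esub> (y \<otimes>\<^bsub>Aut A\<^esub> z)"
    if "x \<in> carrier (Aut A)" "y \<in> carrier (Aut A)" "z \<in> carrier (Aut A)" for x y z
    using that by (auto simp: mul compose_assoc [symmetric] Bij_imp_funcset star_automorphismsD)
  show "\<one>\<^bsub>Aut A\<^esub> \<otimes>\<^bsub>Aut A\<^esub> x = x" if "x \<in> carrier (Aut A)" for x
    using that id_star_automorphism [OF A] Bij_imp_extensional [of x A] Bij_imp_funcset [of x A]
    by (simp add: mul one_Aut star_automorphismsD)
qed (simp_all add: mult_Aut compose_star_automorphism [OF A] one_Aut id_star_automorphism [OF A])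

section \<open>Conjugation by unitaries and multipliers\<close>

lemma Ad_apply: "a \<in> A \<Longrightarrow> Ad A u a = u o\<^sub>L a o\<^sub>L adj u"
  by (simp add: Ad_def)

lemma unitary_comp_simps:
  assumes "unitary u"
  shows "u o\<^sub>L (adj u o\<^sub>L t) = t" "adj u o\<^sub>L (u o\<^sub>L t) = t" "t o\<^sub>L u o\<^sub>L adj u = t"
    "t o\<^sub>L adj u o\<^sub>L u = t"
  using assms by (auto intro!: blinfun_eqI)

lemma Ad_star_automorphism:
  assumes A: "star_algebra A" and u: "unitary u"
    and mem: "\<And>a. a \<in> A \<Longrightarrow> u o\<^sub>L a o\<^sub>L adj u \<in> A" "\<And>a. a \<in> A \<Longrightarrow> adj u o\<^sub>L a o\<^sub>L u \<in> A"
  shows "Ad A u \<in> star_automorphisms A"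
proof -
  note alg = star_algebraD [OF A]
  have ub: "u \<in> bops"
    using u by (rule unitary_bops)
  have "bij_betw (Ad A u) A A"
  proof (rule bij_betw_byWitness [where f' = "\<lambda>a. adj u o\<^sub>L a o\<^sub>L u"])
    show "\<forall>a\<in>A. adj u o\<^sub>L Ad A u a o\<^sub>L u = a"
      using u by (auto simp: Ad_apply intro!: blinfun_eqI)
    show "\<forall>a\<in>A. Ad A u (adj u o\<^sub>L a o\<^sub>L u) = a"
      using u mem by (auto simp: Ad_apply intro!: blinfun_eqI)
  qed (use mem in \<open>auto simp: Ad_apply\<close>)
  then have "Ad A u \<in> Bij A"
    by (simp add: Bij_def Ad_def)
  then show ?thesis
    using u ub unfolding star_automorphisms_def
    by (auto simp: Ad_apply alg adj_comp intro!: blinfun_eqI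
        simp: blinfun.add_left blinfun.add_right bops_scaleC)
qed

lemma Ad_mult:
  assumes A: "star_algebra A" and "unitary u" "unitary v"
    and "Ad A u \<in> star_automorphisms A" and v: "Ad A v \<in> star_automorphisms A"
  shows "Ad A u \<otimes>\<^bsub>Aut A\<^esub> Ad A v = Ad A (u o\<^sub>L v)"
proof -
  have "compose A (Ad A u) (Ad A v) a = Ad A (u o\<^sub>L v) a" if "a \<in> A" for a
    using that star_automorphismsD(7) [OF v that] assms
    by (auto simp: compose_eq Ad_apply adj_comp unitary_bops intro!: blinfun_eqI)
  then show ?thesis
    using assms by (simp add: mult_Aut) (rule extensionalityI [of _ A], auto simp: Ad_def)
qed

lemma multipliersD:
  assumes "t \<in> multipliers A"
  shows "t \<in> bops" "a \<in> A \<Longrightarrow> t o\<^sub>L a \<in> A" "a \<in> A \<Longrightarrow> a o\<^sub>L t \<in> A"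
  using assms by (auto simp: multipliers_def)

lemma multipliers_comp: "s \<in> multipliers A \<Longrightarrow> t \<in> multipliers A \<Longrightarrow> s o\<^sub>L t \<in> multipliers A"
  unfolding multipliers_def by (auto simp: blinfun_compose_assoc)
    (auto simp flip: blinfun_compose_assoc)

lemma multipliers_id: "A \<subseteq> bops \<Longrightarrow> id_blinfun \<in> multipliers A"
  by (auto simp: multipliers_def)

lemma multipliers_adj:
  assumes A: "star_algebra A" and t: "t \<in> multipliers A"
  shows "adj t \<in> multipliers A"
proof -
  note alg = star_algebraD [OF A] and tD = multipliersD [OF t]
  have "adj t o\<^sub>L a \<in> A" if "a \<in> A" for a
  proof -
    have "adj (adj a o\<^sub>L t) \<in> A"
      using that by (intro alg tD)
    then show ?thesis
      using that tD(1) by (simp add: adj_comp alg(1))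
  qed
  moreover have "a o\<^sub>L adj t \<in> A" if "a \<in> A" for a
  proof -
    have "adj (t o\<^sub>L adj a) \<in> A"
      using that by (intro alg tD)
    then show ?thesis
      using that tD(1) by (simp add: adj_comp alg(1))
  qed
  ultimately show ?thesis
    using tD(1) by (simp add: multipliers_def)
qed

lemma Ad_multiplier:
  assumes A: "star_algebra A" and u: "unitary u" "u \<in> multipliers A"
  shows "Ad A u \<in> star_automorphisms A"
  using multipliersD [OF u(2)] multipliersD [OF multipliers_adj [OF A u(2)]]
  by (intro Ad_star_automorphism [OF A u(1)]) auto

text \<open>
  An automorphism \<open>\<phi>\<close> need not come with an extension to the multiplier algebra.  For a unitary
  multiplier \<open>u\<close>, however, \<open>\<phi> a h \<mapsto> \<phi> (u a) h\<close> preserves inner products, because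
  \<open>(u a)\<^sup>* (u b) = a\<^sup>* b\<close>; as the vectors \<open>\<phi> a h\<close> are total, this defines the required unitary.
\<close>

lemma transported_multiplier:
  fixes A :: "('h::chilbert_space \<Rightarrow>\<^sub>L 'h) set"
  assumes A: "star_algebra A" and nd: "nondegenerate_algebra A"
    and \<phi>: "\<phi> \<in> star_automorphisms A" and u: "unitary u" "u \<in> multipliers A"
  obtains w where "unitary w" "w \<in> multipliers A" "\<And>a. a \<in> A \<Longrightarrow> w o\<^sub>L \<phi> a = \<phi> (u o\<^sub>L a)"
    "\<And>a. a \<in> A \<Longrightarrow> \<phi> a o\<^sub>L w = \<phi> (a o\<^sub>L u)"
proof -
  note alg = star_algebraD [OF A] and D = star_automorphismsD [OF \<phi>]
    and uD = multipliersD [OF u(2)] and uD' = multipliersD [OF multipliers_adj [OF A u(2)]]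
  have ub: "u \<in> bops"
    using u(1) by (rule unitary_bops)
  have ran: "\<phi> ` A = A"
    using D(2) by (simp add: bij_betw_def)
  define v where "v = (\<lambda>(a, h). blinfun_apply (\<phi> a) h)"
  define v' where "v' = (\<lambda>(a, h). blinfun_apply (\<phi> (u o\<^sub>L a)) h)"
  have vI: "v ` (A \<times> UNIV) = {blinfun_apply a h |a h. a \<in> A}"
    unfolding v_def using ran by (auto simp: image_def) (metis (lifting) ran imageE)+
  have tot: "closure (cspan (v ` (A \<times> UNIV))) = UNIV"
    using nd unfolding nondegenerate_algebra_def vI .
  have star_mult: "adj (\<phi> a) o\<^sub>L \<phi> b = \<phi> (adj a o\<^sub>L b)" if "a \<in> A" "b \<in> A" for a b
    using that by (simp add: D alg)
  have gram: "cinner (v i) (v j) = cinner (v' i) (v' j)"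
    if i: "i \<in> A \<times> UNIV" and j: "j \<in> A \<times> UNIV" for i j
  proof -
    obtain a h where a: "i = (a, h)" "a \<in> A"
      using i by blast
    obtain b k where b: "j = (b, k)" "b \<in> A"
      using j by blast
    note ij = a(1) b(1) and ab = a(2) b(2)
    have "cinner (v' i) (v' j) = cinner h ((adj (\<phi> (u o\<^sub>L a)) o\<^sub>L \<phi> (u o\<^sub>L b)) k)"
      using ab uD D by (simp add: ij v'_def cinner_adj alg(1))
    also have "\<dots> = cinner h (\<phi> (adj (u o\<^sub>L a) o\<^sub>L (u o\<^sub>L b)) k)"
      using ab uD by (simp only: star_mult)
    also have "adj (u o\<^sub>L a) o\<^sub>L (u o\<^sub>L b) = adj a o\<^sub>L b"
      using ab u ub by (intro blinfun_eqI) (simp add: adj_comp alg(1))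
    also have "cinner h (\<phi> (adj a o\<^sub>L b) k) = cinner (v i) (v j)"
      using ab D by (simp add: ij v_def cinner_adj alg(1) flip: star_mult)
    finally show ?thesis ..
  qed
  obtain w where w: "w \<in> bops" "\<And>x y. cinner (w x) (w y) = cinner x y"
      "\<And>i. i \<in> A \<times> UNIV \<Longrightarrow> w (v i) = v' i"
    using isometric_extension [OF gram tot] by metis
  have wa: "w o\<^sub>L \<phi> a = \<phi> (u o\<^sub>L a)" if "a \<in> A" for a
    using w(3) [of "(a, _)"] that by (intro blinfun_eqI) (simp add: v_def v'_def)
  \<comment> \<open>Surjectivity of \<open>w\<close>: multiplication by \<open>adj u\<close>
    preserves \<open>A\<close>, so every \<open>\<phi> a\<close> is \<open>w\<close> applied after
    \<open>\<phi> (adj u a)\<close>.\<close>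
  have "v ` (A \<times> UNIV) \<subseteq> range (blinfun_apply w)"
  proof clarify
    fix a h assume a: "a \<in> A"
    have "\<phi> a = w o\<^sub>L \<phi> (adj u o\<^sub>L a)"
      using a uD' u by (simp add: wa unitary_comp_simps)
    then show "v (a, h) \<in> range (blinfun_apply w)"
      by (simp add: v_def)
  qed
  then have wu: "unitary w"
    using w tot by (intro unitaryI) auto
  \<comment> \<open>On a vector \<open>\<phi> b h\<close> both sides become
    \<open>\<phi> (a u b) h\<close>, because \<open>w\<close> acts on it by inserting
    \<open>u\<close> in front of \<open>b\<close>; such vectors are total.\<close>
  have aw: "\<phi> a o\<^sub>L w = \<phi> (a o\<^sub>L u)" if "a \<in> A" for a
  proof (rule bops_eqI [OF _ _ tot])
    fix x assume "x \<in> v ` (A \<times> UNIV)"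
    then obtain b h where b: "b \<in> A" "x = \<phi> b h"
      by (auto simp: v_def)
    have "\<phi> a o\<^sub>L w o\<^sub>L \<phi> b = \<phi> (a o\<^sub>L u) o\<^sub>L \<phi> b"
      using that b(1) uD by (simp add: blinfun_compose_assoc wa flip: D(5))
    then show "(\<phi> a o\<^sub>L w) x = \<phi> (a o\<^sub>L u) x"
      using b(2) by (metis blinfun_apply_blinfun_compose)
  qed (use that w uD D alg in auto)
  have "w \<in> multipliers A"
    unfolding multipliers_def
  proof (intro CollectI conjI ballI)
    show "w \<in> bops" by (fact w)
    fix b assume "b \<in> A"
    then obtain a where "a \<in> A" "b = \<phi> a"
      using ran by blast
    then show "w o\<^sub>L b \<in> A" "b o\<^sub>L w \<in> A"
      using wa aw D uD by auto
  qed
  then show thesis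
    using that wu wa aw by blast
qed

lemma Inn_subset: "star_algebra A \<Longrightarrow> Inn A \<subseteq> star_automorphisms A"
  by (auto simp: Inn_def Ad_multiplier)

text \<open>Conjugating \<open>Ad A u\<close> by an automorphism \<open>\<phi>\<close> gives
  \<open>Ad A w\<close>, where \<open>w\<close> is the transported multiplier of
  \<open>u\<close>.\<close>

lemma Inn_normal:
  assumes A: "star_algebra A" and nd: "nondegenerate_algebra A"
  shows "Inn A \<lhd> Aut A"
proof -
  interpret G: group "Aut A"
    using A by (rule group_Aut)
  note alg = star_algebraD [OF A]
  have one: "Ad A id_blinfun = \<one>\<^bsub>Aut A\<^esub>"
    by (auto simp: Ad_def one_Aut fun_eq_iff)
  have idm: "id_blinfun \<in> multipliers A"
    using A by (simp add: multipliers_id star_algebra_def)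
  have mult: "Ad A u \<otimes>\<^bsub>Aut A\<^esub> Ad A v = Ad A (u o\<^sub>L v)"
    if "unitary u" "u \<in> multipliers A" "unitary v" "v \<in> multipliers A" for u v
    using that by (intro Ad_mult A Ad_multiplier)
  have inv: "inv\<^bsub>Aut A\<^esub> Ad A u = Ad A (adj u)" if u: "unitary u" "u \<in> multipliers A" for u
  proof (rule G.inv_equality)
    have "Ad A (adj u) \<otimes>\<^bsub>Aut A\<^esub> Ad A u = Ad A (adj u o\<^sub>L u)"
      using u by (intro mult unitary_adj multipliers_adj A)
    then show "Ad A (adj u) \<otimes>\<^bsub>Aut A\<^esub> Ad A u = \<one>\<^bsub>Aut A\<^esub>"
      using u(1) one by (simp add: unitary_def)
  qed (use u A in \<open>auto simp: Ad_multiplier unitary_adj multipliers_adj\<close>)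
  have sub: "subgroup (Inn A) (Aut A)"
  proof (rule G.subgroupI)
    show "Inn A \<subseteq> carrier (Aut A)"
      using Inn_subset [OF A] by simp
    show "Inn A \<noteq> {}"
      using idm unitary_id by (auto simp: Inn_def)
    show "inv\<^bsub>Aut A\<^esub> a \<in> Inn A" if "a \<in> Inn A" for a
      using that inv unitary_adj multipliers_adj [OF A] by (auto simp: Inn_def)
    show "a \<otimes>\<^bsub>Aut A\<^esub> b \<in> Inn A" if "a \<in> Inn A" "b \<in> Inn A" for a b
      using that mult unitary_comp multipliers_comp unfolding Inn_def by fastforce
  qed
  have "\<phi> \<otimes>\<^bsub>Aut A\<^esub> \<iota> \<otimes>\<^bsub>Aut A\<^esub> inv\<^bsub>Aut A\<^esub> \<phi> \<in> Inn A" if \<phi>: "\<phi> \<in> carrier (Aut A)"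
    and \<iota>: "\<iota> \<in> Inn A" for \<phi> \<iota>
  proof -
    obtain u where u: "\<iota> = Ad A u" "unitary u" "u \<in> multipliers A"
      using \<iota> by (auto simp: Inn_def)
    note D = star_automorphismsD [OF \<phi> [unfolded carrier_Aut]]
    obtain w where w: "unitary w" "w \<in> multipliers A" "\<And>a. a \<in> A \<Longrightarrow> w o\<^sub>L \<phi> a = \<phi> (u o\<^sub>L a)"
        "\<And>a. a \<in> A \<Longrightarrow> \<phi> a o\<^sub>L w = \<phi> (a o\<^sub>L u)"
      using transported_multiplier [OF A nd] \<phi> u(2,3) by (metis carrier_Aut)
    note Adu = Ad_multiplier [OF A u(2,3)] and Adw = Ad_multiplier [OF A w(1,2)]
    have "\<phi> \<otimes>\<^bsub>Aut A\<^esub> Ad A u = Ad A w \<otimes>\<^bsub>Aut A\<^esub> \<phi>"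
    proof -
      have "compose A \<phi> (Ad A u) a = compose A (Ad A w) \<phi> a" if a: "a \<in> A" for a
      proof -
        \<comment> \<open>Detaching \<open>adj u\<close> to the right separates the two one-sided
          rules: \<open>w\<close> enters from the left through \<open>u\<close>, and its adjoint
          from the right through \<open>adj u\<close>.\<close>
        let ?b = "a o\<^sub>L adj u"
        have b: "?b \<in> A"
          using a multipliersD [OF multipliers_adj [OF A u(3)]] by simp
        have "\<phi> ?b o\<^sub>L w = \<phi> a"
          using w(4) [OF b] u(2) by (simp add: unitary_comp_simps)
        then have *: "\<phi> a o\<^sub>L adj w = \<phi> ?b"
          using w(1) by (metis unitary_comp_simps(3))
        have "compose A \<phi> (Ad A u) a = \<phi> (u o\<^sub>L ?b)"
          using a by (simp add: compose_eq Ad_apply blinfun_compose_assoc)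
        also have "\<dots> = w o\<^sub>L (\<phi> a o\<^sub>L adj w)"
          using w(3) [OF b] * by simp
        also have "\<dots> = compose A (Ad A w) \<phi> a"
          using a D(7) by (simp add: compose_eq Ad_apply blinfun_compose_assoc)
        finally show ?thesis .
      qed
      then have "compose A \<phi> (Ad A u) = compose A (Ad A w) \<phi>"
        by (intro extensionalityI [of _ A]) auto
      then show ?thesis
        using \<phi> Adu Adw by (simp add: mult_Aut)
    qed
    then have "\<phi> \<otimes>\<^bsub>Aut A\<^esub> \<iota> \<otimes>\<^bsub>Aut A\<^esub> inv\<^bsub>Aut A\<^esub> \<phi> = Ad A w"
      using u \<phi> Adw G.m_assoc [of "Ad A w" \<phi> "inv\<^bsub>Aut A\<^esub> \<phi>"]
        by (metis G.inv_closed G.r_inv G.r_one carrier_Aut)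
    then show ?thesis
      using w by (auto simp: Inn_def)
  qed
  with sub show ?thesis
    using G.normal_inv_iff by blast
qed

lemma Out_class_mult:
  assumes "star_algebra A" "nondegenerate_algebra A"
    and "\<phi> \<in> star_automorphisms A" "\<psi> \<in> star_automorphisms A"
  shows "Out_class A \<phi> \<otimes>\<^bsub>Out A\<^esub> Out_class A \<psi> = Out_class A (\<phi> \<otimes>\<^bsub>Aut A\<^esub> \<psi>)"
  using normal.rcos_sum [OF Inn_normal [OF assms(1,2)]] assms(3,4)
  by (simp add: Out_class_def Out_def FactGroup_def)

lemma Out_class_carrier: "\<phi> \<in> star_automorphisms A \<Longrightarrow> Out_class A \<phi> \<in> carrier (Out A)"
  by (auto simp: Out_class_def Out_def FactGroup_def RCOSETS_def)

lemma Out_class_eq_iff: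
  assumes A: "star_algebra A" "nondegenerate_algebra A"
    and \<phi>: "\<phi> \<in> star_automorphisms A" and \<psi>: "\<psi> \<in> star_automorphisms A"
  shows "Out_class A \<phi> = Out_class A \<psi> \<longleftrightarrow>
    (\<exists>m. unitary m \<and> m \<in> multipliers A \<and> \<phi> = Ad A m \<otimes>\<^bsub>Aut A\<^esub> \<psi>)"
proof -
  interpret N: normal "Inn A" "Aut A"
    using A by (rule Inn_normal)
  have "Out_class A \<phi> = Out_class A \<psi> \<longleftrightarrow> \<phi> \<in> Inn A #>\<^bsub>Aut A\<^esub> \<psi>"
    unfolding Out_class_def using \<phi> \<psi>
    by (metis N.rcos_self N.repr_independence N.subgroup_axioms carrier_Aut)
  then show ?thesis
    unfolding r_coset_def Inn_def by auto
qed

section \<open>The group of coarse equivalences\<close>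

context coarse_space
begin

lemma carrierD: "E \<in> \<E> \<Longrightarrow> (x, y) \<in> E \<Longrightarrow> x \<in> X \<and> y \<in> X"
  using sub_carrier by blast

text \<open>The usual relation of closeness of maps.\<close>

definition near :: "('x \<Rightarrow> 'x) \<Rightarrow> ('x \<Rightarrow> 'x) \<Rightarrow> bool" where
  "near f g \<longleftrightarrow> (\<lambda>x. (f x, g x)) ` X \<in> \<E>"

definition controlled :: "('x \<Rightarrow> 'x) \<Rightarrow> bool" where
  "controlled f \<longleftrightarrow> (\<forall>E\<in>\<E>. map_prod f f ` E \<in> \<E>)"

lemma nearI: "E \<in> \<E> \<Longrightarrow> (\<And>x. x \<in> X \<Longrightarrow> (f x, g x) \<in> E) \<Longrightarrow> near f g"
  unfolding near_def by (erule subset_closed) auto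

lemma nearE:
  assumes "near f g"
  obtains E where "E \<in> \<E>" "\<And>x. x \<in> X \<Longrightarrow> (f x, g x) \<in> E"
  using assms unfolding near_def by blast

lemma near_refl: "f \<in> X \<rightarrow> X \<Longrightarrow> near f f"
  using diagonal by (rule nearI) auto

lemma near_sym: "near f g \<Longrightarrow> near g f"
  by (metis converse_closed converse_iff nearE nearI)

lemma near_trans: "near f g \<Longrightarrow> near g h \<Longrightarrow> near f h"
  by (erule nearE, erule nearE, rule nearI, erule comp_closed) auto

lemma near_comp_right: "near f g \<Longrightarrow> h \<in> X \<rightarrow> X \<Longrightarrow> near (f \<circ> h) (g \<circ> h)"
  by (erule nearE, erule nearI) auto

lemma controlledD: "controlled f \<Longrightarrow> E \<in> \<E> \<Longrightarrow> map_prod f f ` E \<in> \<E>"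
  by (simp add: controlled_def)

lemma near_comp_left: "near f g \<Longrightarrow> controlled h \<Longrightarrow> near (h \<circ> f) (h \<circ> g)"
  by (erule nearE, rule nearI, erule controlledD) auto

lemma controlled_comp: "controlled f \<Longrightarrow> controlled g \<Longrightarrow> controlled (f \<circ> g)"
  unfolding controlled_def
proof
  fix E assume "\<forall>E\<in>\<E>. map_prod f f ` E \<in> \<E>" "\<forall>E\<in>\<E>. map_prod g g ` E \<in> \<E>" "E \<in> \<E>"
  then have "map_prod f f ` map_prod g g ` E \<in> \<E>"
    by blast
  then show "map_prod (f \<circ> g) (f \<circ> g) ` E \<in> \<E>"
    by (simp add: image_comp map_prod.comp)
qed

lemma controlled_id: "controlled id"
  by (simp add: controlled_def map_prod.id)

lemma near_comp:
  assumes "near f f'" "near g g'" "controlled f" "g' \<in> X \<rightarrow> X"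
  shows "near (f \<circ> g) (f' \<circ> g')"
  using near_trans [OF near_comp_left [OF assms(2,3)] near_comp_right [OF assms(1,4)]] .

lemma coarse_leI: "E \<in> \<E> \<Longrightarrow> F \<in> \<E> \<Longrightarrow> R' \<subseteq> F O R O E \<Longrightarrow> coarse_le \<E> R' R"
  unfolding coarse_le_def by blast

lemma coarse_le_refl:
  assumes "R \<subseteq> X \<times> X" shows "coarse_le \<E> R R"
  using assms by (intro coarse_leI [OF diagonal diagonal]) fastforce

lemma coarse_le_trans: "coarse_le \<E> R S \<Longrightarrow> coarse_le \<E> S T \<Longrightarrow> coarse_le \<E> R T"
proof -
  assume "coarse_le \<E> R S" "coarse_le \<E> S T"
  then obtain E F E' F' where *: "E \<in> \<E>" "F \<in> \<E>" "R \<subseteq> F O S O E" "E' \<in> \<E>" "F' \<in> \<E>" "S \<subseteq> F' O T O E'"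
    unfolding coarse_le_def by auto
  then have "R \<subseteq> (F O F') O T O (E' O E)"
  proof -
    have "F O S O E \<subseteq> F O (F' O T O E') O E"
      using * by (intro relcomp_mono) auto
    then show ?thesis
      using * by (simp add: O_assoc)
  qed
  then show ?thesis
    using * by (intro coarse_leI) (auto intro: comp_closed)
qed

lemma coarse_eq_refl: "R \<subseteq> X \<times> X \<Longrightarrow> coarse_eq \<E> R R"
  by (simp add: coarse_eq_def coarse_le_refl)

lemma coarse_class_eq_iff:
  assumes "R \<subseteq> X \<times> X" "S \<subseteq> X \<times> X"
  shows "coarse_class X \<E> R = coarse_class X \<E> S \<longleftrightarrow> coarse_eq \<E> R S"
proof
  assume "coarse_class X \<E> R = coarse_class X \<E> S"
  moreover have "S \<in> coarse_class X \<E> S"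
    using assms by (simp add: coarse_class_def coarse_eq_refl)
  ultimately show "coarse_eq \<E> R S"
    by (auto simp: coarse_class_def)
next
  assume "coarse_eq \<E> R S"
  then show "coarse_class X \<E> R = coarse_class X \<E> S"
    unfolding coarse_class_def coarse_eq_def using coarse_le_trans by blast
qed

lemma graph_rel_subset: "f \<in> X \<rightarrow> X \<Longrightarrow> graph_rel X f \<subseteq> X \<times> X"
  by (auto simp: graph_rel_def)

text \<open>The entourage on the source side can be moved through a controlled map: \<open>f\<close>
  carries \<open>E\<close> to an entourage on the target side. Comparison with a graph thereby
  becomes a pointwise condition.\<close>

lemma coarse_le_graph_rel:
  assumes f: "controlled f" and S: "S \<subseteq> X \<times> X" and le: "coarse_le \<E> S (graph_rel X f)"
  obtains E where "E \<in> \<E>" "\<And>x y. (y, x) \<in> S \<Longrightarrow> (y, f x) \<in> E"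
proof -
  obtain E F where EF: "E \<in> \<E>" "F \<in> \<E>" "S \<subseteq> F O graph_rel X f O E"
    using le unfolding coarse_le_def by blast
  show thesis
  proof
    show "F O (map_prod f f ` E) \<in> \<E>"
      by (intro comp_closed controlledD EF f)
    show "(y, f x) \<in> F O (map_prod f f ` E)" if yx: "(y, x) \<in> S" for x y
    proof -
      obtain z where "(y, f z) \<in> F" "(z, x) \<in> E"
        using subsetD [OF EF(3) yx] by (auto simp: graph_rel_def)
      then show ?thesis
        by force
    qed
  qed
qed

lemma coarse_leI_graph_rel:
  assumes E: "E \<in> \<E>" and S: "S \<subseteq> X \<times> X" and "\<And>x y. (y, x) \<in> S \<Longrightarrow> (y, f x) \<in> E"
  shows "coarse_le \<E> S (graph_rel X f)"
proof (rule coarse_leI [OF diagonal E])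
  show "S \<subseteq> E O graph_rel X f O Id_on X"
  proof clarify
    fix y x assume *: "(y, x) \<in> S"
    then have "(f x, x) \<in> graph_rel X f" "(x, x) \<in> Id_on X"
      using S by (auto simp: graph_rel_def)
    then show "(y, x) \<in> E O graph_rel X f O Id_on X"
      using assms(3) [OF *] by blast
  qed
qed

lemma graph_rel_near_le:
  assumes "f \<in> X \<rightarrow> X" "near f g"
  shows "coarse_le \<E> (graph_rel X f) (graph_rel X g)"
proof -
  obtain E where "E \<in> \<E>" "\<And>x. x \<in> X \<Longrightarrow> (f x, g x) \<in> E"
    using assms(2) nearE by blast
  then show ?thesis
    by (intro coarse_leI_graph_rel [of E] graph_rel_subset assms) (auto simp: graph_rel_def)
qed

lemma coarse_eq_graph_rel_iff:
  assumes f: "f \<in> X \<rightarrow> X" "controlled f" and g: "g \<in> X \<rightarrow> X"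
  shows "coarse_eq \<E> (graph_rel X f) (graph_rel X g) \<longleftrightarrow> near f g"
proof
  assume "coarse_eq \<E> (graph_rel X f) (graph_rel X g)"
  then have "coarse_le \<E> (graph_rel X g) (graph_rel X f)"
    by (simp add: coarse_eq_def)
  then obtain E where E: "E \<in> \<E>" "\<And>x y. (y, x) \<in> graph_rel X g \<Longrightarrow> (y, f x) \<in> E"
    using coarse_le_graph_rel [OF f(2) graph_rel_subset [OF g]] by metis
  then have "near g f"
    by (intro nearI [OF E(1)]) (auto simp: graph_rel_def)
  then show "near f g"
    by (rule near_sym)
next
  assume "near f g"
  then show "coarse_eq \<E> (graph_rel X f) (graph_rel X g)"
    using f g by (simp add: coarse_eq_def graph_rel_near_le near_sym)
qed

definition map_class :: "('x \<Rightarrow> 'x) \<Rightarrow> 'x rel set" where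
  "map_class f = coarse_class X \<E> (graph_rel X f)"

lemma map_class_eq_iff:
  assumes "f \<in> X \<rightarrow> X" "controlled f" "g \<in> X \<rightarrow> X"
  shows "map_class f = map_class g \<longleftrightarrow> near f g"
  using assms by (simp add: map_class_def coarse_class_eq_iff graph_rel_subset
    coarse_eq_graph_rel_iff)

lemma graph_rel_mem_map_class_iff:
  assumes "f \<in> X \<rightarrow> X" "controlled f" "g \<in> X \<rightarrow> X"
  shows "graph_rel X g \<in> map_class f \<longleftrightarrow> near f g"
  using assms by (simp add: map_class_def coarse_class_def graph_rel_subset coarse_eq_graph_rel_iff)

lemma map_class_id: "map_class id = coarse_class X \<E> (Id_on X)"
proof -
  have "graph_rel X id = Id_on X"
    by (auto simp: graph_rel_def)
  then show ?thesis
    by (simp add: map_class_def)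
qed

lemma coarse_map_map_class:
  assumes f: "f \<in> X \<rightarrow> X" "controlled f"
  shows "coarse_map X \<E> (map_class f)"
  unfolding coarse_map_def map_class_def
proof (intro exI conjI)
  show "graph_rel X f \<subseteq> X \<times> X"
    using f by (simp add: graph_rel_subset)
  show "controlled_rel \<E> (graph_rel X f)"
    unfolding controlled_rel_def
  proof
    fix E assume E: "E \<in> \<E>"
    have "graph_rel X f O E O (graph_rel X f)\<inverse> \<subseteq> map_prod f f ` E"
      by (auto simp: graph_rel_def)
    then show "graph_rel X f O E O (graph_rel X f)\<inverse> \<in> \<E>"
      using controlledD [OF f(2) E] subset_closed by blast
  qed
  have "X = rapp (Id_on X) X"
    by (auto simp: rapp_def)
  moreover have "Range (graph_rel X f) = X"
    by (auto simp: graph_rel_def)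
  ultimately show "coarsely_dense X \<E> (Range (graph_rel X f))"
    using diagonal by (auto simp: coarsely_dense_def)
qed (rule refl)

text \<open>Coarse density of the domain provides for each \<open>y\<close> a nearby point
  \<open>p y\<close> of the domain, and \<open>f y\<close> is any \<open>R\<close>-value there. Two
  \<open>R\<close>-values over nearby points are close because \<open>R\<close> is controlled, which
  gives controlledness of \<open>f\<close> and the comparison of \<open>R\<close> with its
  graph.\<close>

lemma coarse_map_obtain_fun:
  assumes "coarse_map X \<E> F"
  obtains f where "f \<in> X \<rightarrow> X" "controlled f" "F = map_class f"
proof -
  obtain R where R: "R \<subseteq> X \<times> X" "F = coarse_class X \<E> R" "controlled_rel \<E> R"
    "coarsely_dense X \<E> (Range R)"
    using assms unfolding coarse_map_def by blast
  then obtain E where E: "E \<in> \<E>" "X = rapp E (Range R)"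
    unfolding coarsely_dense_def by blast
  have "\<forall>y\<in>X. \<exists>z x. (z, x) \<in> R \<and> (y, x) \<in> E"
    using E(2) unfolding rapp_def by blast
  then obtain f p where fp: "\<And>y. y \<in> X \<Longrightarrow> (f y, p y) \<in> R" "\<And>y. y \<in> X \<Longrightarrow> (y, p y) \<in> E"
    by metis
  have fX: "f \<in> X \<rightarrow> X"
    using fp(1) R(1) by blast
  have ctl: "controlled f"
    unfolding controlled_def
  proof
    fix E' assume E': "E' \<in> \<E>"
    have "map_prod f f ` E' \<subseteq> R O (E\<inverse> O E' O E) O R\<inverse>"
    proof clarify
      fix x y assume xy: "(x, y) \<in> E'"
      then have "(f x, p x) \<in> R" "(p x, x) \<in> E\<inverse>" "(y, p y) \<in> E" "(p y, f y) \<in> R\<inverse>"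
        using fp carrierD [OF E'] by auto
      then show "(f x, f y) \<in> R O (E\<inverse> O E' O E) O R\<inverse>"
        using xy by (intro relcompI)
    qed
    moreover have "E\<inverse> O E' O E \<in> \<E>"
      using E E' by (intro comp_closed converse_closed)
    ultimately show "map_prod f f ` E' \<in> \<E>"
      using R(3) subset_closed unfolding controlled_rel_def by blast
  qed
  have "coarse_le \<E> (graph_rel X f) R"
  proof (rule coarse_leI [OF converse_closed [OF E(1)] diagonal])
    show "graph_rel X f \<subseteq> Id_on X O R O E\<inverse>"
      using fp fX by (fastforce simp: graph_rel_def)
  qed
  moreover have "coarse_le \<E> R (graph_rel X f)"
  proof (rule coarse_leI_graph_rel)
    show "R O E O R\<inverse> \<in> \<E>"
      using R(3) E(1) unfolding controlled_rel_def by blast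
    show "(z, f x) \<in> R O E O R\<inverse>" if "(z, x) \<in> R" for x z
      using that fp R(1) by blast
  qed (rule R)
  ultimately have "F = map_class f"
    unfolding R(2) map_class_def using R(1) fX
    by (simp add: coarse_class_eq_iff graph_rel_subset coarse_eq_def)
  with fX ctl show thesis
    by (rule that)
qed

text \<open>The description inside \<open>coarse_comp\<close> is unique because changing either
  function to a close one changes the composite only to a close one; controlledness of the outer
  function is what makes this true for the inner one.\<close>

lemma coarse_comp_map_class:
  assumes f: "f \<in> X \<rightarrow> X" "controlled f" and g: "g \<in> X \<rightarrow> X" "controlled g"
  shows "coarse_comp X \<E> (map_class f) (map_class g) = map_class (f \<circ> g)"
  unfolding coarse_comp_def
proof (rule the_equality)
  show "\<exists>f' g'. f' \<in> X \<rightarrow> X \<and> g' \<in> X \<rightarrow> X \<and> graph_rel X f' \<in> map_class f \<and>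
     graph_rel X g' \<in> map_class g \<and> map_class (f \<circ> g) = coarse_class X \<E> (graph_rel X (f' \<circ> g'))"
    unfolding map_class_def [symmetric]
    using assms by (intro exI [of _ f] exI [of _ g]) (simp add: graph_rel_mem_map_class_iff
      near_refl)
next
  fix H assume "\<exists>f' g'. f' \<in> X \<rightarrow> X \<and> g' \<in> X \<rightarrow> X \<and> graph_rel X f' \<in> map_class f \<and>
     graph_rel X g' \<in> map_class g \<and> H = coarse_class X \<E> (graph_rel X (f' \<circ> g'))"
  then obtain f' g' where *: "f' \<in> X \<rightarrow> X" "g' \<in> X \<rightarrow> X" "near f f'" "near g g'"
    "H = map_class (f' \<circ> g')"
    unfolding map_class_def [symmetric] using graph_rel_mem_map_class_iff [OF f]
      graph_rel_mem_map_class_iff [OF g] by metis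
  then have "near (f \<circ> g) (f' \<circ> g')"
    using assms by (intro near_comp) auto
  moreover have "f \<circ> g \<in> X \<rightarrow> X" "f' \<circ> g' \<in> X \<rightarrow> X"
    using * f g by auto
  ultimately have "map_class (f \<circ> g) = map_class (f' \<circ> g')"
    using f g by (simp add: map_class_eq_iff controlled_comp)
  then show "H = map_class (f \<circ> g)"
    using * by simp
qed

text \<open>The inverse stays an explicit controlled function, since it is what pulls supports back
  when adjoints are taken.\<close>

definition coarse_inverses :: "('x \<Rightarrow> 'x) \<Rightarrow> ('x \<Rightarrow> 'x) \<Rightarrow> bool" where
  "coarse_inverses f g \<longleftrightarrow> f \<in> X \<rightarrow> X \<and> controlled f \<and> g \<in> X \<rightarrow> X \<and> controlled g \<and>
     near (f \<circ> g) id \<and> near (g \<circ> f) id"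

lemma coarse_inverses_sym: "coarse_inverses f g \<Longrightarrow> coarse_inverses g f"
  by (simp add: coarse_inverses_def)

lemma coarse_inverses_comp:
  assumes "coarse_inverses f f'" "coarse_inverses g g'"
  shows "coarse_inverses (f \<circ> g) (g' \<circ> f')"
proof -
  \<comment> \<open>Proved for arbitrary pairs, because the other composite is the same assertion
    with the inverse maps in reversed order.\<close>
  have "near (f \<circ> g \<circ> (g' \<circ> f')) id" if "coarse_inverses f f'" "coarse_inverses g g'" for f f' g g'
  proof -
    have "near (f \<circ> ((g \<circ> g') \<circ> f')) (f \<circ> (id \<circ> f'))"
      using that by (intro near_comp_left near_comp_right) (auto simp: coarse_inverses_def)
    then show ?thesis
      using that near_trans by (auto simp: coarse_inverses_def o_assoc)
  qed
  from this [OF assms] this [OF assms [THEN coarse_inverses_sym, THEN coarse_inverses_sym]]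
    this [OF coarse_inverses_sym [OF assms(2)] coarse_inverses_sym [OF assms(1)]]
  show ?thesis
    using assms unfolding coarse_inverses_def by (auto intro!: controlled_comp)
qed

lemma carrier_CE_iff: "F \<in> carrier (CE X \<E>) \<longleftrightarrow> (\<exists>f g. coarse_inverses f g \<and> F = map_class f)"
proof
  assume "F \<in> carrier (CE X \<E>)"
  then obtain G where F: "coarse_map X \<E> F" and G: "coarse_map X \<E> G"
    and "coarse_comp X \<E> F G = map_class id" "coarse_comp X \<E> G F = map_class id"
    by (auto simp: CE_def coarse_equivalence_def map_class_id)
  moreover obtain f g where "f \<in> X \<rightarrow> X" "controlled f" "F = map_class f"
     "g \<in> X \<rightarrow> X" "controlled g" "G = map_class g"
    using coarse_map_obtain_fun F G by metis
  moreover have "f \<circ> g \<in> X \<rightarrow> X" "g \<circ> f \<in> X \<rightarrow> X"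
    using calculation by auto
  ultimately have "coarse_inverses f g" "F = map_class f"
    by (simp_all add: coarse_inverses_def coarse_comp_map_class map_class_eq_iff controlled_comp)
  then show "\<exists>f g. coarse_inverses f g \<and> F = map_class f"
    by blast
next
  assume "\<exists>f g. coarse_inverses f g \<and> F = map_class f"
  then obtain f g where *: "f \<in> X \<rightarrow> X" "controlled f" "g \<in> X \<rightarrow> X" "controlled g"
      "near (f \<circ> g) id" "near (g \<circ> f) id" "F = map_class f"
    unfolding coarse_inverses_def by blast
  moreover have "f \<circ> g \<in> X \<rightarrow> X" "g \<circ> f \<in> X \<rightarrow> X"
    using * by auto
  ultimately have "map_class (f \<circ> g) = map_class id" "map_class (g \<circ> f) = map_class id"
    by (simp_all add: map_class_eq_iff controlled_comp)
  then show "F \<in> carrier (CE X \<E>)"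
    using * by (auto simp: CE_def coarse_equivalence_def coarse_map_map_class coarse_comp_map_class
        simp flip: map_class_id intro!: exI [of _ "map_class g"])
qed

lemma mult_CE:
  assumes "f \<in> X \<rightarrow> X" "controlled f" "g \<in> X \<rightarrow> X" "controlled g"
  shows "map_class f \<otimes>\<^bsub>CE X \<E>\<^esub> map_class g = map_class (f \<circ> g)"
  using assms by (simp add: CE_def coarse_comp_map_class)

lemma one_CE: "\<one>\<^bsub>CE X \<E>\<^esub> = map_class id"
  by (simp add: CE_def map_class_id)

lemma coarse_inverses_id: "coarse_inverses id id"
  by (simp add: coarse_inverses_def controlled_id near_refl)

lemma group_CE: "group (CE X \<E>)"
proof (rule groupI)
  fix F G assume "F \<in> carrier (CE X \<E>)" "G \<in> carrier (CE X \<E>)"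
  then obtain f f' g g' where fg: "coarse_inverses f f'" "coarse_inverses g g'"
    and FG: "F = map_class f" "G = map_class g"
    unfolding carrier_CE_iff by blast
  then have "F \<otimes>\<^bsub>CE X \<E>\<^esub> G = map_class (f \<circ> g)"
    by (simp add: mult_CE coarse_inverses_def)
  then show "F \<otimes>\<^bsub>CE X \<E>\<^esub> G \<in> carrier (CE X \<E>)"
    using coarse_inverses_comp [OF fg] carrier_CE_iff by metis
  fix H assume "H \<in> carrier (CE X \<E>)"
  then obtain h h' where h: "coarse_inverses h h'" "H = map_class h"
    unfolding carrier_CE_iff by blast
  have "f \<circ> g \<in> X \<rightarrow> X" "g \<circ> h \<in> X \<rightarrow> X" "controlled (f \<circ> g)" "controlled (g \<circ> h)"
    using fg h by (auto simp: coarse_inverses_def controlled_comp)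
  then show "F \<otimes>\<^bsub>CE X \<E>\<^esub> G \<otimes>\<^bsub>CE X \<E>\<^esub> H = F \<otimes>\<^bsub>CE X \<E>\<^esub> (G \<otimes>\<^bsub>CE X \<E>\<^esub> H)"
    using FG fg h by (simp add: mult_CE coarse_inverses_def o_assoc)
next
  show "\<one>\<^bsub>CE X \<E>\<^esub> \<in> carrier (CE X \<E>)"
    using coarse_inverses_id carrier_CE_iff one_CE by metis
next
  fix F assume "F \<in> carrier (CE X \<E>)"
  then obtain f g where fg: "coarse_inverses f g" "F = map_class f"
    unfolding carrier_CE_iff by blast
  then show "\<one>\<^bsub>CE X \<E>\<^esub> \<otimes>\<^bsub>CE X \<E>\<^esub> F = F"
    by (simp add: one_CE mult_CE coarse_inverses_def controlled_id)
  have "map_class g \<in> carrier (CE X \<E>)"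
    using fg coarse_inverses_sym carrier_CE_iff by metis
  moreover have "map_class g \<otimes>\<^bsub>CE X \<E>\<^esub> F = \<one>\<^bsub>CE X \<E>\<^esub>"
  proof -
    have "g \<circ> f \<in> X \<rightarrow> X"
      using fg by (auto simp: coarse_inverses_def)
    then show ?thesis
      using fg by (simp add: one_CE mult_CE coarse_inverses_def map_class_eq_iff controlled_comp)
  qed
  ultimately show "\<exists>G\<in>carrier (CE X \<E>). G \<otimes>\<^bsub>CE X \<E>\<^esub> F = \<one>\<^bsub>CE X \<E>\<^esub>"
    by blast
qed

end

section \<open>Operators on discrete modules\<close>

context coarse_module
begin

lemma P_bops [simp]: "A \<in> \<AA> \<Longrightarrow> P A \<in> bops"
  using proj projection_bops by blast

lemma P_adj [simp]: "A \<in> \<AA> \<Longrightarrow> adj (P A) = P A"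
  using proj projection_adj by blast

lemma P_cinner: "A \<in> \<AA> \<Longrightarrow> cinner (P A x) y = cinner x (P A y)"
  using proj by (simp add: projection_def)

lemma P_norm: "A \<in> \<AA> \<Longrightarrow> norm (P A) \<le> 1"
  using proj projection_norm by blast

lemma P_P: "A \<in> \<AA> \<Longrightarrow> B \<in> \<AA> \<Longrightarrow> P A (P B h) = P (A \<inter> B) h"
  by (simp add: proj_Int)

lemma P_P_subset:
  assumes "A \<in> \<AA>" "B \<in> \<AA>" "A \<subseteq> B"
  shows "P A (P B h) = P A h" "P B (P A h) = P A h"
  using assms by (simp_all add: P_P Int_absorb1 Int_absorb2)

lemma P_P_disjoint: "A \<in> \<AA> \<Longrightarrow> B \<in> \<AA> \<Longrightarrow> A \<inter> B = {} \<Longrightarrow> P A (P B h) = 0"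
  by (simp add: P_P proj_empty)

lemma P_P_same [simp]: "A \<in> \<AA> \<Longrightarrow> P A (P A h) = P A h"
  by (simp add: P_P_subset)

lemma measurable_subset: "A \<in> \<AA> \<Longrightarrow> A \<subseteq> X"
  using sets_into_space by blast

end

text \<open>One witness of discreteness is fixed, so that all later sets are built from the same
  pieces.\<close>

locale discrete_coarse_module = coarse_module X \<E> \<AA> P
  for X :: "'x set" and \<E> :: "'x rel set" and \<AA> :: "'x set set"
    and P :: "'x set \<Rightarrow> ('h::chilbert_space \<Rightarrow>\<^sub>L 'h)" +
  fixes D :: "'x rel" and \<Q> :: "'x set set"
  assumes D: "gauge_of X \<E> D"
    and partition: "partition_on X \<Q>"
    and piece: "Q \<in> \<Q> \<Longrightarrow> Q \<in> \<AA>" "Q \<in> \<Q> \<Longrightarrow> Q \<times> Q \<subseteq> D"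
    and sum_pieces: "((\<lambda>Q. P Q h) has_sum h) \<Q>"
    and measurableI: "C \<subseteq> X \<Longrightarrow> (\<And>Q. Q \<in> \<Q> \<Longrightarrow> C \<inter> Q \<in> \<AA>) \<Longrightarrow> C \<in> \<AA>"
begin

lemma D_mem: "D \<in> \<E>"
  using D by (simp add: gauge_of_def)

lemma ex_piece:
  assumes "x \<in> X" obtains Q where "Q \<in> \<Q>" "x \<in> Q"
  using assms partition by (auto simp: partition_on_def)

lemma piece_nonempty: "Q \<in> \<Q> \<Longrightarrow> \<exists>x. x \<in> Q"
  using partition unfolding partition_on_def by (metis ex_in_conv)

lemma piece_unique: "Q \<in> \<Q> \<Longrightarrow> Q' \<in> \<Q> \<Longrightarrow> x \<in> Q \<Longrightarrow> x \<in> Q' \<Longrightarrow> Q = Q'"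
  using partition by (auto simp: partition_on_def disjoint_def)

lemma saturated_measurable:
  assumes "C \<subseteq> X" "\<And>Q. Q \<in> \<Q> \<Longrightarrow> Q \<subseteq> C \<or> Q \<inter> C = {}"
  shows "C \<in> \<AA>"
proof (rule measurableI)
  fix Q assume "Q \<in> \<Q>"
  then have "C \<inter> Q = Q \<or> C \<inter> Q = {}"
    using assms by blast
  then show "C \<inter> Q \<in> \<AA>"
    using piece \<open>Q \<in> \<Q>\<close> by auto
qed (rule assms)

lemma Union_pieces_measurable:
  assumes "\<S> \<subseteq> \<Q>"
  shows "\<Union>\<S> \<in> \<AA>"
proof (rule saturated_measurable)
  show "\<Union>\<S> \<subseteq> X"
    using assms piece measurable_subset by blast
  show "Q \<subseteq> \<Union>\<S> \<or> Q \<inter> \<Union>\<S> = {}" if "Q \<in> \<Q>" for Q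
    using that piece_unique assms by blast
qed

text \<open>This is how strong convergence of the pieces enters: a continuous linear map that kills
  all piece components of \<open>h\<close> kills \<open>h\<close>, however many pieces there
  are.\<close>

lemma vanish_on_pieces:
  fixes T :: "'h \<Rightarrow> 'c::real_normed_vector"
  assumes T: "bounded_linear T" and zero: "\<And>Q. Q \<in> \<Q> \<Longrightarrow> T (P Q h) = 0"
  shows "T h = 0"
proof -
  have "((\<lambda>Q. T (P Q h)) has_sum T h) \<Q>"
    using has_sum_bounded_linear [OF T sum_pieces] by (simp add: o_def)
  moreover have "((\<lambda>Q. T (P Q h)) has_sum 0) \<Q>"
    using zero by (intro has_sum_0) auto
  ultimately show ?thesis
    by (rule has_sum_unique)
qed

lemma eq_zeroI: "(\<And>Q. Q \<in> \<Q> \<Longrightarrow> P Q h = 0) \<Longrightarrow> h = 0"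
  using vanish_on_pieces [OF bounded_linear_ident] .

lemma sandwich_eq_zeroI:
  fixes t :: "'h \<Rightarrow>\<^sub>L 'h"
  assumes "\<And>Q h. Q \<in> \<Q> \<Longrightarrow> P B (t (P A (P Q h))) = 0"
  shows "P B o\<^sub>L t o\<^sub>L P A = 0"
proof (rule blinfun_eqI)
  fix h
  show "(P B o\<^sub>L t o\<^sub>L P A) h = (0 :: 'h \<Rightarrow>\<^sub>L 'h) h"
    using vanish_on_pieces [OF blinfun.bounded_linear_right, of "P B o\<^sub>L t o\<^sub>L P A"] assms by simp
qed

subsection \<open>Operators following a map\<close>

definition supported_along :: "('h \<Rightarrow>\<^sub>L 'h) \<Rightarrow> ('x \<Rightarrow> 'x) \<Rightarrow> 'x rel \<Rightarrow> bool" where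
  "supported_along t f E \<longleftrightarrow>
     (\<forall>B\<in>\<AA>. \<forall>A\<in>\<AA>. (\<forall>b\<in>B. \<forall>a\<in>A. (b, f a) \<notin> E) \<longrightarrow> P B o\<^sub>L t o\<^sub>L P A = 0)"

lemma supported_alongI:
  "(\<And>B A. B \<in> \<AA> \<Longrightarrow> A \<in> \<AA> \<Longrightarrow> \<forall>b\<in>B. \<forall>a\<in>A. (b, f a) \<notin> E \<Longrightarrow> P B o\<^sub>L t o\<^sub>L P A = 0) \<Longrightarrow>
    supported_along t f E"
  by (simp add: supported_along_def)

lemma supported_alongD:
  "supported_along t f E \<Longrightarrow> B \<in> \<AA> \<Longrightarrow> A \<in> \<AA> \<Longrightarrow> \<forall>b\<in>B. \<forall>a\<in>A. (b, f a) \<notin> E \<Longrightarrow>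
    P B o\<^sub>L t o\<^sub>L P A = 0"
  by (simp add: supported_along_def)

text \<open>
  \<open>supported_along t f E\<close> says $\mathrm{Supp}(t) \subseteq E \circ f$, so \<open>t\<close> tracks \<open>f\<close> if and only if
  $\mathbf{Supp}(t)$ is coarsely contained in $[f]$.
\<close>

definition tracks :: "('h \<Rightarrow>\<^sub>L 'h) \<Rightarrow> ('x \<Rightarrow> 'x) \<Rightarrow> bool" where
  "tracks t f \<longleftrightarrow> t \<in> bops \<and> (\<exists>E\<in>\<E>. supported_along t f E)"

text \<open>
  On a discrete module the support condition can be sharpened: the image of the range of \<open>P A\<close> lies in the
  range of a single \<open>P A'\<close> with \<open>A'\<close> near \<open>f ` A\<close>.
\<close>

definition pushes :: "('h \<Rightarrow>\<^sub>L 'h) \<Rightarrow> ('x \<Rightarrow> 'x) \<Rightarrow> 'x rel \<Rightarrow> bool" where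
  "pushes t f E \<longleftrightarrow>
     (\<forall>A\<in>\<AA>. \<exists>A'\<in>\<AA>. (\<forall>h. P A' (t (P A h)) = t (P A h)) \<and> (\<forall>y\<in>A'. \<exists>a\<in>A. (y, f a) \<in> E))"

lemma pushesI:
  fixes t :: "'h \<Rightarrow>\<^sub>L 'h"
  shows "(\<And>A. A \<in> \<AA> \<Longrightarrow> \<exists>A'\<in>\<AA>. (\<forall>h. P A' (t (P A h)) = t (P A h)) \<and> (\<forall>y\<in>A'. \<exists>a\<in>A. (y, f a) \<in> E)) \<Longrightarrow>
    pushes t f E"
  by (simp add: pushes_def)

lemma pushesD:
  assumes "pushes t f E" "A \<in> \<AA>"
  obtains A' where "A' \<in> \<AA>" "\<And>h. P A' (t (P A h)) = t (P A h)" "\<And>y. y \<in> A' \<Longrightarrow> \<exists>a\<in>A. (y, f a) \<in> E"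
  using bspec [OF assms(1) [unfolded pushes_def] assms(2)] by blast

lemma tracks_bops: "tracks t f \<Longrightarrow> t \<in> bops"
  by (simp add: tracks_def)

lemma tracks_id_iff: "tracks t id \<longleftrightarrow> t \<in> bops \<and> controlled_propagation \<E> \<AA> P t"
proof -
  have "separated E B A \<longleftrightarrow> (\<forall>b\<in>B. \<forall>a\<in>A. (b, id a) \<notin> E)" for E :: "'x rel" and A B
    by (auto simp: separated_def rapp_def)
  then show ?thesis
    by (simp add: tracks_def supported_along_def controlled_propagation_def supp_in_def)
qed

lemma supp_in_tracks:
  assumes t: "t \<in> bops" "supp_in \<AA> P t S" and E: "E \<in> \<E>" "\<And>x y. (y, x) \<in> S \<Longrightarrow> (y, f x) \<in> E"
  shows "tracks t f"
  unfolding tracks_def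
proof (intro conjI bexI [OF _ E(1)] supported_alongI)
  fix B A assume AB: "B \<in> \<AA>" "A \<in> \<AA>" "\<forall>b\<in>B. \<forall>a\<in>A. (b, f a) \<notin> E"
  then have "separated S B A"
    using E(2) by (auto simp: separated_def rapp_def)
  then show "P B o\<^sub>L t o\<^sub>L P A = 0"
    using t(2) AB by (simp add: supp_in_def)
qed (rule t)

lemma tracks_push:
  assumes "tracks t f"
  obtains E where "E \<in> \<E>" "pushes t f E"
proof -
  obtain E where E: "E \<in> \<E>" "supported_along t f E"
    using assms unfolding tracks_def by blast
  have "\<exists>A'\<in>\<AA>. (\<forall>h. P A' (t (P A h)) = t (P A h)) \<and> (\<forall>y\<in>A'. \<exists>a\<in>A. (y, f a) \<in> D O E)"
    if A: "A \<in> \<AA>" for A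
  proof -
    define \<S> where "\<S> = {Q \<in> \<Q>. P Q o\<^sub>L t o\<^sub>L P A \<noteq> 0}"
    have S: "\<Union>\<S> \<in> \<AA>"
      by (intro Union_pieces_measurable) (auto simp: \<S>_def)
    have "t (P A h) - P (\<Union>\<S>) (t (P A h)) = 0" for h
    proof (rule vanish_on_pieces [where T = "\<lambda>z. z - P (\<Union>\<S>) z"])
      show "bounded_linear (\<lambda>z. z - P (\<Union>\<S>) z)"
        by (intro bounded_linear_sub bounded_linear_ident blinfun.bounded_linear_right)
      fix Q assume Q: "Q \<in> \<Q>"
      show "P Q (t (P A h)) - P (\<Union>\<S>) (P Q (t (P A h))) = 0"
      proof (cases "Q \<in> \<S>")
        case True
        then have "Q \<subseteq> \<Union>\<S>"
          by blast
        then show ?thesis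
          using P_P_subset(2) [OF piece(1) [OF Q] S] by simp
      next
        case False
        then have "P Q o\<^sub>L t o\<^sub>L P A = 0"
          using Q by (simp add: \<S>_def)
        then have "P Q (t (P A h)) = 0"
          using comp_eqD [of "P Q o\<^sub>L t" "P A" 0 h] by simp
        then show ?thesis
          by simp
      qed
    qed
    moreover have "\<exists>a\<in>A. (y, f a) \<in> D O E" if y: "y \<in> \<Union>\<S>" for y
    proof -
      obtain Q where Q: "Q \<in> \<Q>" "y \<in> Q" "P Q o\<^sub>L t o\<^sub>L P A \<noteq> 0"
        using y unfolding \<S>_def by blast
      then obtain b a where "b \<in> Q" "a \<in> A" "(b, f a) \<in> E"
        using supported_alongD [OF E(2) piece(1) A] by blast
      then show ?thesis
        using piece(2) [OF Q(1)] Q(2) by blast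
    qed
    ultimately show ?thesis
      using S by (intro bexI [of _ "\<Union>\<S>"]) auto
  qed
  then show thesis
    using that [OF comp_closed [OF D_mem E(1)]] by (simp add: pushes_def)
qed

lemma tracksI_push:
  assumes "t \<in> bops" "E \<in> \<E>"
    and push: "pushes t f E"
  shows "tracks t f"
  unfolding tracks_def
proof (intro conjI bexI [OF _ assms(2)] supported_alongI)
  fix B A assume AB: "B \<in> \<AA>" "A \<in> \<AA>" "\<forall>b\<in>B. \<forall>a\<in>A. (b, f a) \<notin> E"
  obtain A' where A': "A' \<in> \<AA>" "\<And>h. P A' (t (P A h)) = t (P A h)" "\<And>y. y \<in> A' \<Longrightarrow> \<exists>a\<in>A. (y, f a) \<in> E"
    using pushesD [OF push AB(2)] by blast
  have "B \<inter> A' = {}"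
    using A'(3) AB(3) by blast
  then have "P B (P A' (t (P A h))) = 0" for h
    using AB A' by (intro P_P_disjoint)
  then show "P B o\<^sub>L t o\<^sub>L P A = 0"
    by (intro blinfun_eqI) (simp add: A'(2))
qed (rule assms)

text \<open>Pushing forms chain: \<open>t\<close> moves the range of \<open>P A\<close> into that of
  some \<open>P A'\<close>, and \<open>s\<close> moves this into that of some \<open>P A''\<close>.
  The entourage of \<open>t\<close> has to pass through \<open>f\<close>, hence the
  controlledness.\<close>

lemma tracks_comp:
  assumes s: "tracks s f" and t: "tracks t g" and f: "controlled f"
  shows "tracks (s o\<^sub>L t) (f \<circ> g)"
proof -
  obtain E where E: "E \<in> \<E>" "pushes s f E"
    using tracks_push [OF s] by blast
  obtain F where F: "F \<in> \<E>" "pushes t g F"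
    using tracks_push [OF t] by blast
  show ?thesis
  proof (rule tracksI_push [OF _ _ pushesI])
    show "E O map_prod f f ` F \<in> \<E>"
      by (intro comp_closed E controlledD f F)
    fix A assume A: "A \<in> \<AA>"
    obtain A' where A': "A' \<in> \<AA>" "\<And>h. P A' (t (P A h)) = t (P A h)"
      "\<And>y. y \<in> A' \<Longrightarrow> \<exists>a\<in>A. (y, g a) \<in> F"
      using pushesD [OF F(2) A] by blast
    obtain A'' where A'': "A'' \<in> \<AA>" "\<And>h. P A'' (s (P A' h)) = s (P A' h)"
      "\<And>y. y \<in> A'' \<Longrightarrow> \<exists>a\<in>A'. (y, f a) \<in> E"
      using pushesD [OF E(2) A'(1)] by blast
    have "P A'' ((s o\<^sub>L t) (P A h)) = (s o\<^sub>L t) (P A h)" for h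
      using A''(2) [of "t (P A h)"] by (simp add: A'(2))
    moreover have "\<exists>a\<in>A. (y, (f \<circ> g) a) \<in> E O map_prod f f ` F" if y: "y \<in> A''" for y
    proof -
      obtain x where x: "x \<in> A'" "(y, f x) \<in> E"
        using A''(3) [OF y] by blast
      then obtain a where a: "a \<in> A" "(x, g a) \<in> F"
        using A'(3) by blast
      then have "(f x, f (g a)) \<in> map_prod f f ` F"
        by force
      then show ?thesis
        using x a by auto
    qed
    ultimately show "\<exists>A'\<in>\<AA>. (\<forall>h. P A' ((s o\<^sub>L t) (P A h)) = (s o\<^sub>L t) (P A h)) \<and>
        (\<forall>y\<in>A'. \<exists>a\<in>A. (y, (f \<circ> g) a) \<in> E O map_prod f f ` F)"
      using A''(1) by blast
  qed (use s t tracks_bops in auto)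
qed

lemma tracks_near:
  assumes t: "tracks t f" and fg: "near f g"
  shows "tracks t g"
proof -
  obtain E where E: "E \<in> \<E>" "supported_along t f E"
    using t unfolding tracks_def by blast
  obtain N where N: "N \<in> \<E>" "\<And>x. x \<in> X \<Longrightarrow> (f x, g x) \<in> N"
    using fg nearE by blast
  show ?thesis
    unfolding tracks_def
  proof (intro conjI bexI [of _ "E O N"] supported_alongI)
    fix B A assume AB: "B \<in> \<AA>" "A \<in> \<AA>" "\<forall>b\<in>B. \<forall>a\<in>A. (b, g a) \<notin> E O N"
    have "\<forall>b\<in>B. \<forall>a\<in>A. (b, f a) \<notin> E"
      using AB(3) N(2) measurable_subset [OF AB(2)] by blast
    then show "P B o\<^sub>L t o\<^sub>L P A = 0"
      by (intro supported_alongD [OF E(2)] AB)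
  qed (use t tracks_bops comp_closed E N in auto)
qed

text \<open>Taking adjoints of corners flips the support. A flipped pair says that
  \<open>f b\<close> is close to \<open>a\<close>; applying \<open>g\<close> turns this into
  closeness of \<open>b\<close> to \<open>g a\<close>, because \<open>g\<close> is controlled and
  \<open>g \<circ> f\<close> is close to the identity.\<close>

lemma tracks_adj:
  assumes t: "tracks t f" and fg: "coarse_inverses f g"
  shows "tracks (adj t) g"
proof -
  obtain E where E: "E \<in> \<E>" "supported_along t f E"
    using t unfolding tracks_def by blast
  obtain N where N: "N \<in> \<E>" "\<And>x. x \<in> X \<Longrightarrow> (g (f x), x) \<in> N"
    using fg unfolding coarse_inverses_def by (metis comp_apply id_apply nearE)
  have tb: "t \<in> bops"
    using t by (rule tracks_bops)
  show ?thesis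
    unfolding tracks_def
  proof (intro conjI bexI [of _ "(map_prod g g ` E O N)\<inverse>"] supported_alongI)
    show "(map_prod g g ` E O N)\<inverse> \<in> \<E>"
      using fg E N by (intro converse_closed comp_closed controlledD)
        (auto simp: coarse_inverses_def)
    fix B A assume AB: "B \<in> \<AA>" "A \<in> \<AA>" "\<forall>b\<in>B. \<forall>a\<in>A. (b, g a) \<notin> (map_prod g g ` E O N)\<inverse>"
    have "(a, f b) \<notin> E" if "a \<in> A" "b \<in> B" for a b
    proof
      assume "(a, f b) \<in> E"
      then have "(g a, g (f b)) \<in> map_prod g g ` E"
        by force
      then have "(g a, b) \<in> map_prod g g ` E O N"
        using N(2) [of b] measurable_subset [OF AB(1)] that(2) by (meson relcompI subsetD)
      then show False
        using AB(3) that by (meson converseI)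
    qed
    then have "P A o\<^sub>L t o\<^sub>L P B = 0"
      by (intro supported_alongD [OF E(2)] AB) auto
    then have "adj (P A o\<^sub>L t o\<^sub>L P B) = 0"
      by simp
    then show "P B o\<^sub>L adj t o\<^sub>L P A = 0"
      using AB tb by (simp add: adj_comp blinfun_compose_assoc)
  qed (use tb in simp)
qed

lemma tracks_id: "tracks id_blinfun id"
proof (rule tracksI_push [OF _ diagonal pushesI])
  fix A assume "A \<in> \<AA>"
  then show "\<exists>A'\<in>\<AA>. (\<forall>h. P A' (id_blinfun (P A h)) = id_blinfun (P A h)) \<and>
      (\<forall>y\<in>A'. \<exists>a\<in>A. (y, id a) \<in> Id_on X)"
    using measurable_subset by (intro bexI [of _ A]) auto
qed simp

lemma tracks_add:
  assumes "tracks s f" "tracks t f"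
  shows "tracks (s + t) f"
proof -
  obtain E where E: "E \<in> \<E>" "supported_along s f E"
    using assms(1) unfolding tracks_def by blast
  obtain F where F: "F \<in> \<E>" "supported_along t f F"
    using assms(2) unfolding tracks_def by blast
  show ?thesis
    unfolding tracks_def
  proof (intro conjI bexI [of _ "E \<union> F"] supported_alongI)
    fix B A assume "B \<in> \<AA>" "A \<in> \<AA>" "\<forall>b\<in>B. \<forall>a\<in>A. (b, f a) \<notin> E \<union> F"
    then show "P B o\<^sub>L (s + t) o\<^sub>L P A = 0"
      using supported_alongD [OF E(2), of B A] supported_alongD [OF F(2), of B A]
        by (simp add: blinfun_compose_bilinear_simps)
  qed (use assms tracks_bops E F union_closed in auto)
qed

lemma tracks_scaleC:
  assumes "tracks t f"
  shows "tracks (scaleC_op c t) f"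
proof -
  have "P B o\<^sub>L scaleC_op c t o\<^sub>L P A = scaleC_op c (P B o\<^sub>L t o\<^sub>L P A)" if "B \<in> \<AA>" for A B
    using that by (intro blinfun_eqI) (simp add: bops_scaleC)
  moreover have "scaleC_op c 0 = (0 :: 'h \<Rightarrow>\<^sub>L 'h)"
    by (rule blinfun_eqI) (simp add: scaleC.zero_right)
  ultimately show ?thesis
    using assms unfolding tracks_def supported_along_def by (metis bops_simps(6))
qed

text \<open>A controlled map sends bounded sets to bounded sets, so the image of a bounded corner
  passes through another bounded corner. Local compactness of a product can then be read off its
  left factor.\<close>

lemma tracks_push_bounded:
  assumes t: "tracks t f" and f: "controlled f" and A: "A \<in> \<AA>" "coarsely_bounded \<E> A"
  obtains A' where "A' \<in> \<AA>" "coarsely_bounded \<E> A'" "t o\<^sub>L P A = P A' o\<^sub>L (t o\<^sub>L P A)"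
proof -
  obtain E where E: "E \<in> \<E>" "pushes t f E"
    using tracks_push [OF t] by blast
  obtain A' where A': "A' \<in> \<AA>" "\<And>h. P A' (t (P A h)) = t (P A h)" "\<And>y. y \<in> A' \<Longrightarrow> \<exists>a\<in>A. (y, f a) \<in> E"
    using pushesD [OF E(2) A(1)] by blast
  have "A' \<times> A' \<subseteq> E O map_prod f f ` (A \<times> A) O E\<inverse>"
  proof clarify
    fix x y assume "x \<in> A'" "y \<in> A'"
    then obtain a b where "a \<in> A" "(x, f a) \<in> E" "b \<in> A" "(y, f b) \<in> E"
      using A'(3) by meson
    then show "(x, y) \<in> E O map_prod f f ` (A \<times> A) O E\<inverse>"
      by (intro relcompI [of x "f a"] relcompI [of "f a" "f b"]) auto
  qed
  moreover have "E O map_prod f f ` (A \<times> A) O E\<inverse> \<in> \<E>"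
    using A(2) by (intro comp_closed converse_closed E controlledD f)
      (simp add: coarsely_bounded_def)
  ultimately have "coarsely_bounded \<E> A'"
    unfolding coarsely_bounded_def using subset_closed by blast
  moreover have "t o\<^sub>L P A = P A' o\<^sub>L (t o\<^sub>L P A)"
    by (rule blinfun_eqI) (simp add: A'(2))
  ultimately show thesis
    using that A'(1) by blast
qed

lemma locally_compact_comp_right:
  assumes t: "locally_compact_op \<E> \<AA> P t" and s: "tracks s f" "controlled f"
  shows "locally_compact_op \<E> \<AA> P (t o\<^sub>L s)"
  unfolding locally_compact_op_def
proof (intro ballI impI conjI)
  fix A assume A: "A \<in> \<AA>" "coarsely_bounded \<E> A"
  show "compact_op (P A o\<^sub>L (t o\<^sub>L s))"
    using t A by (simp add: locally_compact_op_def compact_op_comp_right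
      flip: blinfun_compose_assoc)
  obtain A' where "A' \<in> \<AA>" "coarsely_bounded \<E> A'" "s o\<^sub>L P A = P A' o\<^sub>L (s o\<^sub>L P A)"
    using tracks_push_bounded [OF s A] by blast
  then have "t o\<^sub>L s o\<^sub>L P A = (t o\<^sub>L P A') o\<^sub>L (s o\<^sub>L P A)" "compact_op (t o\<^sub>L P A')"
    using t by (simp_all add: locally_compact_op_def blinfun_compose_assoc)
  then show "compact_op (t o\<^sub>L s o\<^sub>L P A)"
    by (simp add: compact_op_comp_right)
qed

lemma locally_compact_adj:
  assumes "t \<in> bops" "locally_compact_op \<E> \<AA> P t"
  shows "locally_compact_op \<E> \<AA> P (adj t)"
  unfolding locally_compact_op_def
proof (intro ballI impI conjI)
  fix A assume A: "A \<in> \<AA>" "coarsely_bounded \<E> A"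
  have "compact_op (adj (t o\<^sub>L P A))" "compact_op (adj (P A o\<^sub>L t))"
    using assms A by (auto simp: locally_compact_op_def intro!: compact_op_adj)
  then show "compact_op (P A o\<^sub>L adj t)" "compact_op (adj t o\<^sub>L P A)"
    using assms A by (simp_all add: adj_comp)
qed

text \<open>Pushing forward handles a tracker on the right; the left case follows by adjoints, since
  \<open>adj s\<close> tracks the coarse inverse \<open>g\<close>.\<close>

lemma locally_compact_comp_left:
  assumes t: "t \<in> bops" "locally_compact_op \<E> \<AA> P t" and s: "tracks s f" "coarse_inverses f g"
  shows "locally_compact_op \<E> \<AA> P (s o\<^sub>L t)"
proof -
  have "locally_compact_op \<E> \<AA> P (adj t o\<^sub>L adj s)"
    using s by (intro locally_compact_comp_right [OF locally_compact_adj [OF t] tracks_adj [OF s]])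
      (simp add: coarse_inverses_def)
  then have "locally_compact_op \<E> \<AA> P (adj (adj t o\<^sub>L adj s))"
    using s t by (intro locally_compact_adj) (auto simp: tracks_bops)
  then show ?thesis
    using s t by (simp add: adj_comp tracks_bops)
qed

lemma tracks_conjugate:
  assumes u: "tracks u f" "coarse_inverses f g" and t: "tracks t id"
  shows "tracks (u o\<^sub>L t o\<^sub>L adj u) id"
proof -
  have "tracks (u o\<^sub>L t o\<^sub>L adj u) (f \<circ> id \<circ> g)"
    using u(2) by (intro tracks_comp [OF _ tracks_adj [OF u]] tracks_comp [OF u(1) t])
      (simp_all add: coarse_inverses_def)
  then show ?thesis
    using u(2) unfolding coarse_inverses_def comp_id by (elim conjE tracks_near)
qed

subsection \<open>The coarse support\<close>

lemma coarse_support_eqI: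
  assumes S: "S \<subseteq> X \<times> X" "supp_in \<AA> P t S"
    and min: "\<And>R. R \<subseteq> X \<times> X \<Longrightarrow> supp_in \<AA> P t R \<Longrightarrow> coarse_le \<E> S R"
  shows "coarse_support X \<E> \<AA> P t = coarse_class X \<E> S"
  unfolding coarse_support_def
proof (rule the_equality)
  show "\<exists>S'\<subseteq>X \<times> X. coarse_class X \<E> S = coarse_class X \<E> S' \<and> supp_in \<AA> P t S' \<and>
      (\<forall>R\<subseteq>X \<times> X. supp_in \<AA> P t R \<longrightarrow> coarse_le \<E> S' R)"
    using assms by blast
  fix F assume "\<exists>S'\<subseteq>X \<times> X. F = coarse_class X \<E> S' \<and> supp_in \<AA> P t S' \<and>
      (\<forall>R\<subseteq>X \<times> X. supp_in \<AA> P t R \<longrightarrow> coarse_le \<E> S' R)"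
  then obtain S' where "S' \<subseteq> X \<times> X" "F = coarse_class X \<E> S'" "coarse_eq \<E> S' S"
    using assms by (auto simp: coarse_eq_def)
  then show "F = coarse_class X \<E> S"
    using S by (simp add: coarse_class_eq_iff)
qed

text \<open>The support is represented by the union of the blocks of pieces on which the corner of
  \<open>t\<close> is nonzero. Any relation supporting \<open>t\<close> must meet each of these
  blocks, so thickening by \<open>D\<close> on both sides recovers them.\<close>

lemma coarse_support_obtain:
  obtains S where "S \<subseteq> X \<times> X" "supp_in \<AA> P t S" "coarse_support X \<E> \<AA> P t = coarse_class X \<E> S"
proof -
  define S where "S = \<Union>{B \<times> A |B A. B \<in> \<Q> \<and> A \<in> \<Q> \<and> P B o\<^sub>L t o\<^sub>L P A \<noteq> 0}"
  have SX: "S \<subseteq> X \<times> X"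
    using piece(1) measurable_subset unfolding S_def by blast
  have supp: "supp_in \<AA> P t S"
    unfolding supp_in_def
  proof (intro ballI impI)
    fix B A assume AB: "B \<in> \<AA>" "A \<in> \<AA>" and sep: "separated S B A"
    show "P B o\<^sub>L t o\<^sub>L P A = 0"
    proof (rule sandwich_eq_zeroI)
      fix Q h assume Q: "Q \<in> \<Q>"
      show "P B (t (P A (P Q h))) = 0"
      proof (rule eq_zeroI)
        fix Q' assume Q': "Q' \<in> \<Q>"
        show "P Q' (P B (t (P A (P Q h)))) = 0"
        proof (cases "P Q' o\<^sub>L t o\<^sub>L P Q = 0")
          case True
          have "P Q' (P B (t (P A (P Q h)))) = P B (P Q' (t (P Q (P A h))))"
            using AB piece(1) [OF Q] piece(1) [OF Q'] by (simp add: P_P Int_commute)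
          also have "P Q' (t (P Q (P A h))) = 0"
            using comp_eqD [of "P Q' o\<^sub>L t" "P Q" 0 "P A h"] True by simp
          finally show ?thesis
            by simp
        next
          case False
          then have "Q' \<times> Q \<subseteq> S"
            using Q Q' unfolding S_def by blast
          then have "A \<inter> Q = {} \<or> Q' \<inter> B = {}"
            using sep unfolding separated_def rapp_def by blast
          then show ?thesis
            using AB piece(1) [OF Q] piece(1) [OF Q'] by (auto simp: P_P proj_empty)
        qed
      qed
    qed
  qed
  have "coarse_le \<E> S R" if R: "R \<subseteq> X \<times> X" "supp_in \<AA> P t R" for R
  proof (rule coarse_leI [OF D_mem D_mem])
    show "S \<subseteq> D O R O D"
    proof clarify
      fix y x assume "(y, x) \<in> S"
      then obtain B A where BA: "B \<in> \<Q>" "A \<in> \<Q>" "y \<in> B" "x \<in> A" "P B o\<^sub>L t o\<^sub>L P A \<noteq> 0"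
        unfolding S_def by blast
      then have "\<not> separated R B A"
        using R(2) piece(1) unfolding supp_in_def by blast
      then obtain b a where "b \<in> B" "a \<in> A" "(b, a) \<in> R"
        unfolding separated_def rapp_def by blast
      then show "(y, x) \<in> D O R O D"
        using piece(2) [OF BA(1)] piece(2) [OF BA(2)] BA by blast
    qed
  qed
  then show thesis
    using that SX supp coarse_support_eqI [OF SX supp] by simp
qed

lemma covers_tracks:
  assumes f: "f \<in> X \<rightarrow> X" "controlled f" and u: "u \<in> bops" "covers X \<E> \<AA> P u (map_class f)"
  shows "tracks u f"
proof -
  obtain S where S: "S \<subseteq> X \<times> X" "supp_in \<AA> P u S" "coarse_class X \<E> S = map_class f"
    using coarse_support_obtain u(2) unfolding covers_def by metis
  then have "coarse_le \<E> S (graph_rel X f)"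
    using f by (simp add: map_class_def coarse_class_eq_iff graph_rel_subset coarse_eq_def)
  then obtain E where "E \<in> \<E>" "\<And>x y. (y, x) \<in> S \<Longrightarrow> (y, f x) \<in> E"
    using coarse_le_graph_rel [OF f(2) S(1)] by metis
  then show ?thesis
    using S(2) u(1) by (intro supp_in_tracks)
qed

subsection \<open>The three algebras\<close>

text \<open>The dense core of the Roe algebra; it lies in all three algebras and supplies the
  rank-one operators used for nondegeneracy and injectivity.\<close>

definition Roe_core :: "('h \<Rightarrow>\<^sub>L 'h) set" where
  "Roe_core = {t. tracks t id \<and> locally_compact_op \<E> \<AA> P t}"

text \<open>The features of the three algebras on which the result depends.\<close>

definition coarse_algebra :: "('h \<Rightarrow>\<^sub>L 'h) set \<Rightarrow> bool" where
  "coarse_algebra R \<longleftrightarrow> star_algebra R \<and> Roe_core \<subseteq> R \<and> {t. tracks t id} \<subseteq> multipliers R \<and>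
     (\<forall>u f g. tracks u f \<and> coarse_inverses f g \<longrightarrow> (\<forall>t\<in>R. u o\<^sub>L t o\<^sub>L adj u \<in> R))"

text \<open>The multiplier and conjugation clauses say that certain continuous maps send
  \<open>R\<close> into \<open>R\<close>, and such inclusions persist on closures.\<close>

lemma coarse_algebra_closure:
  assumes "coarse_algebra R"
  shows "coarse_algebra (closure R)"
proof -
  have cont: "continuous_on UNIV (\<lambda>t. s o\<^sub>L t)" "continuous_on UNIV (\<lambda>t. t o\<^sub>L s)"
    for s :: "'h \<Rightarrow>\<^sub>L 'h"
    by (intro bounded_bilinear.continuous_on [OF bounded_bilinear_blinfun_compose]
      continuous_intros)+
  have cl: "F t \<in> closure R" if "continuous_on UNIV F" "\<And>t. t \<in> R \<Longrightarrow> F t \<in> R" "t \<in> closure R" for F t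
    using closure_image_subset_closed [OF that(1) closed_closure, of R R] that(2,3) closure_subset
      by blast
  show ?thesis
    unfolding coarse_algebra_def
  proof (intro conjI allI impI ballI subsetI)
    show "star_algebra (closure R)"
      using assms by (simp add: coarse_algebra_def star_algebra_closure)
    show "t \<in> closure R" if "t \<in> Roe_core" for t
      using that assms closure_subset unfolding coarse_algebra_def by blast
    show "s \<in> multipliers (closure R)" if "s \<in> {t. tracks t id}" for s
    proof -
      have "s \<in> multipliers R"
        using that assms unfolding coarse_algebra_def by blast
      then show ?thesis
        using multipliersD by (auto simp: multipliers_def intro: cl [OF cont(1)] cl [OF cont(2)])
    qed
    fix u f g t assume "tracks u f \<and> coarse_inverses f g" "t \<in> closure R"
    moreover have "continuous_on UNIV (\<lambda>t. u o\<^sub>L t o\<^sub>L adj u)"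
      using continuous_on_compose2 [OF cont(2) cont(1)] by simp
    ultimately show "u o\<^sub>L t o\<^sub>L adj u \<in> closure R"
      using assms unfolding coarse_algebra_def by (intro cl [of "\<lambda>t. u o\<^sub>L t o\<^sub>L adj u"]) metis+
  qed
qed

lemma tracks_id_comp: "tracks s id \<Longrightarrow> tracks t id \<Longrightarrow> tracks (s o\<^sub>L t) id"
  using tracks_comp [OF _ _ controlled_id, of s t id] by simp

lemma tracks_id_adj: "tracks s id \<Longrightarrow> tracks (adj s) id"
  using tracks_adj coarse_inverses_id by blast

lemma star_algebra_tracks_id: "star_algebra {t. tracks t id}"
  by (auto simp: star_algebra_def tracks_bops tracks_add tracks_scaleC tracks_id_comp tracks_id_adj)

lemma coarse_algebra_tracks_id: "coarse_algebra {t. tracks t id}"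
  unfolding coarse_algebra_def using star_algebra_tracks_id
  by (auto simp: Roe_core_def multipliers_def tracks_bops tracks_id_comp tracks_conjugate)

lemma locally_compact_add:
  "locally_compact_op \<E> \<AA> P s \<Longrightarrow> locally_compact_op \<E> \<AA> P t \<Longrightarrow> locally_compact_op \<E> \<AA> P (s + t)"
  by (simp add: locally_compact_op_def blinfun_compose_bilinear_simps compact_op_add)

lemma locally_compact_scaleC:
  assumes "locally_compact_op \<E> \<AA> P t"
  shows "locally_compact_op \<E> \<AA> P (scaleC_op c t)"
proof -
  have "P A o\<^sub>L scaleC_op c t = scaleC_op c (P A o\<^sub>L t)"
    "scaleC_op c t o\<^sub>L P A = scaleC_op c (t o\<^sub>L P A)"
    if "A \<in> \<AA>" for A
    using that by (auto intro!: blinfun_eqI simp: bops_scaleC)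
  then show ?thesis
    using assms by (simp add: locally_compact_op_def compact_op_scaleC)
qed

lemma coarse_algebra_Roe_core: "coarse_algebra Roe_core"
  unfolding coarse_algebra_def
proof (intro conjI allI impI ballI subset_refl)
  have left: "s o\<^sub>L t \<in> Roe_core" and right: "t o\<^sub>L s \<in> Roe_core"
    if "tracks s id" "t \<in> Roe_core" for s t
    using that by (auto simp: Roe_core_def tracks_id_comp tracks_bops controlled_id
        intro: locally_compact_comp_left [OF _ _ _ coarse_inverses_id] locally_compact_comp_right)
  then show "{t. tracks t id} \<subseteq> multipliers Roe_core"
    by (auto simp: multipliers_def tracks_bops)
  show "star_algebra Roe_core"
    using left by (auto simp: star_algebra_def Roe_core_def tracks_bops tracks_add tracks_scaleC
        tracks_id_adj locally_compact_add locally_compact_scaleC locally_compact_adj)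
  fix u f g t assume u: "tracks u f \<and> coarse_inverses f g" and t: "t \<in> Roe_core"
  have "locally_compact_op \<E> \<AA> P (t o\<^sub>L adj u)"
    using u t by (intro locally_compact_comp_right [OF _ tracks_adj [of u f g]])
      (auto simp: Roe_core_def coarse_inverses_def)
  then have "locally_compact_op \<E> \<AA> P (u o\<^sub>L (t o\<^sub>L adj u))"
    using u t by (intro locally_compact_comp_left [of _ u f g]) (auto simp: Roe_core_def
      tracks_bops)
  then show "u o\<^sub>L t o\<^sub>L adj u \<in> Roe_core"
    using u t tracks_conjugate [of u f g t] by (auto simp: Roe_core_def blinfun_compose_assoc)
qed

section \<open>Quasi-local operators\<close>

definition off_norm_le :: "('h \<Rightarrow>\<^sub>L 'h) \<Rightarrow> real \<Rightarrow> 'x rel \<Rightarrow> bool" where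
  "off_norm_le t \<epsilon> E \<longleftrightarrow>
     (\<forall>B\<in>\<AA>. \<forall>A\<in>\<AA>. (\<forall>b\<in>B. \<forall>a\<in>A. (b, a) \<notin> E) \<longrightarrow> norm (P B o\<^sub>L t o\<^sub>L P A) \<le> \<epsilon>)"

lemma off_norm_leI:
  "(\<And>B A. B \<in> \<AA> \<Longrightarrow> A \<in> \<AA> \<Longrightarrow> \<forall>b\<in>B. \<forall>a\<in>A. (b, a) \<notin> E \<Longrightarrow> norm (P B o\<^sub>L t o\<^sub>L P A) \<le> \<epsilon>) \<Longrightarrow>
    off_norm_le t \<epsilon> E"
  by (simp add: off_norm_le_def)

lemma off_norm_leD:
  "off_norm_le t \<epsilon> E \<Longrightarrow> B \<in> \<AA> \<Longrightarrow> A \<in> \<AA> \<Longrightarrow> (\<And>b a. b \<in> B \<Longrightarrow> a \<in> A \<Longrightarrow> (b, a) \<notin> E) \<Longrightarrow>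
    norm (P B o\<^sub>L t o\<^sub>L P A) \<le> \<epsilon>"
  by (simp add: off_norm_le_def)

lemma Cql_iff: "t \<in> Cql \<E> \<AA> P \<longleftrightarrow> t \<in> bops \<and> (\<forall>\<epsilon>>0. \<exists>E\<in>\<E>. off_norm_le t \<epsilon> E)"
proof -
  have "separated E B A \<longleftrightarrow> (\<forall>b\<in>B. \<forall>a\<in>A. (b, a) \<notin> E)" for E :: "'x rel" and A B
    by (auto simp: separated_def rapp_def)
  then show ?thesis
    by (simp add: Cql_def quasi_local_def off_norm_le_def)
qed

lemma CqlE:
  assumes "t \<in> Cql \<E> \<AA> P" "\<epsilon> > 0"
  obtains E where "E \<in> \<E>" "off_norm_le t \<epsilon> E"
  using assms unfolding Cql_iff by blast

lemma tracks_id_Cql: "tracks t id \<Longrightarrow> t \<in> Cql \<E> \<AA> P"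
  unfolding Cql_iff tracks_def supported_along_def off_norm_le_def
  by (metis id_apply less_imp_le norm_zero)

lemma norm_blinfun_compose3: "norm (r o\<^sub>L s o\<^sub>L t) \<le> norm r * norm s * norm t"
  by (meson mult_right_mono norm_blinfun_compose norm_ge_zero order_trans)

lemma norm_sandwich:
  assumes "B \<in> \<AA>" "A \<in> \<AA>"
  shows "norm (P B o\<^sub>L t o\<^sub>L P A) \<le> norm t"
proof -
  have "norm (P B o\<^sub>L t o\<^sub>L P A) \<le> norm (P B) * norm t * norm (P A)"
    by (rule norm_blinfun_compose3)
  also have "\<dots> \<le> 1 * norm t * 1"
    using assms by (intro mult_mono P_norm) auto
  finally show ?thesis
    by simp
qed

lemma Cql_add:
  assumes "s \<in> Cql \<E> \<AA> P" "t \<in> Cql \<E> \<AA> P"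
  shows "s + t \<in> Cql \<E> \<AA> P"
  unfolding Cql_iff
proof (intro conjI allI impI)
  show "s + t \<in> bops"
    using assms by (simp add: Cql_iff)
  fix \<epsilon> :: real assume "\<epsilon> > 0"
  then have \<epsilon>: "\<epsilon> / 2 > 0" by simp
  obtain E where E: "E \<in> \<E>" "off_norm_le s (\<epsilon> / 2) E"
    using CqlE [OF assms(1) \<epsilon>] by blast
  obtain F where F: "F \<in> \<E>" "off_norm_le t (\<epsilon> / 2) F"
    using CqlE [OF assms(2) \<epsilon>] by blast
  show "\<exists>E\<in>\<E>. off_norm_le (s + t) \<epsilon> E"
  proof (intro bexI [OF _ union_closed [OF E(1) F(1)]] off_norm_leI)
    fix B A assume AB: "B \<in> \<AA>" "A \<in> \<AA>" "\<forall>b\<in>B. \<forall>a\<in>A. (b, a) \<notin> E \<union> F"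
    have "P B o\<^sub>L (s + t) o\<^sub>L P A = (P B o\<^sub>L s o\<^sub>L P A) + (P B o\<^sub>L t o\<^sub>L P A)"
      by (simp add: blinfun_compose_bilinear_simps)
    moreover have "norm (P B o\<^sub>L s o\<^sub>L P A) \<le> \<epsilon> / 2" "norm (P B o\<^sub>L t o\<^sub>L P A) \<le> \<epsilon> / 2"
      using AB by (intro off_norm_leD [OF E(2)] off_norm_leD [OF F(2)]; blast)+
    ultimately show "norm (P B o\<^sub>L (s + t) o\<^sub>L P A) \<le> \<epsilon>"
      using norm_triangle_ineq [of "P B o\<^sub>L s o\<^sub>L P A" "P B o\<^sub>L t o\<^sub>L P A"] by simp
  qed
qed

lemma Cql_adj:
  assumes "t \<in> Cql \<E> \<AA> P"
  shows "adj t \<in> Cql \<E> \<AA> P"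
  unfolding Cql_iff
proof (intro conjI allI impI)
  have t: "t \<in> bops"
    using assms by (simp add: Cql_iff)
  then show "adj t \<in> bops" by simp
  fix \<epsilon> :: real assume "\<epsilon> > 0"
  then obtain E where E: "E \<in> \<E>" "off_norm_le t \<epsilon> E"
    using CqlE [OF assms] by blast
  show "\<exists>E\<in>\<E>. off_norm_le (adj t) \<epsilon> E"
  proof (intro bexI [OF _ converse_closed [OF E(1)]] off_norm_leI)
    fix B A assume AB: "B \<in> \<AA>" "A \<in> \<AA>" "\<forall>b\<in>B. \<forall>a\<in>A. (b, a) \<notin> E\<inverse>"
    then have "norm (P A o\<^sub>L t o\<^sub>L P B) \<le> \<epsilon>"
      by (intro off_norm_leD [OF E(2)]) auto
    moreover have "P B o\<^sub>L adj t o\<^sub>L P A = adj (P A o\<^sub>L t o\<^sub>L P B)"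
      using AB t by (simp add: adj_comp blinfun_compose_assoc)
    ultimately show "norm (P B o\<^sub>L adj t o\<^sub>L P A) \<le> \<epsilon>"
      using AB t by (simp add: norm_adj)
  qed
qed

text \<open>The product is split in the middle by \<open>C\<close>, the union of the pieces that
  meet the \<open>F\<close>-neighbourhood of \<open>A\<close>. Then \<open>B\<close> is
  \<open>E\<close>-separated from \<open>C\<close> and \<open>X - C\<close> is
  \<open>F\<close>-separated from \<open>A\<close>, so each summand has one small corner. Rounding
  the neighbourhood up to pieces makes it measurable and accounts for the factor
  \<open>D\<close>.\<close>

lemma Cql_comp:
  assumes "s \<in> Cql \<E> \<AA> P" "t \<in> Cql \<E> \<AA> P"
  shows "s o\<^sub>L t \<in> Cql \<E> \<AA> P"
  unfolding Cql_iff
proof (intro conjI allI impI)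
  show "s o\<^sub>L t \<in> bops"
    using assms by (simp add: Cql_iff)
  fix \<epsilon> :: real assume \<epsilon>: "\<epsilon> > 0"
  \<comment> \<open>The summand 1 makes \<open>M\<close> positive even if both operators vanish, so
    that \<open>\<epsilon> / M\<close> is a legitimate tolerance.\<close>
  define M where "M = norm s + norm t + 1"
  have M: "M > 0" "norm s + norm t \<le> M"
    by (auto simp: M_def add_nonneg_pos)
  then have \<epsilon>M: "\<epsilon> / M > 0"
    using \<epsilon> by simp
  obtain E where E: "E \<in> \<E>" "off_norm_le s (\<epsilon> / M) E"
    using CqlE [OF assms(1) \<epsilon>M] by blast
  obtain F where F: "F \<in> \<E>" "off_norm_le t (\<epsilon> / M) F"
    using CqlE [OF assms(2) \<epsilon>M] by blast
  show "\<exists>E\<in>\<E>. off_norm_le (s o\<^sub>L t) \<epsilon> E"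
  proof (intro bexI [of _ "E O D O F"] off_norm_leI)
    show "E O D O F \<in> \<E>"
      by (intro comp_closed E F D_mem)
    fix B A assume AB: "B \<in> \<AA>" "A \<in> \<AA>" "\<forall>b\<in>B. \<forall>a\<in>A. (b, a) \<notin> E O D O F"
    define \<S> where "\<S> = {Q \<in> \<Q>. \<exists>x\<in>Q. \<exists>a\<in>A. (x, a) \<in> F}"
    define C where "C = \<Union>\<S>"
    have C: "C \<in> \<AA>"
      unfolding C_def by (intro Union_pieces_measurable) (auto simp: \<S>_def)
    then have XC: "X - C \<in> \<AA>"
      by auto
    have s: "norm (P B o\<^sub>L s o\<^sub>L P C) \<le> \<epsilon> / M"
    proof (rule off_norm_leD [OF E(2) AB(1) C])
      fix b c assume b: "b \<in> B" and "c \<in> C"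
      then obtain Q x a where "Q \<in> \<Q>" "c \<in> Q" "x \<in> Q" "a \<in> A" "(x, a) \<in> F"
        unfolding C_def \<S>_def by blast
      moreover from this have "(c, x) \<in> D"
        using piece(2) by blast
      ultimately show "(b, c) \<notin> E"
        using AB(3) b by blast
    qed
    have t: "norm (P (X - C) o\<^sub>L t o\<^sub>L P A) \<le> \<epsilon> / M"
    proof (rule off_norm_leD [OF F(2) XC AB(2)])
      fix b a assume b: "b \<in> X - C" and a: "a \<in> A"
      obtain Q where "Q \<in> \<Q>" "b \<in> Q"
        using b ex_piece by blast
      then show "(b, a) \<notin> F"
        using b a unfolding C_def \<S>_def by blast
    qed
    have "C \<inter> (X - C) = {}" "C \<union> (X - C) = X"
      using measurable_subset [OF C] by auto
    then have "id_blinfun = P C + P (X - C)"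
      using proj_Un [OF C XC] proj_Int [OF C XC] by (simp add: proj_carrier proj_empty)
    then have "P B o\<^sub>L (s o\<^sub>L t) o\<^sub>L P A = P B o\<^sub>L s o\<^sub>L (P C + P (X - C)) o\<^sub>L t o\<^sub>L P A"
      by (metis blinfun_compose_assoc blinfun_compose_id(2))
    also have "\<dots> = ((P B o\<^sub>L s o\<^sub>L P C) o\<^sub>L (t o\<^sub>L P A)) +
        ((P B o\<^sub>L s) o\<^sub>L (P (X - C) o\<^sub>L t o\<^sub>L P A))"
      by (simp add: blinfun_compose_bilinear_simps blinfun_compose_assoc)
    finally have "norm (P B o\<^sub>L (s o\<^sub>L t) o\<^sub>L P A) \<le>
        norm (P B o\<^sub>L s o\<^sub>L P C) * norm (t o\<^sub>L P A) +
        norm (P B o\<^sub>L s) * norm (P (X - C) o\<^sub>L t o\<^sub>L P A)"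
      by (metis norm_blinfun_compose norm_triangle_mono)
    also have "\<dots> \<le> \<epsilon> / M * norm t + norm s * (\<epsilon> / M)"
    proof (intro add_mono mult_mono s t)
      show "norm (t o\<^sub>L P A) \<le> norm t"
        using norm_sandwich [OF top AB(2), of t] by (simp add: proj_carrier)
      show "norm (P B o\<^sub>L s) \<le> norm s"
        using norm_sandwich [OF AB(1) top, of s] by (simp add: proj_carrier)
    qed (use \<epsilon>M in auto)
    also have "\<dots> = \<epsilon> / M * (norm s + norm t)"
      by (simp add: algebra_simps)
    also have "\<dots> \<le> \<epsilon> / M * M"
      using M \<epsilon>M by (intro mult_left_mono) auto
    finally show "norm (P B o\<^sub>L (s o\<^sub>L t) o\<^sub>L P A) \<le> \<epsilon>"
      using M by simp
  qed
qed

text \<open>\<open>adj u\<close> pushes the ranges of \<open>P A\<close> and \<open>P B\<close> into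
  those of \<open>P A'\<close> and \<open>P B'\<close>, so a corner of the conjugate factors through
  the corner of \<open>t\<close> at \<open>B'\<close> and \<open>A'\<close>. If these sets were not
  \<open>E\<close>-separated, applying \<open>f\<close> would bring points of \<open>B\<close> and
  \<open>A\<close> close together, as recorded by \<open>?E\<close>.\<close>

lemma Cql_conjugate:
  assumes t: "t \<in> Cql \<E> \<AA> P" and u: "tracks u f" and fg: "coarse_inverses f g"
  shows "u o\<^sub>L t o\<^sub>L adj u \<in> Cql \<E> \<AA> P"
  unfolding Cql_iff
proof (intro conjI allI impI)
  have ub: "u \<in> bops"
    using u by (rule tracks_bops)
  then show "u o\<^sub>L t o\<^sub>L adj u \<in> bops"
    using t by (simp add: Cql_iff)
  fix \<epsilon> :: real assume \<epsilon>: "\<epsilon> > 0"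
  define M where "M = norm u * norm u + 1"
  have M: "M > 0" "norm u * norm u \<le> M"
    by (auto simp: M_def add_nonneg_pos)
  then have \<epsilon>M: "\<epsilon> / M > 0"
    using \<epsilon> by simp
  obtain E where E: "E \<in> \<E>" "off_norm_le t (\<epsilon> / M) E"
    using CqlE [OF t \<epsilon>M] by blast
  obtain F where F: "F \<in> \<E>" "pushes (adj u) g F"
    using tracks_push [OF tracks_adj [OF u fg]] by blast
  obtain N where N: "N \<in> \<E>" "\<And>x. x \<in> X \<Longrightarrow> (f (g x), x) \<in> N"
    using fg unfolding coarse_inverses_def by (metis comp_apply id_apply nearE)
  let ?E = "N\<inverse> O map_prod f f ` (F\<inverse> O E O F) O N"
  show "\<exists>E\<in>\<E>. off_norm_le (u o\<^sub>L t o\<^sub>L adj u) \<epsilon> E"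
  proof (intro bexI [of _ ?E] off_norm_leI)
    show "?E \<in> \<E>"
      using fg by (intro comp_closed converse_closed controlledD E F N)
        (simp add: coarse_inverses_def)
    fix B A assume AB: "B \<in> \<AA>" "A \<in> \<AA>" "\<forall>b\<in>B. \<forall>a\<in>A. (b, a) \<notin> ?E"
    obtain A' where A': "A' \<in> \<AA>" "\<And>h. P A' (adj u (P A h)) = adj u (P A h)"
      "\<And>y. y \<in> A' \<Longrightarrow> \<exists>a\<in>A. (y, g a) \<in> F"
      using pushesD [OF F(2) AB(2)] by blast
    obtain B' where B': "B' \<in> \<AA>" "\<And>h. P B' (adj u (P B h)) = adj u (P B h)"
      "\<And>y. y \<in> B' \<Longrightarrow> \<exists>a\<in>B. (y, g a) \<in> F"
      using pushesD [OF F(2) AB(1)] by blast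
    have "norm (P B' o\<^sub>L t o\<^sub>L P A') \<le> \<epsilon> / M"
    proof (rule off_norm_leD [OF E(2) B'(1) A'(1)])
      fix b' a' assume "b' \<in> B'" "a' \<in> A'"
      then obtain b a where ba: "b \<in> B" "(b', g b) \<in> F" "a \<in> A" "(a', g a) \<in> F"
        using A'(3) B'(3) by meson
      show "(b', a') \<notin> E"
      proof
        assume "(b', a') \<in> E"
        then have "(g b, g a) \<in> F\<inverse> O E O F"
          using ba by blast
        then have "(f (g b), f (g a)) \<in> map_prod f f ` (F\<inverse> O E O F)"
          by force
        moreover have "(b, f (g b)) \<in> N\<inverse>" "(f (g a), a) \<in> N"
          using N(2) ba measurable_subset AB by blast+
        ultimately have "(b, a) \<in> ?E"
          by (intro relcompI)
        then show False
          using AB(3) ba by blast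
      qed
    qed
    moreover have "P B o\<^sub>L (u o\<^sub>L t o\<^sub>L adj u) o\<^sub>L P A =
        (P B o\<^sub>L u) o\<^sub>L (P B' o\<^sub>L t o\<^sub>L P A') o\<^sub>L (adj u o\<^sub>L P A)"
    proof -
      have "P B' o\<^sub>L (adj u o\<^sub>L P B) = adj u o\<^sub>L P B"
        by (rule blinfun_eqI) (simp add: B'(2))
      then have "adj (P B' o\<^sub>L (adj u o\<^sub>L P B)) = adj (adj u o\<^sub>L P B)"
        by simp
      then have "P B o\<^sub>L u o\<^sub>L P B' = P B o\<^sub>L u"
        using AB B' ub by (simp add: adj_comp)
      moreover have "P A' o\<^sub>L (adj u o\<^sub>L P A) = adj u o\<^sub>L P A"
        by (rule blinfun_eqI) (simp add: A'(2))
      ultimately show ?thesis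
        by (metis blinfun_compose_assoc)
    qed
    ultimately have "norm (P B o\<^sub>L (u o\<^sub>L t o\<^sub>L adj u) o\<^sub>L P A) \<le>
        norm (P B o\<^sub>L u) * norm (P B' o\<^sub>L t o\<^sub>L P A') * norm (adj u o\<^sub>L P A)"
      by (simp add: norm_blinfun_compose3)
    also have "\<dots> \<le> norm (P B o\<^sub>L u) * (\<epsilon> / M) * norm (adj u o\<^sub>L P A)"
      using \<open>norm (P B' o\<^sub>L t o\<^sub>L P A') \<le> \<epsilon> / M\<close> by (intro mult_right_mono mult_left_mono) auto
    also have "\<dots> \<le> norm u * (\<epsilon> / M) * norm u"
    proof (intro mult_mono)
      show "norm (adj u o\<^sub>L P A) \<le> norm u"
        using norm_sandwich [OF top AB(2), of "adj u"] ub by (simp add: proj_carrier norm_adj)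
      show "norm (P B o\<^sub>L u) \<le> norm u"
        using norm_sandwich [OF AB(1) top, of u] by (simp add: proj_carrier)
    qed (use \<epsilon> M in auto)
    also have "\<dots> = \<epsilon> / M * (norm u * norm u)"
      by (simp add: algebra_simps)
    also have "\<dots> \<le> \<epsilon> / M * M"
      using M \<epsilon>M by (intro mult_left_mono) auto
    finally show "norm (P B o\<^sub>L (u o\<^sub>L t o\<^sub>L adj u) o\<^sub>L P A) \<le> \<epsilon>"
      using M by simp
  qed
qed

lemma coarse_algebra_Cql: "coarse_algebra (Cql \<E> \<AA> P)"
  unfolding coarse_algebra_def
proof (intro conjI allI impI ballI)
  have "scaleC_op c t \<in> Cql \<E> \<AA> P" if "t \<in> Cql \<E> \<AA> P" for c t
  proof -
    have "scaleC_op c t = scaleC_op c id_blinfun o\<^sub>L t"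
      by (rule blinfun_eqI) simp
    then show ?thesis
      using that Cql_comp tracks_id_Cql tracks_scaleC tracks_id by metis
  qed
  moreover have "Cql \<E> \<AA> P \<subseteq> bops"
    by (auto simp: Cql_iff)
  ultimately show "star_algebra (Cql \<E> \<AA> P)"
    by (simp add: star_algebra_def Cql_add Cql_comp Cql_adj)
  show "Roe_core \<subseteq> Cql \<E> \<AA> P"
    by (auto simp: Roe_core_def tracks_id_Cql)
  show "{t. tracks t id} \<subseteq> multipliers (Cql \<E> \<AA> P)"
    by (auto simp: multipliers_def tracks_bops Cql_comp tracks_id_Cql)
qed (use Cql_conjugate in blast)

lemma coarse_algebra_cases:
  assumes "R \<in> {CRoe \<E> \<AA> P, Ccp \<E> \<AA> P, Cql \<E> \<AA> P}"
  shows "coarse_algebra R"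
proof -
  have "CRoe \<E> \<AA> P = closure Roe_core" "Ccp \<E> \<AA> P = closure {t. tracks t id}"
    unfolding CRoe_def Ccp_def Roe_core_def tracks_id_iff by (metis (no_types, lifting) conj_commute
      conj_left_commute)+
  then show ?thesis
    using assms coarse_algebra_Cql coarse_algebra_closure coarse_algebra_Roe_core
      coarse_algebra_tracks_id
    by auto
qed

end

section \<open>Unitaries covering coarse equivalences\<close>

text \<open>The basis hidden in \<open>proj_rank\<close> gets a name, so that inequalities of ranks
  can be turned into bijections of actual vectors.\<close>

definition proj_basis :: "('h::chilbert_space \<Rightarrow>\<^sub>L 'h) \<Rightarrow> 'h set" where
  "proj_basis p = (SOME B. orthonormal_basis_of (range (blinfun_apply p)) B)"

lemma proj_rank_eq: "proj_rank p = |proj_basis p|"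
  by (simp add: proj_rank_def proj_basis_def)

lemma proj_basis:
  assumes "projection p"
  shows "orthonormal_basis_of (range (blinfun_apply p)) (proj_basis p)"
proof -
  obtain B where "orthonormal_basis_of (range (blinfun_apply p)) B"
    using ex_orthonormal_basis_of [OF projection_range_csubspace projection_range_closed] assms
      by metis
  then show ?thesis
    unfolding proj_basis_def by (rule someI)
qed

lemma proj_basis_fixed: "projection p \<Longrightarrow> e \<in> proj_basis p \<Longrightarrow> p e = e"
  using proj_basis [THEN orthonormal_basis_of_subset] projection_range by blast

locale uniform_rank_module = discrete_coarse_module X \<E> \<AA> P D \<Q>
  for X :: "'x set" and \<E> :: "'x rel set" and \<AA> :: "'x set set"
    and P :: "'x set \<Rightarrow> ('h::chilbert_space \<Rightarrow>\<^sub>L 'h)" and D :: "'x rel" and \<Q> :: "'x set set" +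
  fixes \<kappa> :: "'k rel"
  assumes ample: "ample_module \<kappa> X \<E> \<AA> P"
    and local_rank: "local_rank_at_most \<kappa> \<E> \<AA> P"
begin

text \<open>The nonzero vectors in the range are used later to detect supports and as test vectors
  for injectivity.\<close>

definition full :: "'x set \<Rightarrow> bool" where
  "full A \<longleftrightarrow> A \<in> \<AA> \<and> P A \<noteq> 0 \<and> \<kappa> \<le>o proj_rank (P A)"

lemma full_mono:
  assumes A: "full A" and B: "B \<in> \<AA>" "A \<subseteq> B"
  shows "full B"
proof -
  have AA: "A \<in> \<AA>"
    using A by (simp add: full_def)
  have "range (blinfun_apply (P A)) \<subseteq> range (blinfun_apply (P B))"
  proof clarify
    fix h
    show "P A h \<in> range (blinfun_apply (P B))"
      using P_P_subset(2) [OF AA B] by (metis rangeI)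
  qed
  then have "proj_rank (P A) \<le>o proj_rank (P B)"
    unfolding proj_rank_eq using orthonormal_basis_card_mono proj_basis proj AA B by metis
  moreover have "P B \<noteq> 0"
  proof
    assume "P B = 0"
    then have "P A h = 0" for h
      using P_P_subset(1) [OF AA B, of h] by simp
    then have "P A = 0"
      by (intro blinfun_eqI) simp
    then show False
      using A by (simp add: full_def)
  qed
  ultimately show ?thesis
    using A B ordLeq_transitive unfolding full_def by blast
qed

text \<open>The sets provided by ampleness may cut across pieces. Some piece meets such a set in a
  nonzero part; this part is again small enough for the ampleness bound, and
  \<open>full_mono\<close> then passes the lower bound on the rank to the whole piece.\<close>

lemma full_piece_in_set:
  assumes A: "A \<in> \<AA>" "P A \<noteq> 0"
  obtains Q where "Q \<in> \<Q>" "P (A \<inter> Q) \<noteq> 0"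
proof -
  have "\<exists>h. P A h \<noteq> 0"
    using A(2) by (metis blinfun_eqI zero_blinfun.rep_eq)
  then obtain h where "P A h \<noteq> 0"
    by blast
  then obtain Q where "Q \<in> \<Q>" "P A (P Q h) \<noteq> 0"
    using vanish_on_pieces [OF blinfun.bounded_linear_right, where h = h] by metis
  then show thesis
    using that A piece by (metis P_P zero_blinfun.rep_eq)
qed

text \<open>
  A coarse retraction onto base points of full pieces.  It plays the part of a discretisation of \<open>X\<close>
  by pieces of maximal rank.
\<close>

definition base_map :: "('x \<Rightarrow> 'x) \<Rightarrow> bool" where
  "base_map c \<longleftrightarrow> c \<in> X \<rightarrow> X \<and> near c id \<and> (\<forall>x\<in>X. c (c x) = c x) \<and>
     (\<forall>Q\<in>\<Q>. \<forall>x\<in>Q. \<forall>y\<in>Q. c x = c y) \<and>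
     (\<forall>x\<in>X. \<exists>G\<in>\<Q>. full G \<and> (\<forall>z\<in>G. c z = c x))"

lemma ex_base_map: obtains c where "base_map c"
proof -
  obtain E where E: "gauge_of X \<E> E" "coarsely_dense X \<E> (\<Union>{A \<in> \<AA>. A \<times> A \<subseteq> E \<and> P A \<noteq> 0})"
    "\<And>A. A \<in> \<AA> \<Longrightarrow> A \<times> A \<subseteq> E \<Longrightarrow> P A \<noteq> 0 \<Longrightarrow> \<kappa> \<le>o proj_rank (P A)"
    using ample unfolding ample_module_def by blast
  obtain F where F: "F \<in> \<E>" "X = rapp F (\<Union>{A \<in> \<AA>. A \<times> A \<subseteq> E \<and> P A \<noteq> 0})"
    using E(2) unfolding coarsely_dense_def by blast
  \<comment> \<open>The term \<open>D\<close> serves full pieces. Otherwise one walks inside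
    \<open>Q\<close> by \<open>D\<close>, to an ample set by \<open>F\<close>, inside that set by
    \<open>E\<close>, and inside a full piece by \<open>D\<close>.\<close>
  define E' where "E' = D \<union> (D O (F O E) O D)"
  have E': "E' \<in> \<E>"
    unfolding E'_def using E(1) by (intro union_closed comp_closed D_mem F) (simp add: gauge_of_def)
  \<comment> \<open>Full pieces are assigned to themselves; this makes \<open>c\<close> idempotent
    and constant with value \<open>c x\<close> on the full piece chosen for
    \<open>x\<close>.\<close>
  have "\<exists>G. G \<in> \<Q> \<and> full G \<and> (full Q \<longrightarrow> G = Q) \<and> G \<times> Q \<subseteq> E'\<inverse>" if Q: "Q \<in> \<Q>" for Q
  proof (cases "full Q")
    case True
    then show ?thesis
      using Q piece(2) [OF Q] by (intro exI [of _ Q]) (auto simp: E'_def)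
  next
    case False
    obtain x where x: "x \<in> Q"
      using piece_nonempty [OF Q] by blast
    then have "x \<in> X"
      using piece(1) [OF Q] measurable_subset by blast
    then obtain A a where A: "A \<in> \<AA>" "A \<times> A \<subseteq> E" "P A \<noteq> 0" "a \<in> A" "(x, a) \<in> F"
      using F(2) unfolding rapp_def by blast
    obtain G where G: "G \<in> \<Q>" "P (A \<inter> G) \<noteq> 0"
      using full_piece_in_set A by metis
    have AG: "A \<inter> G \<in> \<AA>"
      using A(1) piece(1) [OF G(1)] by (rule Int)
    moreover have "(A \<inter> G) \<times> (A \<inter> G) \<subseteq> E"
      using A(2) by blast
    ultimately have "full (A \<inter> G)"
      using E(3) [OF AG _ G(2)] G(2) by (auto simp: full_def)
    then have "full G"
      using full_mono piece(1) [OF G(1)] by blast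
    have "A \<inter> G \<noteq> {}"
      using G(2) proj_empty by metis
    then obtain b where "b \<in> A" "b \<in> G"
      by blast
    then have "(x, b) \<in> F O E"
      using A by blast
    have "Q \<times> G \<subseteq> D O (F O E) O D"
    proof clarify
      fix q g assume "q \<in> Q" "g \<in> G"
      then have "(q, x) \<in> D" "(b, g) \<in> D"
        using piece(2) [OF Q] piece(2) [OF G(1)] x \<open>b \<in> G\<close> by auto
      then show "(q, g) \<in> D O (F O E) O D"
        using \<open>(x, b) \<in> F O E\<close> by blast
    qed
    then have "G \<times> Q \<subseteq> E'\<inverse>"
      by (auto simp: E'_def)
    then show ?thesis
      using False G(1) \<open>full G\<close> by blast
  qed
  then obtain \<gamma> where \<gamma>: "\<And>Q. Q \<in> \<Q> \<Longrightarrow> \<gamma> Q \<in> \<Q>" "\<And>Q. Q \<in> \<Q> \<Longrightarrow> full (\<gamma> Q)"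
    "\<And>Q. Q \<in> \<Q> \<Longrightarrow> full Q \<Longrightarrow> \<gamma> Q = Q" "\<And>Q. Q \<in> \<Q> \<Longrightarrow> \<gamma> Q \<times> Q \<subseteq> E'\<inverse>"
    by metis
  obtain pt where pt: "\<And>Q. Q \<in> \<Q> \<Longrightarrow> pt Q \<in> Q"
    using piece_nonempty by metis
  obtain pc where pc: "\<And>x. x \<in> X \<Longrightarrow> pc x \<in> \<Q>" "\<And>x. x \<in> X \<Longrightarrow> x \<in> pc x"
  proof -
    have "\<forall>x. \<exists>Q. x \<in> X \<longrightarrow> Q \<in> \<Q> \<and> x \<in> Q"
      using ex_piece by blast
    then show thesis
      using that by metis
  qed
  have pcI: "pc x = Q" if "Q \<in> \<Q>" "x \<in> Q" for x Q
  proof -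
    have "x \<in> X"
      using that piece(1) measurable_subset by blast
    then show ?thesis
      using that pc piece_unique by metis
  qed
  define c where "c x = pt (\<gamma> (pc x))" for x
  have cX: "c \<in> X \<rightarrow> X"
    unfolding c_def using pt \<gamma>(1) pc piece(1) measurable_subset by blast
  have "near c id"
  proof (rule nearI [OF converse_closed [OF E']])
    fix x assume x: "x \<in> X"
    then have "(c x, x) \<in> \<gamma> (pc x) \<times> pc x"
      using pt [OF \<gamma>(1) [OF pc(1) [OF x]]] pc by (simp add: c_def)
    then show "(c x, id x) \<in> E'\<inverse>"
      using \<gamma>(4) [OF pc(1) [OF x]] by auto
  qed
  moreover have const: "c z = c x" if "x \<in> X" "z \<in> \<gamma> (pc x)" for x z
  proof -
    have "pc z = \<gamma> (pc x)"
      using that \<gamma>(1) pc(1) by (intro pcI) auto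
    then show ?thesis
      using that \<gamma> pc(1) by (simp add: c_def)
  qed
  moreover have "c (c x) = c x" if "x \<in> X" for x
    using that pt \<gamma>(1) pc(1) by (intro const) (auto simp: c_def)
  moreover have "c x = c y" if "Q \<in> \<Q>" "x \<in> Q" "y \<in> Q" for Q x y
    using that by (simp add: c_def pcI)
  ultimately have "base_map c"
    unfolding base_map_def using cX \<gamma>(1,2) pc(1) by metis
  then show thesis
    by (rule that)
qed

definition fib :: "('x \<Rightarrow> 'x) \<Rightarrow> 'x \<Rightarrow> 'x set" where
  "fib a j = {x \<in> X. a x = j}"

text \<open>The conditions are tailored to the fibres: constancy on pieces makes them measurable,
  the controlled kernel makes them bounded and so of rank at most \<kappa>, and a full piece inside
  makes their rank at least \<kappa>.\<close>

definition full_map :: "('x \<Rightarrow> 'x) \<Rightarrow> bool" where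
  "full_map a \<longleftrightarrow> a \<in> X \<rightarrow> X \<and> (\<forall>Q\<in>\<Q>. \<forall>x\<in>Q. \<forall>y\<in>Q. a x = a y) \<and>
     {(x, y). x \<in> X \<and> y \<in> X \<and> a x = a y} \<in> \<E> \<and> (\<forall>j\<in>a ` X. \<exists>G\<in>\<Q>. full G \<and> G \<subseteq> fib a j)"

lemma kernel_controlled:
  assumes "near (g \<circ> a) id"
  shows "{(x, y). x \<in> X \<and> y \<in> X \<and> a x = a y} \<in> \<E>"
proof -
  obtain N where N: "N \<in> \<E>" "\<And>x. x \<in> X \<Longrightarrow> (g (a x), x) \<in> N"
    using assms nearE by (metis comp_apply id_apply)
  have "{(x, y). x \<in> X \<and> y \<in> X \<and> a x = a y} \<subseteq> N\<inverse> O N"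
    using N(2) by (smt (verit) case_prodE converse_iff mem_Collect_eq relcomp.simps subsetI)
  then show ?thesis
    using subset_closed comp_closed converse_closed N(1) by blast
qed

text \<open>
  A coarse equivalence \<open>f\<close> is represented by \<open>a\<close>, up to the coarse retraction \<open>b\<close> of \<open>X\<close> onto the image of
  \<open>a\<close>.  All fibres of \<open>a\<close> and \<open>b\<close> have the same rank, which allows them to be matched unitarily.
\<close>

lemma full_factorization:
  assumes fg: "coarse_inverses f g"
  obtains a b where "full_map a" "full_map b" "a ` X = b ` X" "near a f" "near b id"
proof -
  obtain c where "base_map c"
    by (rule ex_base_map)
  then have cX: "c \<in> X \<rightarrow> X" and cid: "near c id" and cc: "\<And>x. x \<in> X \<Longrightarrow> c (c x) = c x"
    and cQ: "\<And>Q x y. Q \<in> \<Q> \<Longrightarrow> x \<in> Q \<Longrightarrow> y \<in> Q \<Longrightarrow> c x = c y"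
    and cG: "\<And>x. x \<in> X \<Longrightarrow> \<exists>G\<in>\<Q>. full G \<and> (\<forall>z\<in>G. c z = c x)"
    unfolding base_map_def by blast+
  have f: "f \<in> X \<rightarrow> X" "controlled f" and g: "g \<in> X \<rightarrow> X" "controlled g"
    and fgid: "near (f \<circ> g) id" and gfid: "near (g \<circ> f) id"
    using fg by (auto simp: coarse_inverses_def)
  \<comment> \<open>The inner \<open>c\<close> makes \<open>a\<close> constant on pieces and puts
    full pieces into its fibres; the outer \<open>c\<close> places its image among the fixed points
    of \<open>c\<close>.\<close>
  define a where "a = c \<circ> (f \<circ> c)"
  have aX: "a \<in> X \<rightarrow> X"
    unfolding a_def using cX f by (simp add: Pi_iff)
  have af: "near a f"
  proof -
    have "f \<circ> c \<in> X \<rightarrow> X"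
      using cX f by auto
    then have "near (c \<circ> (f \<circ> c)) (id \<circ> (f \<circ> c))"
      using cid by (intro near_comp_right)
    moreover have "near (f \<circ> c) (f \<circ> id)"
      using cid f(2) by (rule near_comp_left)
    ultimately show ?thesis
      unfolding a_def using near_trans by simp
  qed
  have agid: "near (a \<circ> g) id"
    using near_trans [OF near_comp_right [OF af g(1)] fgid] .
  have gaid: "near (g \<circ> a) id"
    using near_trans [OF near_comp_left [OF af g(2)] gfid] .
  \<comment> \<open>If \<open>c x\<close> misses the image of \<open>a\<close>, then
    \<open>a (g (c x))\<close> is a nearby point of that image. On the image itself \<open>b\<close>
    is the identity, so both images coincide, and since \<open>b x\<close> depends only on
    \<open>c x\<close>, its fibres also contain full pieces.\<close>
  define b where "b x = (if c x \<in> a ` X then c x else a (g (c x)))" for x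
  have bX: "b \<in> X \<rightarrow> X"
    unfolding b_def using cX aX g by (simp add: Pi_iff)
  have bid: "near b id"
  proof -
    obtain N where N: "N \<in> \<E>" "\<And>x. x \<in> X \<Longrightarrow> (a (g x), x) \<in> N"
      using agid nearE by (metis comp_apply id_apply)
    have "near b c"
    proof (rule nearI [OF union_closed [OF N(1) diagonal]])
      show "(b x, c x) \<in> N \<union> Id_on X" if "x \<in> X" for x
        using that cX N(2) by (auto simp: b_def)
    qed
    then show ?thesis
      using cid near_trans by blast
  qed
  have aim: "c j = j" if "j \<in> a ` X" for j
    using that cX f cc by (auto simp: a_def)
  have im: "a ` X = b ` X"
  proof
    show "b ` X \<subseteq> a ` X"
      unfolding b_def using cX g by auto
    show "a ` X \<subseteq> b ` X"
    proof
      fix j assume "j \<in> a ` X"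
      moreover from this have "j \<in> X" "b j = j"
        using aX aim by (auto simp: b_def)
      ultimately show "j \<in> b ` X"
        by (metis imageI)
    qed
  qed
  have Gsub: "G \<subseteq> X" if "G \<in> \<Q>" for G
    using that piece(1) measurable_subset by blast
  have "full_map a"
    unfolding full_map_def
  proof (intro conjI ballI)
    show "a x = a y" if "Q \<in> \<Q>" "x \<in> Q" "y \<in> Q" for Q x y
      using cQ [OF that] by (simp add: a_def)
    show "\<exists>G\<in>\<Q>. full G \<and> G \<subseteq> fib a j" if j: "j \<in> a ` X" for j
    proof -
      obtain x where x: "x \<in> X" "j = a x"
        using j by blast
      obtain G where "G \<in> \<Q>" "full G" "\<forall>z\<in>G. c z = c x"
        using cG [OF x(1)] by blast
      then show ?thesis
        using Gsub x by (intro bexI [of _ G]) (auto simp: fib_def a_def)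
    qed
  qed (use aX kernel_controlled [OF gaid] in auto)
  moreover have "full_map b"
    unfolding full_map_def
  proof (intro conjI ballI)
    show "b x = b y" if "Q \<in> \<Q>" "x \<in> Q" "y \<in> Q" for Q x y
      using cQ [OF that] by (simp add: b_def)
    have "near (id \<circ> b) id"
      using bid by simp
    then show "{(x, y). x \<in> X \<and> y \<in> X \<and> b x = b y} \<in> \<E>"
      by (rule kernel_controlled)
    show "\<exists>G\<in>\<Q>. full G \<and> G \<subseteq> fib b j" if "j \<in> b ` X" for j
    proof -
      have j: "j \<in> a ` X" "j \<in> X"
        using that im bX by auto
      obtain G where "G \<in> \<Q>" "full G" "\<forall>z\<in>G. c z = c j"
        using cG [OF j(2)] by blast
      then show ?thesis
        using Gsub j aim by (intro bexI [of _ G]) (auto simp: fib_def b_def)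
    qed
  qed (use bX in auto)
  ultimately show thesis
    using that im af bid by blast
qed

context
  fixes a
  assumes a: "full_map a"
begin

lemma fib_measurable: "fib a j \<in> \<AA>"
proof (rule saturated_measurable)
  show "Q \<subseteq> fib a j \<or> Q \<inter> fib a j = {}" if "Q \<in> \<Q>" for Q
    using that a piece(1) [OF that] measurable_subset unfolding full_map_def fib_def by blast
qed (auto simp: fib_def)

lemma fib_full: "j \<in> a ` X \<Longrightarrow> full (fib a j)"
  using a full_mono fib_measurable unfolding full_map_def by blast

lemma fib_bounded: "coarsely_bounded \<E> (fib a j)"
proof -
  have "fib a j \<times> fib a j \<subseteq> {(x, y). x \<in> X \<and> y \<in> X \<and> a x = a y}"
    by (auto simp: fib_def)
  then show ?thesis
    using a subset_closed unfolding full_map_def coarsely_bounded_def by blast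
qed

lemma piece_in_fib:
  assumes "Q \<in> \<Q>" obtains j where "j \<in> a ` X" "Q \<subseteq> fib a j"
proof -
  obtain x where x: "x \<in> Q"
    using piece_nonempty [OF assms] by blast
  have "Q \<subseteq> X"
    using piece(1) [OF assms] measurable_subset by blast
  then have "Q \<subseteq> fib a (a x)" "a x \<in> a ` X"
    using a x assms unfolding full_map_def fib_def by blast+
  then show thesis
    using that by blast
qed

lemma fib_disjoint: "i \<noteq> j \<Longrightarrow> fib a i \<inter> fib a j = {}"
  by (auto simp: fib_def)

lemma fib_basis_other:
  assumes "e \<in> proj_basis (P (fib a i))" "i \<noteq> j"
  shows "P (fib a j) e = 0"
proof -
  have "P (fib a j) e = P (fib a j) (P (fib a i) e)"
    using assms proj_basis_fixed proj fib_measurable by metis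
  then show ?thesis
    using assms(2) fib_disjoint [of j i] by (simp add: P_P_disjoint fib_measurable)
qed

lemma fib_basis_orthogonal:
  assumes "e \<in> proj_basis (P (fib a i))" "e' \<in> proj_basis (P (fib a j))"
  shows "cinner e e' = (if i = j \<and> e = e' then 1 else 0)"
proof (cases "i = j")
  case True
  then show ?thesis
    using assms proj_basis [OF proj [OF fib_measurable]] unfolding orthonormal_basis_of_def by auto
next
  case False
  have "cinner e e' = cinner (P (fib a i) e) e'"
    using assms(1) proj_basis_fixed proj fib_measurable by metis
  also have "\<dots> = 0"
    using False fib_basis_other [OF assms(2), of i]
      by (simp add: P_cinner fib_measurable cinner.zero_right)
  finally show ?thesis
    using False by simp
qed

text \<open>A vector orthogonal to all these bases has zero component in each fibre and so in each
  piece, as every piece lies in a single fibre.\<close>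

lemma fib_basis_total: "closure (cspan (\<Union>j\<in>a ` X. proj_basis (P (fib a j)))) = UNIV"
proof -
  have "orthonormal_basis_of UNIV (\<Union>j\<in>a ` X. proj_basis (P (fib a j)))"
    (is "orthonormal_basis_of _ ?B")
  proof (rule orthonormal_basis_ofI)
    show "orthonormal ?B"
      unfolding orthonormal_def
    proof (intro ballI)
      fix e e' assume e: "e \<in> ?B" "e' \<in> ?B"
      then obtain i j where ij: "e \<in> proj_basis (P (fib a i))" "e' \<in> proj_basis (P (fib a j))"
        by blast
      have "e \<noteq> e'" if "i \<noteq> j"
        using fib_basis_orthogonal [OF ij(1) ij(1)] fib_basis_orthogonal [OF ij] that by auto
      then show "cinner e e' = (if e = e' then 1 else 0)"
        using fib_basis_orthogonal [OF ij] by auto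
    qed
    fix x assume x: "\<And>b. b \<in> ?B \<Longrightarrow> cinner b x = 0"
    have z: "P (fib a j) x = 0" if j: "j \<in> a ` X" for j
    proof (rule orthonormal_basis_of_orth [OF proj_basis [OF proj [OF fib_measurable]]])
      show "P (fib a j) x \<in> range (blinfun_apply (P (fib a j)))"
        by simp
      fix b assume b: "b \<in> proj_basis (P (fib a j))"
      then have "cinner b (P (fib a j) x) = cinner b x"
        using proj_basis_fixed [OF proj [OF fib_measurable] b] P_cinner [OF fib_measurable, of j b
          x]
        by simp
      then show "cinner b (P (fib a j) x) = 0"
        using x b j by auto
    qed
    show "x = 0"
    proof (rule eq_zeroI)
      fix Q assume Q: "Q \<in> \<Q>"
      then obtain j where "j \<in> a ` X" "Q \<subseteq> fib a j"
        by (rule piece_in_fib)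
      then show "P Q x = 0"
        using z P_P_subset(1) [OF piece(1) [OF Q] fib_measurable, of j x] by simp
    qed
  qed auto
  then show ?thesis
    by (simp add: orthonormal_basis_of_iff)
qed

end

lemma rank_le: "A \<in> \<AA> \<Longrightarrow> coarsely_bounded \<E> A \<Longrightarrow> |proj_basis (P A)| \<le>o \<kappa>"
  using local_rank by (auto simp: local_rank_at_most_def proj_rank_eq)

text \<open>\<kappa> sits between the rank of a bounded set and that of a full set. Used in both
  directions, this yields a bijection of bases by Cantor-Bernstein, without any cardinal
  arithmetic.\<close>

lemma fib_basis_card_le:
  assumes "full_map a" "full_map b" "i \<in> a ` X"
  shows "|proj_basis (P (fib b j))| \<le>o |proj_basis (P (fib a i))|"
  using rank_le [OF fib_measurable fib_bounded, OF assms(2,2)] fib_full [OF assms(1,3)]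
  unfolding full_def proj_rank_eq using ordLeq_transitive by blast

text \<open>Both maps have the same image, so their fibres share one index set; the block structure
  obtained here confines the support of \<open>u\<close> to the pairs with
  \<open>b y = a x\<close>.\<close>

lemma ex_intertwining_unitary:
  assumes a: "full_map a" and b: "full_map b" and ab: "a ` X = b ` X"
  obtains u where "unitary u" "\<And>j h. j \<in> a ` X \<Longrightarrow> u (P (fib a j) h) = P (fib b j) (u h)"
proof -
  let ?J = "a ` X"
  let ?B = "\<lambda>j. proj_basis (P (fib a j))" and ?C = "\<lambda>j. proj_basis (P (fib b j))"
  have "\<exists>\<sigma>. bij_betw \<sigma> (?B j) (?C j)" if "j \<in> ?J" for j
    unfolding card_of_ordIso ordIso_iff_ordLeq
    using that ab fib_basis_card_le [OF a b, of j j] fib_basis_card_le [OF b a, of j j] by auto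
  then obtain \<sigma> where \<sigma>: "\<And>j. j \<in> ?J \<Longrightarrow> bij_betw (\<sigma> j) (?B j) (?C j)"
    by metis
  have \<sigma>C: "\<sigma> j e \<in> ?C j" if "j \<in> ?J" "e \<in> ?B j" for j e
    using \<sigma> that bij_betwE by blast
  define I where "I = Sigma ?J ?B"
  have gram: "cinner (snd i) (snd k) = cinner (\<sigma> (fst i) (snd i)) (\<sigma> (fst k) (snd k))"
    if "i \<in> I" "k \<in> I" for i k
  proof -
    obtain j e where i: "i = (j, e)" "j \<in> ?J" "e \<in> ?B j"
      using \<open>i \<in> I\<close> unfolding I_def by blast
    obtain l e' where k: "k = (l, e')" "l \<in> ?J" "e' \<in> ?B l"
      using \<open>k \<in> I\<close> unfolding I_def by blast
    have "\<sigma> j e = \<sigma> j e' \<longleftrightarrow> e = e'" if "j = l"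
      using \<sigma> [OF i(2)] i k that by (metis bij_betw_imp_inj_on inj_on_eq_iff)
    then show ?thesis
      using fib_basis_orthogonal [OF a i(3) k(3)]
        fib_basis_orthogonal [OF b \<sigma>C [OF i(2,3)] \<sigma>C [OF k(2,3)]] by (auto simp: i(1) k(1))
  qed
  have "snd ` I = (\<Union>j\<in>?J. ?B j)"
    unfolding I_def by force
  then have tot: "closure (cspan (snd ` I)) = UNIV"
    using fib_basis_total [OF a] by simp
  obtain u where u: "u \<in> bops" "\<And>x y. cinner (u x) (u y) = cinner x y"
    "\<And>i. i \<in> I \<Longrightarrow> u (snd i) = \<sigma> (fst i) (snd i)"
    using isometric_extension [OF gram tot] by metis
  have ue: "u e = \<sigma> j e" if "j \<in> ?J" "e \<in> ?B j" for j e
    using u(3) [of "(j, e)"] that by (simp add: I_def)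
  have "unitary u"
  proof (rule unitaryI [OF u(1,2)])
    show "closure (cspan (\<Union>j\<in>b ` X. ?C j)) = UNIV"
      by (rule fib_basis_total [OF b])
    show "(\<Union>j\<in>b ` X. ?C j) \<subseteq> range (blinfun_apply u)"
    proof clarify
      fix x e' assume "x \<in> X" "e' \<in> ?C (b x)"
      moreover have "b x \<in> ?J"
        using \<open>x \<in> X\<close> ab by simp
      ultimately obtain e where "e \<in> ?B (b x)" "e' = \<sigma> (b x) e"
        using \<sigma> by (metis bij_betw_imp_surj_on imageE)
      then show "e' \<in> range (blinfun_apply u)"
        using ue [OF \<open>b x \<in> ?J\<close>] by (metis rangeI)
    qed
  qed
  moreover have "u (P (fib a j) h) = P (fib b j) (u h)" for j h
  proof -
    have "u o\<^sub>L P (fib a j) = P (fib b j) o\<^sub>L u"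
    proof (rule bops_eqI [OF _ _ fib_basis_total [OF a]])
      fix e assume "e \<in> (\<Union>j\<in>?J. ?B j)"
      then obtain i where i: "i \<in> ?J" "e \<in> ?B i"
        by blast
      show "(u o\<^sub>L P (fib a j)) e = (P (fib b j) o\<^sub>L u) e"
      proof (cases "i = j")
        case True
        then show ?thesis
          using i \<sigma>C [OF i] proj_basis_fixed [OF proj [OF fib_measurable]] a b
          by (simp add: ue)
      next
        case False
        then show ?thesis
          using i \<sigma>C [OF i] fib_basis_other a b by (simp add: ue)
      qed
    qed (use u fib_measurable a b in auto)
    then show ?thesis
      by (metis blinfun_apply_blinfun_compose)
  qed
  ultimately show thesis
    using that by blast
qed

lemma ex_covering_unitary:
  assumes fg: "coarse_inverses f g"
  obtains u where "unitary u" "covers X \<E> \<AA> P u (map_class f)"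
proof -
  obtain a b where a: "full_map a" and b: "full_map b" and ab: "a ` X = b ` X"
    and af: "near a f" and bid: "near b id"
    using full_factorization [OF fg] by metis
  obtain u where u: "unitary u" "\<And>j h. j \<in> a ` X \<Longrightarrow> u (P (fib a j) h) = P (fib b j) (u h)"
    using ex_intertwining_unitary [OF a b ab] by metis
  note ma = fib_measurable [OF a] and mb = fib_measurable [OF b]
  \<comment> \<open>\<open>S\<close> is the union of the blocks \<open>fib b j\<close> times
    \<open>fib a j\<close>. The unitary is nonzero on each block, so every relation supporting
    \<open>u\<close> meets each of them, and the controlled kernels of \<open>b\<close> and
    \<open>a\<close> spread such a point over the block; this gives minimality.\<close>
  define S where "S = {(y, x). y \<in> X \<and> x \<in> X \<and> b y = a x}"
  have SX: "S \<subseteq> X \<times> X"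
    by (auto simp: S_def)
  have f: "f \<in> X \<rightarrow> X" "controlled f"
    using fg by (auto simp: coarse_inverses_def)
  have supp: "supp_in \<AA> P u S"
    unfolding supp_in_def
  proof (intro ballI impI)
    fix B A assume AB: "B \<in> \<AA>" "A \<in> \<AA>" and sep: "separated S B A"
    show "P B o\<^sub>L u o\<^sub>L P A = 0"
    proof (rule sandwich_eq_zeroI)
      fix Q h assume Q: "Q \<in> \<Q>"
      note mQ = piece(1) [OF Q]
      obtain j where j: "j \<in> a ` X" "Q \<subseteq> fib a j"
        using piece_in_fib [OF a Q] by metis
      have "P A (P Q h) = P (fib a j) (P (A \<inter> Q) h)"
      proof -
        have "A \<inter> Q \<in> \<AA>"
          using AB(2) mQ by (rule Int)
        then show ?thesis
          using P_P_subset(2) [OF _ ma, of "A \<inter> Q" j h] AB mQ j(2) by (simp add: P_P le_infI2)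
      qed
      then have "P B (u (P A (P Q h))) = P B (P (fib b j) (u (P (A \<inter> Q) h)))"
        using u(2) [OF j(1)] by simp
      also have "\<dots> = P (B \<inter> fib b j) (u (P (A \<inter> Q) h))"
        using AB mb by (simp add: P_P)
      also have "\<dots> = 0"
      proof (cases "A \<inter> Q = {}")
        case False
        then obtain x where x: "x \<in> A" "x \<in> X" "a x = j"
          using j(2) by (auto simp: fib_def)
        have "B \<inter> fib b j = {}"
        proof (rule ccontr)
          assume "B \<inter> fib b j \<noteq> {}"
          then obtain y where "y \<in> B" "y \<in> X" "b y = j"
            by (auto simp: fib_def)
          then have "(y, x) \<in> S"
            using x by (simp add: S_def)
          then show False
            using sep \<open>y \<in> B\<close> x(1) unfolding separated_def rapp_def by blast
        qed
        then show ?thesis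
          by (simp add: proj_empty)
      qed (simp add: proj_empty)
      finally show "P B (u (P A (P Q h))) = 0" .
    qed
  qed
  have min: "coarse_le \<E> S R" if R: "R \<subseteq> X \<times> X" "supp_in \<AA> P u R" for R
  proof (rule coarse_leI)
    show "S \<subseteq> {(x, y). x \<in> X \<and> y \<in> X \<and> b x = b y} O R O {(x, y). x \<in> X \<and> y \<in> X \<and> a x = a y}"
    proof clarify
      fix y x assume "(y, x) \<in> S"
      then have yx: "y \<in> X" "x \<in> X" "b y = a x"
        by (auto simp: S_def)
      have j: "a x \<in> a ` X"
        using yx by simp
      have "P (fib a (a x)) \<noteq> 0"
        using fib_full [OF a j] by (simp add: full_def)
      then obtain h where h: "P (fib a (a x)) h \<noteq> 0"
        by (metis blinfun_eqI zero_blinfun.rep_eq)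
      have "P (fib b (a x)) (u (P (fib a (a x)) h)) = u (P (fib a (a x)) (P (fib a (a x)) h))"
        using u(2) [OF j] by simp
      also have "\<dots> \<noteq> 0"
        using h ma unitary_norm [OF u(1)] by (metis P_P_same norm_eq_zero)
      finally have "P (fib b (a x)) o\<^sub>L u o\<^sub>L P (fib a (a x)) \<noteq> 0"
        by (metis blinfun_apply_blinfun_compose zero_blinfun.rep_eq)
      then have "\<not> separated R (fib b (a x)) (fib a (a x))"
        using R(2) ma mb unfolding supp_in_def by blast
      then obtain y' x' where "y' \<in> fib b (a x)" "x' \<in> fib a (a x)" "(y', x') \<in> R"
        unfolding separated_def rapp_def by blast
      then show "(y, x) \<in> {(x, y). x \<in> X \<and> y \<in> X \<and> b x = b y} O R O
          {(x, y). x \<in> X \<and> y \<in> X \<and> a x = a y}"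
        using yx by (intro relcompI [of y y'] relcompI [of y' x']) (auto simp: fib_def)
    qed
  qed (use a b in \<open>auto simp: full_map_def\<close>)
  obtain N where N: "N \<in> \<E>" "\<And>x. x \<in> X \<Longrightarrow> (a x, f x) \<in> N"
    using af nearE by blast
  obtain M where M: "M \<in> \<E>" "\<And>x. x \<in> X \<Longrightarrow> (b x, x) \<in> M"
    using bid nearE by (metis id_apply)
  have "coarse_le \<E> S (graph_rel X f)"
  proof (rule coarse_leI_graph_rel [OF _ SX])
    show "M\<inverse> O N \<in> \<E>"
      by (intro comp_closed converse_closed M N)
    fix x y assume "(y, x) \<in> S"
    then have "(y, b y) \<in> M\<inverse>" "(b y, f x) \<in> N"
      using M(2) [of y] N(2) [of x] by (simp_all add: S_def)
    then show "(y, f x) \<in> M\<inverse> O N"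
      by blast
  qed
  moreover have "coarse_le \<E> (graph_rel X f) S"
  proof (rule coarse_leI [OF diagonal])
    show "N\<inverse> O M \<in> \<E>"
      by (intro comp_closed converse_closed M N)
    show "graph_rel X f \<subseteq> (N\<inverse> O M) O S O Id_on X"
    proof clarify
      fix z x assume "(z, x) \<in> graph_rel X f"
      then have x: "x \<in> X" "z = f x"
        by (auto simp: graph_rel_def)
      \<comment> \<open>Equality of the images supplies a point \<open>y\<close> in the fibre of
        \<open>b\<close> over \<open>a x\<close>; it stands near \<open>f x\<close> since
        \<open>b\<close> is close to the identity and \<open>a\<close> to \<open>f\<close>.\<close>
      then obtain y where y: "y \<in> X" "a x = b y"
        using ab by blast
      have "(z, a x) \<in> N\<inverse>" "(a x, y) \<in> M" "(y, x) \<in> S" "(x, x) \<in> Id_on X"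
        using x y N(2) [OF x(1)] M(2) [OF y(1)] by (simp_all add: S_def Id_on_iff)
      then show "(z, x) \<in> (N\<inverse> O M) O S O Id_on X"
        by blast
    qed
  qed
  ultimately have "coarse_class X \<E> S = map_class f"
    unfolding map_class_def using SX graph_rel_subset [OF f(1)]
    by (simp add: coarse_class_eq_iff coarse_eq_def)
  then have "covers X \<E> \<AA> P u (map_class f)"
    unfolding covers_def using coarse_support_eqI [OF SX supp min] by simp
  then show thesis
    using that u(1) by blast
qed

section \<open>The homomorphism into the outer automorphism group\<close>

lemma rank_one_Roe_core:
  assumes A: "A \<in> \<AA>" "coarsely_bounded \<E> A" and h: "P A h = h" and k: "P A k = k"
  shows "rank_one h k \<in> Roe_core"
proof -
  have "tracks (rank_one h k) id"
    unfolding tracks_def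
  proof (intro conjI bexI [of _ "A \<times> A"] supported_alongI)
    show "A \<times> A \<in> \<E>"
      using A(2) by (simp add: coarsely_bounded_def)
    fix C B assume CB: "C \<in> \<AA>" "B \<in> \<AA>" "\<forall>c\<in>C. \<forall>b\<in>B. (c, id b) \<notin> A \<times> A"
    have "cinner k (P B z) *\<^sub>C P C h = 0" for z
    proof (cases "C \<inter> A = {}")
      case True
      then have "P C h = 0"
        using P_P_disjoint [OF CB(1) A(1) True, of h] h by simp
      then show ?thesis
        by (simp add: scaleC.zero_right)
    next
      case False
      then have "B \<inter> A = {}"
        using CB(3) by auto
      then have "P B k = 0"
        using P_P_disjoint [OF CB(2) A(1), of k] k by simp
      then show ?thesis
        using P_cinner [OF CB(2), of k z] by (simp add: cinner.zero_left scaleC.zero_left)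
    qed
    then show "P C o\<^sub>L rank_one h k o\<^sub>L P B = 0"
      using CB by (intro blinfun_eqI) (simp add: bops_scaleC)
  qed simp
  then show ?thesis
    by (simp add: Roe_core_def locally_compact_op_def compact_op_comp_left compact_op_comp_right
        compact_op_rank_one)
qed

text \<open>Each vector in the range of a bounded \<open>P A\<close> is an image under its own
  rank-one operator, and nondegeneracy of the module says that such vectors are total.\<close>

lemma coarse_algebra_nondegenerate:
  assumes "coarse_algebra R"
  shows "nondegenerate_algebra R"
proof -
  obtain E where E: "gauge_of X \<E> E"
    "closure (cspan (\<Union>A\<in>{A \<in> \<AA>. A \<times> A \<subseteq> E}. range (blinfun_apply (P A)))) = UNIV"
    using nondegenerate by blast
  have "(\<Union>A\<in>{A \<in> \<AA>. A \<times> A \<subseteq> E}. range (blinfun_apply (P A))) \<subseteq> {blinfun_apply t h |t h. t \<in> R}"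
    (is "?U \<subseteq> ?V")
  proof clarify
    fix A z assume A: "A \<in> \<AA>" "A \<times> A \<subseteq> E"
    define h where "h = P A z"
    have h: "P A h = h"
      using A by (simp add: h_def)
    have "coarsely_bounded \<E> A"
      using A E(1) subset_closed unfolding gauge_of_def coarsely_bounded_def by blast
    then have "rank_one h h \<in> Roe_core"
      using rank_one_Roe_core A h by blast
    then have R: "rank_one h h \<in> R"
      using assms unfolding coarse_algebra_def by blast
    \<comment> \<open>For \<open>h = 0\<close> the inverse is 0 by convention and both sides
      vanish.\<close>
    have "rank_one h h (complex_of_real (inverse ((norm h)\<^sup>2)) *\<^sub>C h) = h"
      by (cases "h = 0") (simp_all add: cinner_norm_sq scaleC.zero_right flip: of_real_power
        of_real_mult)
    then have "\<exists>k. h = rank_one h h k"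
      by metis
    then show "\<exists>t k. P A z = blinfun_apply t k \<and> t \<in> R"
      using R unfolding h_def by blast
  qed
  then have "closure (cspan ?U) \<subseteq> closure (cspan ?V)"
    by (rule closure_mono [OF complex_vector.span_mono])
  then show ?thesis
    unfolding nondegenerate_algebra_def E(2) by (rule top.extremum_uniqueI)
qed

context
  fixes R :: "('h \<Rightarrow>\<^sub>L 'h) set"
  assumes R: "coarse_algebra R"
begin

lemma star_R: "star_algebra R"
  using R by (simp add: coarse_algebra_def)

lemma Ad_automorphism:
  assumes "unitary u" "tracks u f" "coarse_inverses f g"
  shows "Ad R u \<in> star_automorphisms R"
proof (rule Ad_star_automorphism [OF star_R assms(1)])
  have conj: "u o\<^sub>L t o\<^sub>L adj u \<in> R" if "tracks u f" "coarse_inverses f g" "t \<in> R" for u t f g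
    using that R unfolding coarse_algebra_def by blast
  show "u o\<^sub>L t o\<^sub>L adj u \<in> R" if "t \<in> R" for t
    using conj assms that by blast
  show "adj u o\<^sub>L t o\<^sub>L u \<in> R" if "t \<in> R" for t
    using conj [OF tracks_adj [OF assms(2,3)] coarse_inverses_sym [OF assms(3)] that] assms(2)
    by (simp add: tracks_bops)
qed

lemma Out_class_Ad_eq:
  assumes u: "unitary u" "tracks u f" "coarse_inverses f g" and v: "unitary v" "tracks v f"
  shows "Out_class R (Ad R u) = Out_class R (Ad R v)"
proof -
  let ?m = "u o\<^sub>L adj v"
  have "tracks ?m (f \<circ> g)"
    using u(3) by (intro tracks_comp u tracks_adj [OF v(2) u(3)]) (simp add: coarse_inverses_def)
  then have "tracks ?m id"
    using u(3) by (auto simp: coarse_inverses_def intro: tracks_near)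
  then have m: "?m \<in> multipliers R" "unitary ?m"
    using R u(1) v(1) by (auto simp: coarse_algebra_def unitary_comp unitary_adj)
  have "?m o\<^sub>L v = u"
    using v(1) by (simp add: unitary_comp_simps)
  then have "Ad R u = Ad R ?m \<otimes>\<^bsub>Aut R\<^esub> Ad R v"
    using Ad_mult [OF star_R m(2) v(1) Ad_multiplier [OF star_R m(2,1)] Ad_automorphism [OF v u(3)]]
      by simp
  then show ?thesis
    using Out_class_eq_iff [OF star_R coarse_algebra_nondegenerate [OF R] Ad_automorphism [OF u]
        Ad_automorphism [OF v u(3)]] m by blast
qed

text \<open>The product \<open>u o\<^sub>L v\<close> tracks \<open>f \<circ> g\<close> just as
  \<open>w\<close> does, so independence of the chosen unitary lets it replace
  \<open>w\<close>.\<close>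

lemma Out_class_Ad_mult:
  assumes u: "unitary u" "tracks u f" "coarse_inverses f f'"
    and v: "unitary v" "tracks v g" "coarse_inverses g g'"
    and w: "unitary w" "tracks w (f \<circ> g)"
  shows "Out_class R (Ad R w) = Out_class R (Ad R u) \<otimes>\<^bsub>Out R\<^esub> Out_class R (Ad R v)"
proof -
  have uv: "tracks (u o\<^sub>L v) (f \<circ> g)"
    using u v by (intro tracks_comp) (auto simp: coarse_inverses_def)
  have "Out_class R (Ad R w) = Out_class R (Ad R (u o\<^sub>L v))"
    using w uv u v by (intro Out_class_Ad_eq [of w "f \<circ> g" "g' \<circ> f'"])
      (auto simp: coarse_inverses_comp unitary_comp)
  also have "\<dots> = Out_class R (Ad R u \<otimes>\<^bsub>Aut R\<^esub> Ad R v)"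
    using Ad_mult [OF star_R u(1) v(1) Ad_automorphism [OF u] Ad_automorphism [OF v]] by simp
  also have "\<dots> = Out_class R (Ad R u) \<otimes>\<^bsub>Out R\<^esub> Out_class R (Ad R v)"
    using Out_class_mult [OF star_R coarse_algebra_nondegenerate [OF R] Ad_automorphism [OF u]
      Ad_automorphism [OF v]]
    by simp
  finally show ?thesis .
qed

text \<open>
  If \<open>Ad u\<close> and \<open>Ad (m v)\<close> agree, then \<open>u h\<close> is a multiple of \<open>m (v h)\<close> for each \<open>h\<close> of bounded support.
  Since \<open>v h\<close> lives near the \<open>g\<close>-image and \<open>u h\<close> near the \<open>f\<close>-image of the support of \<open>h\<close>,
  quasi-locality of \<open>m\<close> keeps these images uniformly close.
\<close>

lemma near_if_Out_class_eq:
  assumes u: "unitary u" "tracks u f" "coarse_inverses f f'"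
    and v: "unitary v" "tracks v g" "coarse_inverses g g'"
    and eq: "Out_class R (Ad R u) = Out_class R (Ad R v)" and ql: "multipliers R \<subseteq> Cql \<E> \<AA> P"
  shows "near f g"
proof -
  obtain m where m: "unitary m" "m \<in> multipliers R" "Ad R u = Ad R m \<otimes>\<^bsub>Aut R\<^esub> Ad R v"
    using eq Out_class_eq_iff [OF star_R coarse_algebra_nondegenerate [OF R] Ad_automorphism [OF u]
        Ad_automorphism [OF v]] by blast
  define w where "w = m o\<^sub>L v"
  have w: "unitary w"
    using m v by (simp add: w_def unitary_comp)
  have Adu: "Ad R u = Ad R w"
    unfolding w_def
    using Ad_mult [OF star_R m(1) v(1) Ad_multiplier [OF star_R m(1,2)] Ad_automorphism [OF v]] m(3)
      by simp
  \<comment> \<open>Any positive constant below 1 would do: unit vectors will force a corner of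
    \<open>m\<close> to have norm at least 1.\<close>
  have half: "(0::real) < 1 / 2"
    by simp
  obtain E where E: "E \<in> \<E>"
    "off_norm_le m (1 / 2) E"
    using CqlE [OF subsetD [OF ql m(2)] half] by blast
  obtain F where F: "F \<in> \<E>" "pushes u f F"
    using tracks_push [OF u(2)] by blast
  obtain F' where F': "F' \<in> \<E>" "pushes v g F'"
    using tracks_push [OF v(2)] by blast
  obtain c where c: "base_map c"
    by (rule ex_base_map)
  then obtain N where N: "N \<in> \<E>" "\<And>x. x \<in> X \<Longrightarrow> (c x, x) \<in> N"
    unfolding base_map_def by (metis id_apply nearE)
  \<comment> \<open>The factors follow the chain \<open>f x\<close>, \<open>f p\<close>,
    \<open>y\<close>, \<open>z\<close>, \<open>g q\<close>, \<open>g x\<close>, where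
    \<open>p\<close> and \<open>q\<close> lie in a full piece near \<open>x\<close>, while
    \<open>y\<close> and \<open>z\<close> lie in the sets into which \<open>u\<close> and
    \<open>v\<close> push that piece.\<close>
  let ?K = "map_prod f f ` (N\<inverse> O N) O F\<inverse> O E O F' O map_prod g g ` (N\<inverse> O N)"
  show "near f g"
  proof (rule nearI)
    show "?K \<in> \<E>"
      using u(3) v(3) by (intro comp_closed converse_closed controlledD E F F' N)
        (auto simp: coarse_inverses_def)
    fix x assume x: "x \<in> X"
    have "\<forall>x\<in>X. \<exists>G\<in>\<Q>. full G \<and> (\<forall>z\<in>G. c z = c x)"
      using c unfolding base_map_def by (elim conjE)
    then have "\<exists>G\<in>\<Q>. full G \<and> (\<forall>z\<in>G. c z = c x)"
      using x by (rule bspec)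
    then obtain G where G: "G \<in> \<Q>" "full G" "\<And>z. z \<in> G \<Longrightarrow> c z = c x"
      by blast
    have GA: "G \<in> \<AA>"
      by (rule piece(1) [OF G(1)])
    have "coarsely_bounded \<E> G"
      using piece(2) [OF G(1)] D_mem subset_closed unfolding coarsely_bounded_def by blast
    have xG: "(x, z) \<in> N\<inverse> O N" "(z, x) \<in> N\<inverse> O N" if "z \<in> G" for z
    proof -
      have "z \<in> X"
        using that measurable_subset [OF GA] by blast
      then have "(c x, x) \<in> N" "(c x, z) \<in> N"
        using N(2) x G(3) [OF that] by metis+
      then show "(x, z) \<in> N\<inverse> O N" "(z, x) \<in> N\<inverse> O N"
        by blast+
    qed
    have "P G \<noteq> 0"
      using G(2) by (simp add: full_def)
    then obtain k where k: "P G k \<noteq> 0"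
      by (metis blinfun_eqI zero_blinfun.rep_eq)
    define h where "h = complex_of_real (inverse (norm (P G k))) *\<^sub>C P G k"
    have h: "P G h = h" "cinner h h = 1"
      using k GA by (simp_all add: h_def bops_scaleC cinner_norm_sq norm_scaleC norm_inverse)
    have "rank_one h h \<in> R"
      using rank_one_Roe_core [OF GA \<open>coarsely_bounded \<E> G\<close> h(1) h(1)] R
        unfolding coarse_algebra_def by blast
    then have "u o\<^sub>L rank_one h h o\<^sub>L adj u = w o\<^sub>L rank_one h h o\<^sub>L adj w"
      using Adu by (metis Ad_apply)
    \<comment> \<open>Both sides are projections onto lines, spanned by \<open>u h\<close> and by
      \<open>w h\<close>; evaluating at \<open>u h\<close> shows that the lines agree.\<close>
    then have "(u o\<^sub>L rank_one h h o\<^sub>L adj u) (u h) = (w o\<^sub>L rank_one h h o\<^sub>L adj w) (u h)"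
      by simp
    then have uh: "u h = cinner h (adj w (u h)) *\<^sub>C w h"
      using u(1) h(2) by (simp add: bops_scaleC [OF unitary_bops [OF w]])
    have nh: "norm h = 1"
      using h(2) norm_ge_zero [of h] by (simp add: cinner_norm_sq power2_eq_1_iff
        flip: of_real_power)
    have \<lambda>: "cmod (cinner h (adj w (u h))) \<le> 1"
      using cmod_cinner_le [of h "adj w (u h)"] unitary_norm [OF unitary_adj [OF w]] unitary_norm
        [OF u(1)] nh
      by simp
    obtain C where C: "C \<in> \<AA>" "\<And>h. P C (u (P G h)) = u (P G h)" "\<And>y. y \<in> C \<Longrightarrow> \<exists>a\<in>G. (y, f a) \<in> F"
      using pushesD [OF F(2) GA] by blast
    obtain B where B: "B \<in> \<AA>" "\<And>h. P B (v (P G h)) = v (P G h)" "\<And>y. y \<in> B \<Longrightarrow> \<exists>a\<in>G. (y, g a) \<in> F'"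
      using pushesD [OF F'(2) GA] by blast
    have "u h = P C (u h)"
      using C(2) [of h] h(1) by simp
    also have "\<dots> = cinner h (adj w (u h)) *\<^sub>C (P C o\<^sub>L m o\<^sub>L P B) (v h)"
      using B(2) [of h] h(1) C(1) by (subst uh) (simp add: bops_scaleC w_def)
    finally have "norm (u h) \<le> 1 * norm ((P C o\<^sub>L m o\<^sub>L P B) (v h))"
      using \<lambda> by (metis mult_right_mono norm_ge_zero norm_scaleC)
    also have "\<dots> \<le> norm (P C o\<^sub>L m o\<^sub>L P B) * norm (v h)"
      unfolding mult_1 by (rule norm_blinfun)
    finally have "1 \<le> norm (P C o\<^sub>L m o\<^sub>L P B)"
      using nh unitary_norm [OF u(1)] unitary_norm [OF v(1)] by simp
    then have "\<not> norm (P C o\<^sub>L m o\<^sub>L P B) \<le> 1 / 2"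
      by linarith
    then obtain y z where yz: "y \<in> C" "z \<in> B" "(y, z) \<in> E"
      using off_norm_leD [OF E(2) C(1) B(1)] by blast
    obtain p where p: "p \<in> G" "(y, f p) \<in> F"
      using C(3) yz by blast
    obtain q where q: "q \<in> G" "(z, g q) \<in> F'"
      using B(3) yz by blast
    have "(f x, f p) \<in> map_prod f f ` (N\<inverse> O N)" "(g q, g x) \<in> map_prod g g ` (N\<inverse> O N)"
      using xG(1) [OF p(1)] xG(2) [OF q(1)] by (metis image_eqI map_prod_simp)+
    then show "(f x, g x) \<in> ?K"
      using p q yz by (meson converseI relcompI)
  qed
qed

end

end

theorem corollary7p20:
  fixes X :: "'x set" and \<E> :: "'x rel set" and \<AA> :: "'x set set"
    and P :: "'x set \<Rightarrow> ('h::chilbert_space \<Rightarrow>\<^sub>L 'h)" and \<kappa> :: "'k rel"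
    and \<R> :: "('h \<Rightarrow>\<^sub>L 'h) set"
  assumes "coarse_space X \<E>"
    and "Cnotzero \<kappa>"
    and "coarse_module X \<E> \<AA> P"
    and "discrete_module X \<E> \<AA> P"
    and "ample_module \<kappa> X \<E> \<AA> P"
    and "local_rank_at_most \<kappa> \<E> \<AA> P"
    and "\<R> \<in> {CRoe \<E> \<AA> P, Ccp \<E> \<AA> P, Cql \<E> \<AA> P}"
  shows "\<exists>\<Phi>. group_hom (CE X \<E>) (Out \<R>) \<Phi> \<and>
      (\<forall>F\<in>carrier (CE X \<E>).
         (\<exists>u. unitary u \<and> covers X \<E> \<AA> P u F) \<and>
         (\<forall>u. unitary u \<and> covers X \<E> \<AA> P u F \<longrightarrow>
              Ad \<R> u \<in> carrier (Aut \<R>) \<and> \<Phi> F = Out_class \<R> (Ad \<R> u))) \<and>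
      (multipliers \<R> \<subseteq> Cql \<E> \<AA> P \<longrightarrow> inj_on \<Phi> (carrier (CE X \<E>)))"
proof -
  obtain D \<Q> where D: "gauge_of X \<E> D" "partition_on X \<Q>" "\<forall>A\<in>\<Q>. A \<in> \<AA> \<and> A \<times> A \<subseteq> D"
    "\<forall>h. ((\<lambda>A. P A h) has_sum h) \<Q>" "\<forall>C\<subseteq>X. (\<forall>A\<in>\<Q>. C \<inter> A \<in> \<AA>) \<longrightarrow> C \<in> \<AA>"
    using assms(4) unfolding discrete_module_def by auto
  interpret coarse_module X \<E> \<AA> P
    by (fact assms)
  interpret uniform_rank_module X \<E> \<AA> P D \<Q> \<kappa>
    by unfold_locales (use D assms(5,6) in auto)
  have R: "coarse_algebra \<R>"
    using assms(7) by (rule coarse_algebra_cases)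
  define U where "U F = (SOME u. unitary u \<and> covers X \<E> \<AA> P u F)" for F
  define \<Phi> where "\<Phi> F = Out_class \<R> (Ad \<R> (U F))" for F
  have ex: "\<exists>u. unitary u \<and> covers X \<E> \<AA> P u F" if "F \<in> carrier (CE X \<E>)" for F
    using that ex_covering_unitary unfolding carrier_CE_iff by metis
  have U: "unitary (U F)" "covers X \<E> \<AA> P (U F) F" if "F \<in> carrier (CE X \<E>)" for F
    using someI_ex [OF ex [OF that]] unfolding U_def by auto
  have tr: "tracks u f" if "unitary u" "covers X \<E> \<AA> P u (map_class f)"
    "coarse_inverses f g" for u f g
    using that by (intro covers_tracks) (auto simp: coarse_inverses_def unitary_bops)
  \<comment> \<open>\<open>\<Phi>\<close> was defined by an arbitrary choice of covering unitaries.
    Any other covering unitary tracks the same representing function and so gives the same outer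
    class, which makes the map canonical.\<close>
  have well: "Ad \<R> u \<in> star_automorphisms \<R>" "\<Phi> F = Out_class \<R> (Ad \<R> u)"
    if F: "F \<in> carrier (CE X \<E>)" and u: "unitary u" "covers X \<E> \<AA> P u F" for F u
  proof -
    obtain f g where fg: "coarse_inverses f g" "F = map_class f"
      using F unfolding carrier_CE_iff by blast
    have "tracks u f" "tracks (U F) f"
      using tr [OF _ _ fg(1)] u U [OF F] fg(2) by auto
    then show "Ad \<R> u \<in> star_automorphisms \<R>" "\<Phi> F = Out_class \<R> (Ad \<R> u)"
      unfolding \<Phi>_def using Ad_automorphism [OF R] Out_class_Ad_eq [OF R] u(1) U(1) [OF F] fg(1)
        by blast+
  qed
  have "group (Out \<R>)"
    unfolding Out_def
    using Inn_normal [OF star_R [OF R] coarse_algebra_nondegenerate [OF R]]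
      by (rule normal.factorgroup_is_group)
  moreover have "\<Phi> \<in> hom (CE X \<E>) (Out \<R>)"
  proof (rule homI)
    show "\<Phi> F \<in> carrier (Out \<R>)" if "F \<in> carrier (CE X \<E>)" for F
      unfolding \<Phi>_def using Out_class_carrier well(1) [OF that U [OF that]] by blast
    fix F G assume F: "F \<in> carrier (CE X \<E>)" and G: "G \<in> carrier (CE X \<E>)"
    obtain f f' where f: "coarse_inverses f f'" "F = map_class f"
      using F unfolding carrier_CE_iff by blast
    obtain g g' where g: "coarse_inverses g g'" "G = map_class g"
      using G unfolding carrier_CE_iff by blast
    have FG: "F \<otimes>\<^bsub>CE X \<E>\<^esub> G = map_class (f \<circ> g)"
      using f g by (simp add: mult_CE coarse_inverses_def)
    have mem: "F \<otimes>\<^bsub>CE X \<E>\<^esub> G \<in> carrier (CE X \<E>)"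
      using group_CE F G by (simp add: group.is_monoid monoid.m_closed)
    show "\<Phi> (F \<otimes>\<^bsub>CE X \<E>\<^esub> G) = \<Phi> F \<otimes>\<^bsub>Out \<R>\<^esub> \<Phi> G"
      unfolding \<Phi>_def
    proof (rule Out_class_Ad_mult [OF R])
      show "tracks (U F) f" "tracks (U G) g"
        using tr [OF _ _ f(1)] tr [OF _ _ g(1)] U [OF F] U [OF G] f(2) g(2) by auto
      show "tracks (U (F \<otimes>\<^bsub>CE X \<E>\<^esub> G)) (f \<circ> g)"
        using tr [OF _ _ coarse_inverses_comp [OF f(1) g(1)]] U [OF mem] FG by simp
    qed (use U F G mem f g in auto)
  qed
  ultimately have "group_hom (CE X \<E>) (Out \<R>) \<Phi>"
    using group_CE by (simp add: group_hom_def group_hom_axioms_def)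
  moreover have "inj_on \<Phi> (carrier (CE X \<E>))" if ql: "multipliers \<R> \<subseteq> Cql \<E> \<AA> P"
  proof (rule inj_onI)
    fix F G assume F: "F \<in> carrier (CE X \<E>)" and G: "G \<in> carrier (CE X \<E>)" and eq: "\<Phi> F = \<Phi> G"
    obtain f f' where f: "coarse_inverses f f'" "F = map_class f"
      using F unfolding carrier_CE_iff by blast
    obtain g g' where g: "coarse_inverses g g'" "G = map_class g"
      using G unfolding carrier_CE_iff by blast
    have "tracks (U F) f" "tracks (U G) g"
      using tr [OF _ _ f(1)] tr [OF _ _ g(1)] U [OF F] U [OF G] f(2) g(2) by auto
    then have "near f g"
      using near_if_Out_class_eq [OF R U(1) [OF F] _ f(1) U(1) [OF G] _ g(1) _ ql] eq
        unfolding \<Phi>_def by blast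
    then show "F = G"
      using f g by (simp add: map_class_eq_iff coarse_inverses_def)
  qed
  ultimately show ?thesis
    using ex well by (intro exI [of _ \<Phi>]) auto
qed

end
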